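(* Let $\xi_k,\gamma_{jk},\beta_j\in\mathbb{C}$ ($1\leqslant j\leqslant d$, $1\leqslant k\leqslant r$) with $|\xi_k|\leqslant1$, $\Re\gamma_{jk}\geqslant0$, $\Re\beta_j>0$, and for each $j$ at least one $\Re\gamma_{jk}>0$; let $\delta(k)=1$ if $\xi_k=1$ and $0$ otherwise. Let $$\zeta_r((s_j);(\xi_k);(\gamma_{jk});(\beta_j))=\sum_{m_1=0}^\infty\cdots\sum_{m_r=0}^\infty\frac{\prod_{k=1}^r\xi_k^{m_k}}{\prod_{j=1}^d(\beta_j+\sum_{k=1}^r\gamma_{jk}m_k)^{s_j}},$$ continued meromorphically to $\mathbb{C}^d$, and let $\zeta_r^{\rm des}((s_j);(\xi_k);(\gamma_{jk});(\beta_j))$ be its desingularization (defined in the context). Assume there exist constants $c_{mj}\in\mathbb{C}$ ($1\leqslant m\leqslant r$, $1\leqslant j\leqslant d$) with $\sum_{j=1}^dc_{mj}\gamma_{jk}=\delta_{mk}$ (Kronecker delta) for all $1\leqslant k,m\leqslant r$. For indeterminates $\mathbf{u}=(u_j)$, $\mathbf{v}=(v_j)$ put $$G(\mathbf{u},\mathbf{v})=\prod_{k=1}^r\Bigl\{1-\delta(k)\Bigl(1+\sum_{j=1}^dc_{kj}(v_j^{-1}-\beta_j)\Bigr)\Bigl(\sum_{j=1}^d\gamma_{jk}u_jv_j\Bigr)\Bigr\}=\sum_{\mathbf{l},\mathbf{m}}\alpha_{\mathbf{l},\mathbf{m}}\prod_{j=1}^du_j^{l_j}v_j^{m_j},$$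 with $\mathbf{l}=(l_1,\dots,l_d)\in\mathbb{N}_0^d$, $\mathbf{m}=(m_1,\dots,m_d)\in\mathbb{Z}^d$ (a finite sum). Then $$\zeta_r^{\rm des}((s_j);(\xi_k);(\gamma_{jk});(\beta_j))=\sum_{\mathbf{l},\mathbf{m}}\alpha_{\mathbf{l},\mathbf{m}}\Bigl(\prod_{j=1}^d(s_j)_{l_j}\Bigr)\zeta_r((s_j+m_j);(\xi_k);(\gamma_{jk});(\beta_j)),$$ where $(s)_l=s(s+1)\cdots(s+l-1)$ (and $(s)_0=1$).
   Context: The desingularization is defined by $$\zeta_r^{\rm des}((s_j);(\xi_k);(\gamma_{jk});(\beta_j))=\lim_{c\to1}\frac{1}{\prod_{k=1}^r(1-\delta(k)c)}\cdot\frac{1}{\prod_{j=1}^d(e^{2\pi is_j}-1)\Gamma(s_j)}\int_{\mathcal{C}^d}\prod_{j=1}^dx_j^{s_j-1}e^{(\sum_k\gamma_{jk}-\beta_j)x_j}dx_j\prod_{k=1}^r\Bigl(\frac{1}{e^{\sum_j\gamma_{jk}x_j}-\xi_k}-\delta(k)\frac{c}{e^{c\sum_j\gamma_{jk}x_j}-1}\Bigr),$$ limit over real $c$, where $\mathcal{C}$ is the Hankel contour (from $+\infty$ along the upper side of the positive real axis, counterclockwise around a small circle about $0$, back along the lower side), with $\arg x=0$ on the upper and $2\pi$ on the lower side; it is an entire function of $(s_j)$. The identity is one of meromorphic functions on $\mathbb{C}^d$.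
   Formalization: The desingularization is required to be given by a contour integral that avoids the poles and does not depend on the small radius; this excludes |ξ_k|=1 with some nonzero purely imaginary γ_jk, where poles lie on the contour for every radius and the defining integral has no meaning. *)

theory Defs
  imports "HOL-Analysis.Analysis" "HOL-Library.Poly_Mapping"
begin

subsection \<open>Holomorphic and meromorphic functions of several complex variables\<close>

definition mv_holomorphic_on :: "(complex^'d \<Rightarrow> complex) \<Rightarrow> (complex^'d) set \<Rightarrow> bool" where
  "mv_holomorphic_on f S \<longleftrightarrow> open S \<and>
     (\<forall>z\<in>S. \<exists>f'. (f has_derivative f') (at z) \<and> (\<forall>a v. f' (a *s v) = a * f' v))"

definition mv_regular_at :: "(complex^'d \<Rightarrow> complex) \<Rightarrow> complex^'d \<Rightarrow> bool" where
  "mv_regular_at f p \<longleftrightarrow> (\<exists>U. p \<in> U \<and> mv_holomorphic_on f U)"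

text \<open>
  A meromorphic function on \<open>\<complex>\<^sup>d\<close> is locally a quotient \<open>g / h\<close> of holomorphic functions with
  \<open>h\<close> not identically zero. It is represented by a total function whose values on the thin set
  where \<open>h\<close> vanishes are arbitrary; hence identities between such functions are only
  meaningful at points of regularity, which form a dense open set.
\<close>

definition mv_meromorphic :: "(complex^'d \<Rightarrow> complex) \<Rightarrow> bool" where
  "mv_meromorphic f \<longleftrightarrow>
     (\<forall>p. \<exists>U g h. connected U \<and> p \<in> U \<and> mv_holomorphic_on g U \<and> mv_holomorphic_on h U \<and>
        (\<exists>z\<in>U. h z \<noteq> 0) \<and> (\<forall>z\<in>U. h z \<noteq> 0 \<longrightarrow> f z = g z / h z))"

subsection \<open>The multiple zeta function of generalized Hurwitz--Lerch type\<close>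

text \<open>The bases have positive real part, so \<open>powr\<close> is the principal branch.\<close>

definition hl_term ::
  "complex^'r \<Rightarrow> complex^'r^'d \<Rightarrow> complex^'d \<Rightarrow> complex^'d \<Rightarrow> nat^'r \<Rightarrow> complex" where
  "hl_term \<xi> \<gamma> \<beta> s m =
     (\<Prod>k\<in>UNIV. (\<xi> $ k) ^ (m $ k)) /
     (\<Prod>j\<in>UNIV. (\<beta> $ j + (\<Sum>k\<in>UNIV. \<gamma> $ j $ k * of_nat (m $ k))) powr (s $ j))"

definition is_hl_zeta ::
  "complex^'r \<Rightarrow> complex^'r^'d \<Rightarrow> complex^'d \<Rightarrow> (complex^'d \<Rightarrow> complex) \<Rightarrow> bool" where
  "is_hl_zeta \<xi> \<gamma> \<beta> Z \<longleftrightarrow> mv_meromorphic Z \<and>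
     (\<forall>s. (\<lambda>m. norm (hl_term \<xi> \<gamma> \<beta> s m)) summable_on UNIV \<longrightarrow>
          Z s = (\<Sum>\<^sub>\<infinity>m. hl_term \<xi> \<gamma> \<beta> s m))"

subsection \<open>The Hankel contour\<close>

text \<open>
  The contour of radius \<open>\<epsilon>\<close> is parametrized by the real line: the upper side for \<open>t < 0\<close>
  (coming from infinity), the circle for \<open>0 \<le> t \<le> 2 * pi\<close>, the lower side for \<open>t > 2 * pi\<close>.
  Modulus and argument are kept separately since the two sides coincide as sets of points but
  carry the arguments \<open>0\<close> and \<open>2 * pi\<close>.
\<close>

definition hankel_abs :: "real \<Rightarrow> real \<Rightarrow> real" where
  "hankel_abs \<epsilon> t = (if t < 0 then \<epsilon> - t else if t \<le> 2 * pi then \<epsilon> else \<epsilon> + (t - 2 * pi))"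

definition hankel_arg :: "real \<Rightarrow> real" where
  "hankel_arg t = (if t < 0 then 0 else if t \<le> 2 * pi then t else 2 * pi)"

definition hankel :: "real \<Rightarrow> real \<Rightarrow> complex" where
  "hankel \<epsilon> t = rcis (hankel_abs \<epsilon> t) (hankel_arg t)"

definition hankel_deriv :: "real \<Rightarrow> real \<Rightarrow> complex" where
  "hankel_deriv \<epsilon> t =
     (if t < 0 then -1 else if t \<le> 2 * pi then \<i> * of_real \<epsilon> * cis t else 1)"

definition hankel_power :: "real \<Rightarrow> real \<Rightarrow> complex \<Rightarrow> complex" where
  "hankel_power \<epsilon> t a =
     exp (a * (of_real (ln (hankel_abs \<epsilon> t)) + \<i> * of_real (hankel_arg t)))"

subsection \<open>The desingularization\<close>

definition hl_delta :: "complex^'r \<Rightarrow> 'r \<Rightarrow> complex" where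
  "hl_delta \<xi> k = (if \<xi> $ k = 1 then 1 else 0)"

text \<open>
  For \<open>x = 1\<close> the singularity at \<open>y = 0\<close> is removable: both
  \<open>1 / (exp y - 1)\<close> and \<open>c / (exp (c * y) - 1)\<close> have principal part \<open>1 / y\<close>, and the
  difference has the limit \<open>(c - 1) / 2\<close>.
\<close>

definition des_factor :: "real \<Rightarrow> complex \<Rightarrow> complex \<Rightarrow> complex" where
  "des_factor c x y =
     (if x = 1 then
        (if y = 0 then (of_real c - 1) / 2
         else 1 / (exp y - 1) - of_real c / (exp (of_real c * y) - 1))
      else 1 / (exp y - x))"

text \<open>\<open>\<Sum>\<^sub>j \<gamma>\<^sub>j\<^sub>k x\<^sub>j\<close> at a point of the product contour:\<close>

definition hankel_lin :: "complex^'r^'d \<Rightarrow> real \<Rightarrow> real^'d \<Rightarrow> 'r \<Rightarrow> complex" where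
  "hankel_lin \<gamma> \<epsilon> t k = (\<Sum>j\<in>UNIV. \<gamma> $ j $ k * hankel \<epsilon> (t $ j))"

definition des_integrand ::
  "complex^'r \<Rightarrow> complex^'r^'d \<Rightarrow> complex^'d \<Rightarrow> complex^'d \<Rightarrow> real \<Rightarrow> real \<Rightarrow> real^'d \<Rightarrow> complex"
  where
  "des_integrand \<xi> \<gamma> \<beta> s c \<epsilon> t =
     (\<Prod>j\<in>UNIV. hankel_power \<epsilon> (t $ j) (s $ j - 1) *
        exp (((\<Sum>k\<in>UNIV. \<gamma> $ j $ k) - \<beta> $ j) * hankel \<epsilon> (t $ j)) * hankel_deriv \<epsilon> (t $ j)) *
     (\<Prod>k\<in>UNIV. des_factor c (\<xi> $ k) (hankel_lin \<gamma> \<epsilon> t k))"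

text \<open>No pole of the integrand lies on the product contour of radius \<open>\<epsilon>\<close>.\<close>

definition hankel_avoids_poles :: "complex^'r \<Rightarrow> complex^'r^'d \<Rightarrow> real \<Rightarrow> real \<Rightarrow> bool" where
  "hankel_avoids_poles \<xi> \<gamma> c \<epsilon> \<longleftrightarrow>
     (\<forall>(t :: real^'d) k.
        (if \<xi> $ k = 1 then
           hankel_lin \<gamma> \<epsilon> t k \<noteq> 0 \<longrightarrow>
             exp (hankel_lin \<gamma> \<epsilon> t k) \<noteq> 1 \<and> exp (of_real c * hankel_lin \<gamma> \<epsilon> t k) \<noteq> 1
         else exp (hankel_lin \<gamma> \<epsilon> t k) \<noteq> \<xi> $ k))"

text \<open>
  \<open>I\<close> is the value of the integral over the \<open>d\<close>-fold product of the Hankel contour: for all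
  sufficiently small radii the contour avoids the poles and the integral converges
  absolutely, with value independent of the radius.
\<close>

definition has_des_integral ::
  "complex^'r \<Rightarrow> complex^'r^'d \<Rightarrow> complex^'d \<Rightarrow> complex^'d \<Rightarrow> real \<Rightarrow> complex \<Rightarrow> bool" where
  "has_des_integral \<xi> \<gamma> \<beta> s c I \<longleftrightarrow>
     (\<forall>\<^sub>F \<epsilon> in at_right 0. hankel_avoids_poles \<xi> \<gamma> c \<epsilon> \<and>
        has_bochner_integral lborel (des_integrand \<xi> \<gamma> \<beta> s c \<epsilon>) I)"

text \<open>
  The factor \<open>(exp (2 * pi * \<i> * s) - 1) * Gamma s\<close> vanishes or is indeterminate at the
  integers, so the defining formula is required at non-integral \<open>s\<^sub>j\<close>, and the
  desingularization is the entire function extending it.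
\<close>

definition is_hl_desingularization ::
  "complex^'r \<Rightarrow> complex^'r^'d \<Rightarrow> complex^'d \<Rightarrow> (complex^'d \<Rightarrow> complex) \<Rightarrow> bool" where
  "is_hl_desingularization \<xi> \<gamma> \<beta> D \<longleftrightarrow> mv_holomorphic_on D UNIV \<and>
     (\<forall>s. (\<forall>j. s $ j \<notin> \<int>) \<longrightarrow>
        (\<exists>I. (\<forall>\<^sub>F c in at 1. has_des_integral \<xi> \<gamma> \<beta> s c (I c)) \<and>
             ((\<lambda>c. 1 / (\<Prod>k\<in>UNIV. 1 - hl_delta \<xi> k * of_real c) *
                   (1 / (\<Prod>j\<in>UNIV. (exp (2 * of_real pi * \<i> * s $ j) - 1) * Gamma (s $ j))) *
                   I c) \<longlongrightarrow> D s) (at 1)))"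

subsection \<open>The generating Laurent polynomial\<close>

text \<open>
  Polynomials in the \<open>u\<^sub>j\<close> and Laurent polynomials in the \<open>v\<^sub>j\<close>, as the monoid algebra over
  the exponents \<open>(l, m)\<close>; the coefficient of \<open>\<Prod>\<^sub>j u\<^sub>j\<^bsup>l\<^sub>j\<^esup> v\<^sub>j\<^bsup>m\<^sub>j\<^esup>\<close> in \<open>G\<close> is
  \<open>lookup G (l, m)\<close>.
\<close>

type_synonym 'd laurent = "((nat^'d) \<times> (int^'d)) \<Rightarrow>\<^sub>0 complex"

definition L_const :: "complex \<Rightarrow> 'd::finite laurent" where
  "L_const a = Poly_Mapping.single 0 a"

definition L_u :: "'d::finite \<Rightarrow> 'd laurent" where
  "L_u j = Poly_Mapping.single (axis j 1, 0) 1"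

definition L_v :: "'d::finite \<Rightarrow> 'd laurent" where
  "L_v j = Poly_Mapping.single (0, axis j 1) 1"

definition L_v_inv :: "'d::finite \<Rightarrow> 'd laurent" where
  "L_v_inv j = Poly_Mapping.single (0, axis j (-1)) 1"

definition hl_G ::
  "complex^'r \<Rightarrow> complex^'r^'d \<Rightarrow> complex^'d \<Rightarrow> complex^'d^'r \<Rightarrow> 'd::finite laurent" where
  "hl_G \<xi> \<gamma> \<beta> C =
     (\<Prod>k\<in>UNIV. 1 - L_const (hl_delta \<xi> k) *
        (1 + (\<Sum>j\<in>UNIV. L_const (C $ k $ j) * (L_v_inv j - L_const (\<beta> $ j)))) *
        (\<Sum>j\<in>UNIV. L_const (\<gamma> $ j $ k) * L_u j * L_v j))"

end

theory Submission
  imports Defs "HOL-Complex_Analysis.Conformal_Mappings" "HOL-Real_Asymp.Real_Asymp"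
begin

text \<open>
  Both sides are meromorphic, so it suffices to compare them where all \<open>Re s\<^sub>j\<close> are large. There
  the Hankel contours can be shrunk onto the positive axes, \<open>c \<rightarrow> 1\<close> turns each factor with
  \<open>\<xi>\<^sub>k = 1\<close> into a derivative, and with \<open>y\<^sub>k = \<Sum>\<^sub>j \<gamma>\<^sub>j\<^sub>k x\<^sub>j\<close> the remaining product is
  \<open>\<Prod>\<^sub>k \<Sum>\<^sub>m \<xi>\<^sub>k\<^sup>m e\<^bsup>-m y\<^sub>k\<^esup> (1 - \<delta>(k) (m + 1) y\<^sub>k)\<close>. For fixed \<open>m\<close> put
  \<open>z\<^sub>j = \<beta>\<^sub>j + \<Sum>\<^sub>k \<gamma>\<^sub>j\<^sub>k m\<^sub>k\<close>; the hypothesis on \<open>c\<^sub>k\<^sub>j\<close> says \<open>m\<^sub>k + 1 = 1 + \<Sum>\<^sub>j c\<^sub>k\<^sub>j (z\<^sub>j - \<beta>\<^sub>j)\<close>, so the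
  polynomial factor is \<open>G\<close> at \<open>u\<^sub>j = x\<^sub>j z\<^sub>j\<close>, \<open>v\<^sub>j = 1 / z\<^sub>j\<close>. Termwise integration against
  \<open>x\<^sub>j\<^bsup>s\<^sub>j - 1\<^esup> e\<^bsup>- z\<^sub>j x\<^sub>j\<^esup>\<close> gives Gamma integrals, which produce the Pochhammer symbols.
\<close>

subsection \<open>Identity theorem for meromorphic functions of several variables\<close>

text \<open>Three obstacles shape the proof. First, the conditions on \<xi> and \<gamma> alone allow
  imaginary entries in a column with |\<xi>_k| = 1, and the contour then meets poles. The existence
  of the contour integrals excludes this: nonzero entries of such a column have positive real part,
  so on the half-lines y_k stays in a sector Re y >= \<kappa> |y|, on which the estimates rest. The
  relation between \<open>C\<close> and \<gamma> makes every column nonzero, which gives decay in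
  m_k when |\<xi>_k| = 1. Second, the factors with \<xi>_k = 1 have a removable singularity at y_k =
  0, so their quotients by 1 - c must be bounded uniformly in c and in y down to 0. Third, the
  truncated series are bounded near the origin only by a multiple of 1 + 1 / Re y_k; up to r such
  factors are paid for by the powers of x_j, hence the lower bounds on Re s_j. The values of a
  meromorphic function on a thin set are arbitrary, so the identity reaches a given point by
  continuity. The defining formula concerns nonintegral s_j, so the open set of comparison also asks
  for Im s_j > 0.\<close>

lemma mv_holomorphic_on_subset:
  "mv_holomorphic_on f S \<Longrightarrow> open T \<Longrightarrow> T \<subseteq> S \<Longrightarrow> mv_holomorphic_on f T"
  by (auto simp: mv_holomorphic_on_def)

lemma mv_holomorphic_on_mult:
  assumes "mv_holomorphic_on f S" "mv_holomorphic_on g S"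
  shows "mv_holomorphic_on (\<lambda>z. f z * g z) S"
  unfolding mv_holomorphic_on_def
proof (intro conjI ballI)
  show "open S" using assms mv_holomorphic_on_def by blast
  fix z assume "z \<in> S"
  then obtain f' g' where *: "(f has_derivative f') (at z)" "\<forall>a v. f' (a *s v) = a * f' v"
    "(g has_derivative g') (at z)" "\<forall>a v. g' (a *s v) = a * g' v"
    using assms unfolding mv_holomorphic_on_def by meson
  show "\<exists>h'. ((\<lambda>z. f z * g z) has_derivative h') (at z) \<and> (\<forall>a v. h' (a *s v) = a * h' v)"
    by (rule exI, rule conjI, rule has_derivative_mult[OF *(1) *(3)])
       (use * in \<open>auto simp: algebra_simps\<close>)
qed

lemma mv_holomorphic_on_diff:
  assumes "mv_holomorphic_on f S" "mv_holomorphic_on g S"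
  shows "mv_holomorphic_on (\<lambda>z. f z - g z) S"
  unfolding mv_holomorphic_on_def
proof (intro conjI ballI)
  show "open S" using assms mv_holomorphic_on_def by blast
  fix z assume "z \<in> S"
  then obtain f' g' where *: "(f has_derivative f') (at z)" "\<forall>a v. f' (a *s v) = a * f' v"
    "(g has_derivative g') (at z)" "\<forall>a v. g' (a *s v) = a * g' v"
    using assms unfolding mv_holomorphic_on_def by meson
  show "\<exists>h'. ((\<lambda>z. f z - g z) has_derivative h') (at z) \<and> (\<forall>a v. h' (a *s v) = a * h' v)"
    by (rule exI, rule conjI, rule has_derivative_diff[OF *(1) *(3)])
       (use * in \<open>auto simp: algebra_simps\<close>)
qed

lemma mv_holomorphic_on_const:
  assumes "open S" shows "mv_holomorphic_on (\<lambda>_. c) S"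
  unfolding mv_holomorphic_on_def
  using assms has_derivative_const[of c] by (auto intro!: exI[of _ "\<lambda>_. 0"])

lemma mv_holomorphic_on_prod:
  assumes "\<And>i. i \<in> I \<Longrightarrow> mv_holomorphic_on (f i) S" "open S"
  shows "mv_holomorphic_on (\<lambda>z. \<Prod>i\<in>I. f i z) S"
  using assms(1)
  by (induction I rule: infinite_finite_induct)
     (auto simp: mv_holomorphic_on_const assms mv_holomorphic_on_mult)

lemma mv_holomorphic_on_component:
  assumes "open S" shows "mv_holomorphic_on (\<lambda>z. z $ j) S"
  unfolding mv_holomorphic_on_def
proof (intro conjI ballI assms)
  fix z :: "complex^'a"
  show "\<exists>h'. ((\<lambda>z. z $ j) has_derivative h') (at z) \<and> (\<forall>a v. h' (a *s v) = a * h' v)"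
    by (rule exI[of _ "\<lambda>z. z $ j"])
       (auto intro: bounded_linear_imp_has_derivative bounded_linear_vec_nth)
qed

lemma mv_holomorphic_on_pochhammer:
  assumes "open S" shows "mv_holomorphic_on (\<lambda>z. pochhammer (z $ j) n) S"
proof -
  have "mv_holomorphic_on (\<lambda>z. \<Prod>i=0..<n. (z $ j - (- of_nat i))) S"
    by (intro mv_holomorphic_on_prod mv_holomorphic_on_diff mv_holomorphic_on_const
         mv_holomorphic_on_component assms)
  then show ?thesis by (simp add: pochhammer_prod)
qed

lemma mv_holomorphic_on_translate:
  assumes "mv_holomorphic_on f S"
  shows "mv_holomorphic_on (\<lambda>z. f (z + a)) ((\<lambda>z. z + a) -` S)"
  unfolding mv_holomorphic_on_def
proof (intro conjI ballI)
  show "open ((\<lambda>z. z + a) -` S)"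
    using assms by (intro open_vimage continuous_intros) (auto simp: mv_holomorphic_on_def)
  fix z assume "z \<in> (\<lambda>z. z + a) -` S"
  then obtain f' where *: "(f has_derivative f') (at (z + a))" "\<forall>a v. f' (a *s v) = a * f' v"
    using assms unfolding mv_holomorphic_on_def by auto
  have "((\<lambda>z. z + a) has_derivative (\<lambda>h. h)) (at z)"
    by (auto intro!: derivative_eq_intros)
  from has_derivative_compose[OF this *(1)] show
    "\<exists>h'. ((\<lambda>z. f (z + a)) has_derivative h') (at z) \<and> (\<forall>a v. h' (a *s v) = a * h' v)"
    using *(2) by blast
qed

section \<open>The identity theorem for holomorphic functions\<close>

lemma mv_holomorphic_on_imp_continuous_on:
  "mv_holomorphic_on f S \<Longrightarrow> continuous_on S f"
  unfolding mv_holomorphic_on_def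
  by (rule continuous_at_imp_continuous_on) (blast dest: has_derivative_continuous)

text \<open>Reduction to one variable: by the chain rule the derivative along the line is
  \<open>h \<mapsto> f' (h *s v)\<close>, and complex linearity of \<open>f'\<close> turns this into
  multiplication by \<open>f' v\<close>.\<close>

lemma mv_holomorphic_on_line:
  assumes "mv_holomorphic_on f S"
  shows "(\<lambda>t. f (a + t *s v)) holomorphic_on {t. a + t *s v \<in> S}"
  unfolding holomorphic_on_def
proof
  fix t assume "t \<in> {t. a + t *s v \<in> S}"
  then obtain f' where *: "(f has_derivative f') (at (a + t *s v))" "\<forall>a v. f' (a *s v) = a * f' v"
    using assms unfolding mv_holomorphic_on_def by auto
  have "linear (\<lambda>h::complex. h *s v)"
    by (rule linearI) (simp_all add: vec_eq_iff algebra_simps)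
  then have "bounded_linear (\<lambda>h. h *s v)"
    by (simp add: linear_conv_bounded_linear)
  then have "((\<lambda>t. a + t *s v) has_derivative (\<lambda>h. h *s v)) (at t)"
    by (auto intro!: derivative_eq_intros bounded_linear_imp_has_derivative)
  from has_derivative_compose[OF this *(1)]
  have "((\<lambda>t. f (a + t *s v)) has_derivative (\<lambda>h. f' v * h)) (at t)"
    using *(2) by (simp add: mult.commute)
  then have "((\<lambda>t. f (a + t *s v)) has_field_derivative f' v) (at t)"
    by (simp add: has_field_derivative_def)
  then show "(\<lambda>t. f (a + t *s v)) field_differentiable at t within {t. a + t *s v \<in> S}"
    using field_differentiable_at_within field_differentiable_def by blast
qed

text \<open>On the complex line through \<open>p\<close> and \<open>w\<close> the preimage of the
  convex set is convex, hence connected, so analytic continuation in one variable carries the zero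
  from parameter 0 to parameter 1.\<close>

lemma mv_identity_convex:
  assumes f: "mv_holomorphic_on f S" and S: "convex S"
    and p: "p \<in> T" "T \<subseteq> S" "open T" "\<And>z. z \<in> T \<Longrightarrow> f z = 0" and w: "w \<in> S"
  shows "f w = 0"
proof -
  define v where "v = w - p"
  define \<Phi> where "\<Phi> = (\<lambda>t::complex. p + t *s v)"
  have cont: "continuous_on UNIV \<Phi>"
    unfolding \<Phi>_def vector_scalar_mult_def by (intro continuous_intros)
  have oS: "open S" using f mv_holomorphic_on_def by blast
  have lin: "\<Phi> ((1 - u) *\<^sub>R x + u *\<^sub>R y) = (1 - u) *\<^sub>R \<Phi> x + u *\<^sub>R \<Phi> y" for u x y
    by (simp add: \<Phi>_def vec_eq_iff scaleR_conv_of_real[where 'a=complex] algebra_simps)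
  have "convex (\<Phi> -` S)"
    unfolding convex_alt
    using S lin by (auto simp: convex_alt)
  then have con: "connected (\<Phi> -` S)" by (rule convex_connected)
  have op: "open (\<Phi> -` S)" "open (\<Phi> -` T)"
    using cont oS p(3) by (simp_all add: continuous_on_open_vimage)
  have hol: "(\<lambda>t. f (\<Phi> t)) holomorphic_on \<Phi> -` S"
    using mv_holomorphic_on_line[OF f, of p v] by (simp add: \<Phi>_def vimage_def)
  have 0: "0 \<in> \<Phi> -` T" using p(1) by (simp add: \<Phi>_def)
  have 1: "1 \<in> \<Phi> -` S" using w by (simp add: \<Phi>_def v_def)
  have "f (\<Phi> 1) = 0"
    by (rule analytic_continuation_open[OF op(2) op(1) _ con _ hol holomorphic_on_const _ 1])
       (use p 0 in blast)+
  then show ?thesis by (simp add: \<Phi>_def v_def)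
qed

text \<open>The set \<open>A\<close> of points near which \<open>f\<close> vanishes is open by
  construction. Its complement in \<open>S\<close> is open because the convex case applies to balls:
  a ball that meets \<open>A\<close> lies in \<open>A\<close>.\<close>

lemma mv_identity_connected:
  assumes f: "mv_holomorphic_on f S" and S: "connected S"
    and p: "p \<in> T" "T \<subseteq> S" "open T" "\<And>z. z \<in> T \<Longrightarrow> f z = 0" and w: "w \<in> S"
  shows "f w = 0"
proof -
  have oS: "open S" using f mv_holomorphic_on_def by blast
  define A where "A = {z\<in>S. \<exists>e>0. \<forall>y\<in>ball z e. f y = 0}"
  have "open A"
    unfolding open_contains_ball
  proof
    fix z assume "z \<in> A"
    then obtain e where e: "e > 0" "\<forall>y\<in>ball z e. f y = 0" "z \<in> S" by (auto simp: A_def)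
    from oS e(3) obtain e' where e': "e' > 0" "ball z e' \<subseteq> S" by (meson openE)
    have "ball z (min e e') \<subseteq> A"
    proof
      fix y assume y: "y \<in> ball z (min e e')"
      obtain d where "d > 0" "ball y d \<subseteq> ball z (min e e')" using y by (meson open_ball openE)
      then show "y \<in> A" using e e' y by (auto simp: A_def intro!: exI[of _ d])
    qed
    then show "\<exists>e>0. ball z e \<subseteq> A" using e e' by (intro exI[of _ "min e e'"]) auto
  qed
  moreover have "open (S - A)"
    unfolding open_contains_ball
  proof
    fix z assume z: "z \<in> S - A"
    with oS obtain e where e: "e > 0" "ball z e \<subseteq> S" by (meson DiffE openE)
    have "ball z e \<subseteq> S - A"
    proof (rule ccontr)
      assume "\<not> ?thesis"
      then obtain y where y: "y \<in> ball z e" "y \<in> A" using e by blast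
      then obtain d where d: "d > 0" "\<forall>x\<in>ball y d. f x = 0" by (auto simp: A_def)
      have "f x = 0" if "x \<in> ball z e" for x
        by (rule mv_identity_convex[of f "ball z e" y "ball y d \<inter> ball z e"])
           (use that d y e f in \<open>auto intro: mv_holomorphic_on_subset\<close>)
      then show False using z e by (auto simp: A_def)
    qed
    then show "\<exists>e>0. ball z e \<subseteq> S - A" using e by blast
  qed
  moreover have "p \<in> A"
    using p by (auto simp: A_def) (meson openE subsetD)
  ultimately have "S - A = {}"
    using connectedD[OF S, of A "S - A"] p by auto
  then have "w \<in> A" using w by blast
  then show ?thesis by (auto simp: A_def)
qed

lemma mv_holomorphic_nonzero_dense:
  assumes "mv_holomorphic_on h S" "connected S" "z \<in> S" "h z \<noteq> 0"
    and "open T" "T \<subseteq> S" "T \<noteq> {}"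
  obtains w where "w \<in> T" "h w \<noteq> 0"
proof -
  obtain p where "p \<in> T" using assms(7) by blast
  then show ?thesis
    using mv_identity_connected[OF assms(1,2) _ assms(6,5) _ assms(3), of p] assms(4) that by blast
qed

text \<open>By the identity theorem, \<open>h\<close> cannot vanish on the whole open set where
  \<open>g\<close> is nonzero. This is what makes a product of denominators an admissible
  denominator.\<close>

lemma mv_holomorphic_mult_nonzero:
  assumes "mv_holomorphic_on g S" "mv_holomorphic_on h S" "connected S"
    and "\<exists>z\<in>S. g z \<noteq> 0" "\<exists>z\<in>S. h z \<noteq> 0"
  shows "\<exists>z\<in>S. g z * h z \<noteq> 0"
proof -
  have oS: "open S" using assms(1) mv_holomorphic_on_def by blast
  define T where "T = {z\<in>S. g z \<noteq> 0}"
  have "T = S \<inter> g -` (- {0})" by (auto simp: T_def)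
  then have "open T"
    using continuous_open_preimage[OF mv_holomorphic_on_imp_continuous_on[OF assms(1)] oS, of "- {0}"]
    by auto
  moreover obtain z where "z \<in> S" "h z \<noteq> 0" using assms by blast
  moreover have "T \<noteq> {}" "T \<subseteq> S" using assms by (auto simp: T_def)
  ultimately obtain w where "w \<in> T" "h w \<noteq> 0"
    using mv_holomorphic_nonzero_dense[OF assms(2,3), of z T] by metis
  then show ?thesis by (auto simp: T_def)
qed

section \<open>Meromorphic functions as local quotients\<close>

definition mv_quotient_on :: "(complex^'d \<Rightarrow> complex) \<Rightarrow> (complex^'d \<Rightarrow> complex) \<Rightarrow>
    (complex^'d \<Rightarrow> complex) \<Rightarrow> (complex^'d) set \<Rightarrow> bool" where
  "mv_quotient_on f g h U \<longleftrightarrow> mv_holomorphic_on g U \<and> mv_holomorphic_on h U \<and>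
     (\<exists>z\<in>U. h z \<noteq> 0) \<and> (\<forall>z\<in>U. h z \<noteq> 0 \<longrightarrow> f z = g z / h z)"

lemma mv_quotient_on_subset:
  assumes "mv_quotient_on f g h U" "connected U" "open T" "T \<subseteq> U" "T \<noteq> {}"
  shows "mv_quotient_on f g h T"
proof -
  obtain z where "z \<in> U" "h z \<noteq> 0" using assms by (auto simp: mv_quotient_on_def)
  then obtain w where "w \<in> T" "h w \<noteq> 0"
    using mv_holomorphic_nonzero_dense[of h U z T] assms by (auto simp: mv_quotient_on_def)
  then show ?thesis
    using assms mv_holomorphic_on_subset unfolding mv_quotient_on_def by (meson subsetD)
qed

text \<open>Balls around one point are nested and connected, so two quotient representations can be
  compared on the smaller ball; an intersection of two arbitrary connected neighbourhoods may be
  disconnected.\<close>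

lemma mv_meromorphic_iff_ball:
  "mv_meromorphic f \<longleftrightarrow> (\<forall>p. \<exists>e>0. \<exists>g h. mv_quotient_on f g h (ball p e))"
proof
  assume f: "mv_meromorphic f"
  show "\<forall>p. \<exists>e>0. \<exists>g h. mv_quotient_on f g h (ball p e)"
  proof
    fix p
    from f obtain U g h where U: "connected U" "p \<in> U" "mv_quotient_on f g h U"
      unfolding mv_meromorphic_def mv_quotient_on_def by meson
    then have "open U" by (auto simp: mv_quotient_on_def mv_holomorphic_on_def)
    with U(2) obtain e where e: "e > 0" "ball p e \<subseteq> U" by (meson openE)
    then have "mv_quotient_on f g h (ball p e)"
      by (intro mv_quotient_on_subset[OF U(3) U(1)]) auto
    with e show "\<exists>e>0. \<exists>g h. mv_quotient_on f g h (ball p e)" by blast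
  qed
next
  assume *: "\<forall>p. \<exists>e>0. \<exists>g h. mv_quotient_on f g h (ball p e)"
  show "mv_meromorphic f"
    unfolding mv_meromorphic_def
  proof
    fix p
    from * obtain e g h where "e > 0" "mv_quotient_on f g h (ball p e)" by blast
    then show "\<exists>U g h. connected U \<and> p \<in> U \<and> mv_holomorphic_on g U \<and> mv_holomorphic_on h U \<and>
        (\<exists>z\<in>U. h z \<noteq> 0) \<and> (\<forall>z\<in>U. h z \<noteq> 0 \<longrightarrow> f z = g z / h z)"
      unfolding mv_quotient_on_def
      by (intro exI[of _ "ball p e"] exI[of _ g] exI[of _ h]) auto
  qed
qed

lemma mv_meromorphic_diff:
  assumes "mv_meromorphic f1" "mv_meromorphic f2"
  shows "mv_meromorphic (\<lambda>z. f1 z - f2 z)"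
  unfolding mv_meromorphic_iff_ball
proof
  fix p
  obtain e1 g1 h1 where 1: "e1 > 0" "mv_quotient_on f1 g1 h1 (ball p e1)"
    using assms(1) unfolding mv_meromorphic_iff_ball by blast
  obtain e2 g2 h2 where 2: "e2 > 0" "mv_quotient_on f2 g2 h2 (ball p e2)"
    using assms(2) unfolding mv_meromorphic_iff_ball by blast
  define e where "e = min e1 e2"
  have e: "e > 0" using 1 2 by (simp add: e_def)
  have q1: "mv_quotient_on f1 g1 h1 (ball p e)"
    by (rule mv_quotient_on_subset[OF 1(2)]) (use e in \<open>auto simp: e_def\<close>)
  have q2: "mv_quotient_on f2 g2 h2 (ball p e)"
    by (rule mv_quotient_on_subset[OF 2(2)]) (use e in \<open>auto simp: e_def\<close>)
  have "\<exists>z\<in>ball p e. h1 z * h2 z \<noteq> 0"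
    using q1 q2 by (intro mv_holomorphic_mult_nonzero) (auto simp: mv_quotient_on_def)
  then have "mv_quotient_on (\<lambda>z. f1 z - f2 z) (\<lambda>z. g1 z * h2 z - g2 z * h1 z)
      (\<lambda>z. h1 z * h2 z) (ball p e)"
    using q1 q2 unfolding mv_quotient_on_def
    by (auto intro!: mv_holomorphic_on_diff mv_holomorphic_on_mult simp: diff_frac_eq)
  with e show "\<exists>e>0. \<exists>g h. mv_quotient_on (\<lambda>z. f1 z - f2 z) g h (ball p e)" by blast
qed

lemma mv_meromorphic_holomorphic:
  assumes "mv_holomorphic_on f UNIV"
  shows "mv_meromorphic f"
  unfolding mv_meromorphic_iff_ball
proof
  fix p
  have "mv_quotient_on f f (\<lambda>_. 1) (ball p 1)"
    unfolding mv_quotient_on_def using assms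
    by (auto intro!: mv_holomorphic_on_const exI[of _ p] intro: mv_holomorphic_on_subset)
  then show "\<exists>e>0. \<exists>g h. mv_quotient_on f g h (ball p e)" using zero_less_one by blast
qed

lemma mv_meromorphic_sum:
  assumes "\<And>i. i \<in> I \<Longrightarrow> mv_meromorphic (f i)"
  shows "mv_meromorphic (\<lambda>z. \<Sum>i\<in>I. f i z)"
  using assms
proof (induction I rule: infinite_finite_induct)
  case (insert i I)
  \<comment> \<open>The sum is written as a difference with a negated term, so that closure under
    differences suffices.\<close>
  have "mv_meromorphic (\<lambda>z. f i z - (0 - (\<Sum>i\<in>I. f i z)))"
    using insert by (intro mv_meromorphic_diff mv_meromorphic_holomorphic[of "\<lambda>_. 0"]
      mv_holomorphic_on_const) auto
  then show ?case using insert by (simp add: algebra_simps)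
qed (auto simp: mv_holomorphic_on_const intro: mv_meromorphic_holomorphic)

lemma mv_meromorphic_mult_holomorphic:
  assumes "mv_holomorphic_on c UNIV" "mv_meromorphic f"
  shows "mv_meromorphic (\<lambda>z. c z * f z)"
  unfolding mv_meromorphic_iff_ball
proof
  fix p
  obtain e g h where 1: "e > 0" "mv_quotient_on f g h (ball p e)"
    using assms(2) unfolding mv_meromorphic_iff_ball by blast
  have "mv_holomorphic_on c (ball p e)" using assms(1) by (auto intro: mv_holomorphic_on_subset)
  then have "mv_quotient_on (\<lambda>z. c z * f z) (\<lambda>z. c z * g z) h (ball p e)"
    using 1(2) unfolding mv_quotient_on_def by (auto intro: mv_holomorphic_on_mult)
  with 1 show "\<exists>e>0. \<exists>g h. mv_quotient_on (\<lambda>z. c z * f z) g h (ball p e)" by blast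
qed

lemma mv_meromorphic_translate:
  assumes "mv_meromorphic f"
  shows "mv_meromorphic (\<lambda>z. f (z + a))"
  unfolding mv_meromorphic_iff_ball
proof
  fix p
  obtain e g h where 1: "e > 0" "mv_quotient_on f g h (ball (p + a) e)"
    using assms unfolding mv_meromorphic_iff_ball by blast
  have eq: "(\<lambda>z. z + a) -` ball (p + a) e = ball p e"
    by (auto simp: dist_norm)
  have "\<exists>z\<in>ball p e. h (z + a) \<noteq> 0"
  proof -
    obtain w where "w \<in> ball (p + a) e" "h w \<noteq> 0" using 1 by (auto simp: mv_quotient_on_def)
    then show ?thesis by (intro bexI[of _ "w - a"]) (auto simp: dist_norm algebra_simps)
  qed
  moreover have "z + a \<in> ball (p + a) e" if "z \<in> ball p e" for z
    using that by (simp add: dist_norm)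
  ultimately have "mv_quotient_on (\<lambda>z. f (z + a)) (\<lambda>z. g (z + a)) (\<lambda>z. h (z + a)) (ball p e)"
    using 1(2) mv_holomorphic_on_translate[of _ "ball (p + a) e" a, unfolded eq]
    unfolding mv_quotient_on_def by blast
  with 1 show "\<exists>e>0. \<exists>g h. mv_quotient_on (\<lambda>z. f (z + a)) g h (ball p e)" by blast
qed

text \<open>Connectedness of the whole space is applied to the set \<open>A\<close> of points with a
  local representation whose numerator is zero. Such a representation leaves the value at
  \<open>s\<close> itself undetermined if the denominator vanishes there; continuity settles
  it.\<close>

lemma mv_meromorphic_eq_zero:
  assumes f: "mv_meromorphic f" and T: "open T" "T \<noteq> {}" "\<And>z. z \<in> T \<Longrightarrow> f z = 0"
    and cont: "isCont f s"
  shows "f s = 0"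
proof -
  define A where "A = {p. \<exists>e>0. \<exists>h. mv_quotient_on f (\<lambda>_. 0) h (ball p e)}"
  have "open A"
    unfolding open_contains_ball
  proof
    fix p assume "p \<in> A"
    then obtain e h where e: "e > 0" "mv_quotient_on f (\<lambda>_. 0) h (ball p e)" by (auto simp: A_def)
    have "ball p e \<subseteq> A"
    proof
      fix q assume "q \<in> ball p e"
      then obtain d where d: "d > 0" "ball q d \<subseteq> ball p e" by (meson open_ball openE)
      then have "mv_quotient_on f (\<lambda>_. 0) h (ball q d)"
        by (intro mv_quotient_on_subset[OF e(2)]) auto
      with d show "q \<in> A" by (auto simp: A_def)
    qed
    with e show "\<exists>e>0. ball p e \<subseteq> A" by blast
  qed
  moreover have "open (- A)"
    unfolding open_contains_ball
  proof
    fix q assume q: "q \<in> - A"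
    obtain e g h where e: "e > 0" "mv_quotient_on f g h (ball q e)"
      using f unfolding mv_meromorphic_iff_ball by blast
    have "ball q e \<subseteq> - A"
    proof (rule ccontr)
      assume "\<not> ?thesis"
      then obtain y where y: "y \<in> ball q e" "y \<in> A" by blast
      then obtain d0 h0 where d0: "d0 > 0" "mv_quotient_on f (\<lambda>_. 0) h0 (ball y d0)"
        by (auto simp: A_def)
      obtain d1 where d1: "d1 > 0" "ball y d1 \<subseteq> ball q e" using y by (meson open_ball openE)
      define d where "d = min d0 d1"
      have d: "d > 0" "ball y d \<subseteq> ball q e" "ball y d \<subseteq> ball y d0"
        using d0 d1 by (auto simp: d_def)
      have q0: "mv_quotient_on f (\<lambda>_. 0) h0 (ball y d)"
        by (rule mv_quotient_on_subset[OF d0(2)]) (use d in auto)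
      have q1: "mv_quotient_on f g h (ball y d)"
        by (rule mv_quotient_on_subset[OF e(2)]) (use d in auto)
      have g0: "g z = 0" if z: "z \<in> ball y d" for z
      proof (rule ccontr)
        assume "g z \<noteq> 0"
        \<comment> \<open>At a point where all three functions are nonzero the two representations
          give f = 0 and f = g / h, a contradiction.\<close>
        have "\<exists>z\<in>ball y d. g z * (h0 z * h z) \<noteq> 0"
          by (intro mv_holomorphic_mult_nonzero mv_holomorphic_on_mult)
             (use q0 q1 z \<open>g z \<noteq> 0\<close> in \<open>auto simp: mv_quotient_on_def\<close>)
        then show False using q0 q1 by (auto simp: mv_quotient_on_def)
      qed
      have "g z = 0" if "z \<in> ball q e" for z
        by (rule mv_identity_connected[of g "ball q e" y "ball y d"])
           (use e d g0 that in \<open>auto simp: mv_quotient_on_def\<close>)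
      then have "mv_quotient_on f (\<lambda>_. 0) h (ball q e)"
        using e(2) by (auto simp: mv_quotient_on_def intro!: mv_holomorphic_on_const)
      then show False using q e by (auto simp: A_def)
    qed
    with e show "\<exists>e>0. ball q e \<subseteq> - A" by blast
  qed
  moreover have "A \<noteq> {}"
  proof -
    obtain p where "p \<in> T" using T by blast
    then obtain e where e: "e > 0" "ball p e \<subseteq> T" using T(1) by (meson openE)
    then have "mv_quotient_on f (\<lambda>_. 0) (\<lambda>_. 1) (ball p e)"
      using T(3) by (auto simp: mv_quotient_on_def subset_iff intro!: mv_holomorphic_on_const exI[of _ p])
    with e show ?thesis by (auto simp: A_def)
  qed
  ultimately have "A = UNIV"
    using connectedD[of "UNIV :: (complex^'a) set" A "- A"] connected_UNIV by auto
  then obtain e h where e: "e > 0" "mv_quotient_on f (\<lambda>_. 0) h (ball s e)"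
    unfolding A_def by blast
  show ?thesis
  proof (rule ccontr)
    assume "f s \<noteq> 0"
    with cont obtain d where d: "d > 0" "\<And>z. dist s z < d \<Longrightarrow> f z \<noteq> 0"
      using continuous_at_avoid by blast
    \<comment> \<open>However small the ball, it contains a point with nonzero denominator, where
      \<open>f\<close> is 0; this contradicts nonvanishing near \<open>s\<close>.\<close>
    have "mv_quotient_on f (\<lambda>_. 0) h (ball s (min e d))"
      by (rule mv_quotient_on_subset[OF e(2)]) (use e d in auto)
    with d(2) show False by (auto simp: mv_quotient_on_def)
  qed
qed

lemma mv_regular_at_imp_isCont: "mv_regular_at f p \<Longrightarrow> isCont f p"
  unfolding mv_regular_at_def mv_holomorphic_on_def by (meson has_derivative_continuous)

subsection \<open>Evaluation of Laurent polynomials\<close>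

definition laurent_monom :: "('d::finite \<Rightarrow> complex) \<Rightarrow> ('d \<Rightarrow> complex) \<Rightarrow> (nat^'d) \<times> (int^'d) \<Rightarrow> complex" where
  "laurent_monom u v = (\<lambda>(l, m). (\<Prod>j\<in>UNIV. u j ^ (l $ j)) * (\<Prod>j\<in>UNIV. v j powi (m $ j)))"

definition laurent_eval :: "('d::finite \<Rightarrow> complex) \<Rightarrow> ('d \<Rightarrow> complex) \<Rightarrow> 'd laurent \<Rightarrow> complex" where
  "laurent_eval u v p = (\<Sum>a\<in>Poly_Mapping.keys p. Poly_Mapping.lookup p a * laurent_monom u v a)"

lemma laurent_monom_add:
  assumes "\<And>j. v j \<noteq> 0"
  shows "laurent_monom u v (a + b) = laurent_monom u v a * laurent_monom u v b"
  using assms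
  by (cases a; cases b) (simp add: laurent_monom_def power_add power_int_add prod.distrib)

lemma laurent_eval_superset:
  assumes "finite K" "Poly_Mapping.keys p \<subseteq> K"
  shows "laurent_eval u v p = (\<Sum>a\<in>K. Poly_Mapping.lookup p a * laurent_monom u v a)"
  using assms unfolding laurent_eval_def by (intro sum.mono_neutral_left) (auto simp: in_keys_iff)

lemma laurent_eval_single [simp]:
  "laurent_eval u v (Poly_Mapping.single a c) = c * laurent_monom u v a"
  by (subst laurent_eval_superset[of "{a}"]) auto

lemma laurent_eval_0 [simp]: "laurent_eval u v 0 = 0"
  by (simp add: laurent_eval_def)

lemma laurent_eval_add: "laurent_eval u v (p + q) = laurent_eval u v p + laurent_eval u v q"
proof -
  let ?K = "Poly_Mapping.keys p \<union> Poly_Mapping.keys q"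
  have "Poly_Mapping.keys (p + q) \<subseteq> ?K" by (rule keys_add)
  then show ?thesis
    by (simp add: laurent_eval_superset[of ?K] lookup_add sum.distrib algebra_simps)
qed

lemma laurent_eval_diff: "laurent_eval u v (p - q) = laurent_eval u v p - laurent_eval u v q"
  by (metis add_diff_cancel diff_add_cancel laurent_eval_add)

lemma laurent_eval_sum: "laurent_eval u v (sum f A) = (\<Sum>i\<in>A. laurent_eval u v (f i))"
  by (induction A rule: infinite_finite_induct) (auto simp: laurent_eval_add)

lemma laurent_eval_1 [simp]: "laurent_eval u v 1 = 1"
  by (simp flip: single_one add: laurent_monom_def zero_prod_def)

lemma laurent_sum_singles:
  fixes p :: "'a \<Rightarrow>\<^sub>0 'b::comm_monoid_add"
  shows "(\<Sum>a\<in>Poly_Mapping.keys p. Poly_Mapping.single a (Poly_Mapping.lookup p a)) = p"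
  by (rule poly_mapping_eqI)
     (auto simp: lookup_sum lookup_single when_def in_keys_iff if_distrib cong: if_cong)

lemma laurent_eval_mult:
  assumes v: "\<And>j. v j \<noteq> 0"
  shows "laurent_eval u v (p * q) = laurent_eval u v p * laurent_eval u v q"
proof -
  \<comment> \<open>Both factors are decomposed into monomials, for which multiplicativity is the
    additivity of exponents in \<open>laurent_monom_add\<close>.\<close>
  let ?s = "\<lambda>p :: 'a laurent. \<Sum>a\<in>Poly_Mapping.keys p. Poly_Mapping.single a (Poly_Mapping.lookup p a)"
  have "laurent_eval u v (p * q) = laurent_eval u v (?s p * ?s q)"
    by (simp only: laurent_sum_singles)
  also have "\<dots> = laurent_eval u v (?s p) * laurent_eval u v (?s q)"
    by (simp add: sum_product mult_single laurent_eval_sum laurent_monom_add[OF v] mult_ac)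
  finally show ?thesis by (simp only: laurent_sum_singles)
qed

lemma laurent_eval_prod:
  assumes v: "\<And>j. v j \<noteq> 0"
  shows "laurent_eval u v (prod f A) = (\<Prod>i\<in>A. laurent_eval u v (f i))"
  by (induction A rule: infinite_finite_induct) (auto simp: laurent_eval_mult[OF v])

lemma laurent_monom_axis:
  "laurent_monom u v (axis j 1, 0) = u j" "laurent_monom u v (0, axis j k) = v j powi k" "laurent_monom u v (0, 0) = 1"
  "laurent_monom u v 0 = 1"
  by (simp_all add: laurent_monom_def axis_def if_distrib if_distribR prod.delta' zero_prod_def cong: if_cong)

section \<open>The value of \<open>hl_G\<close> at the bases of a term of the series\<close>

lemma laurent_eval_hl_G:
  fixes \<gamma> :: "complex^'r^'d"
  assumes v: "\<And>j. v j \<noteq> 0"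
  shows "laurent_eval u v (hl_G \<xi> \<gamma> \<beta> C) = (\<Prod>k\<in>UNIV. 1 - hl_delta \<xi> k *
    (1 + (\<Sum>j\<in>UNIV. C $ k $ j * (inverse (v j) - \<beta> $ j))) * (\<Sum>j\<in>UNIV. \<gamma> $ j $ k * (u j * v j)))"
  unfolding hl_G_def L_const_def L_u_def L_v_def L_v_inv_def
  by (simp add: laurent_eval_prod[OF v] laurent_eval_diff laurent_eval_mult[OF v] laurent_eval_add
      laurent_eval_sum laurent_monom_axis[unfolded One_nat_def] power_int_minus mult.assoc)

lemma powi_inverse_mult:
  fixes z :: complex
  assumes "z \<noteq> 0"
  shows "(x * z) ^ l * inverse z powi m = x ^ l * z powi (int l - m)"
  using assms by (simp add: power_mult_distrib power_int_diff power_int_inverse divide_inverse)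

text \<open>This separates the variables. The left side couples the coordinates through the sums
  over \<open>j\<close>, whereas every summand on the right is a product of functions of a single
  \<open>x j\<close>, ready to be integrated coordinate by coordinate.\<close>

lemma hl_G_expansion:
  fixes \<gamma> :: "complex^'r^'d" and \<beta> :: "complex^'d" and m :: "nat^'r" and x :: "'d \<Rightarrow> complex"
  assumes C: "\<And>m k. (\<Sum>j\<in>UNIV. C $ m $ j * \<gamma> $ j $ k) = (if m = k then 1 else 0)"
  defines "z \<equiv> \<lambda>j. \<beta> $ j + (\<Sum>k\<in>UNIV. \<gamma> $ j $ k * of_nat (m $ k))"
  assumes z: "\<And>j. z j \<noteq> 0"
  shows "(\<Prod>k\<in>UNIV. 1 - hl_delta \<xi> k * of_nat (m $ k + 1) * (\<Sum>j\<in>UNIV. \<gamma> $ j $ k * x j)) =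
    (\<Sum>(l, n)\<in>Poly_Mapping.keys (hl_G \<xi> \<gamma> \<beta> C). Poly_Mapping.lookup (hl_G \<xi> \<gamma> \<beta> C) (l, n) *
      (\<Prod>j\<in>UNIV. x j ^ (l $ j) * z j powi (int (l $ j) - n $ j)))"
proof -
  have inv: "1 + (\<Sum>j\<in>UNIV. C $ k $ j * (z j - \<beta> $ j)) = of_nat (m $ k + 1)" for k
  proof -
    have "(\<Sum>j\<in>UNIV. C $ k $ j * (z j - \<beta> $ j)) = (\<Sum>j\<in>UNIV. \<Sum>i\<in>UNIV. C $ k $ j * \<gamma> $ j $ i * of_nat (m $ i))"
      by (simp add: z_def sum_distrib_left mult.assoc)
    also have "\<dots> = (\<Sum>i\<in>UNIV. (\<Sum>j\<in>UNIV. C $ k $ j * \<gamma> $ j $ i) * of_nat (m $ i))"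
      by (subst sum.swap) (simp add: sum_distrib_right)
    also have "\<dots> = of_nat (m $ k)" by (simp add: C if_distribR if_distrib cong: if_cong)
    finally show ?thesis by simp
  qed
  have "laurent_eval (\<lambda>j. x j * z j) (\<lambda>j. inverse (z j)) (hl_G \<xi> \<gamma> \<beta> C) =
    (\<Prod>k\<in>UNIV. 1 - hl_delta \<xi> k * of_nat (m $ k + 1) * (\<Sum>j\<in>UNIV. \<gamma> $ j $ k * x j))"
    using z by (subst laurent_eval_hl_G) (simp_all add: inv mult.assoc)
  then show ?thesis
    by (simp add: laurent_eval_def laurent_monom_def case_prod_unfold powi_inverse_mult[OF z] flip: prod.distrib)
qed

lemma powi_eq_exp_Ln:
  assumes "(z::complex) \<noteq> 0"
  shows "z powi k = exp (of_int k * Ln z)"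
  using assms exp_power_int[of "Ln z" k] by (simp add: mult.commute)

text \<open>The Gamma integral with an extra power x^l contributes the exponent -s - l, and the
  monomial of G contributes l - n. The l cancels, and only the shift of s by n survives.\<close>

lemma powr_mult_powi:
  assumes "(z::complex) \<noteq> 0"
  shows "z powr (- s - of_nat l) * z powi (int l - n) = 1 / z powr (s + of_int n)"
proof -
  have "z powr (- s - of_nat l) * z powi (int l - n) = exp ((- s - of_nat l) * Ln z + of_int (int l - n) * Ln z)"
    using assms by (simp only: powi_eq_exp_Ln[OF assms] powr_def if_False mult_exp_exp)
  also have "(- s - of_nat l) * Ln z + of_int (int l - n) * Ln z = - ((s + of_int n) * Ln z)"
    by (simp add: algebra_simps)
  also have "exp \<dots> = 1 / z powr (s + of_int n)"
    using assms by (simp only: powr_def if_False exp_minus inverse_eq_divide)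
  finally show ?thesis .
qed

subsection \<open>The Hankel contour\<close>

lemma hankel_circle: "0 \<le> t \<Longrightarrow> t \<le> 2 * pi \<Longrightarrow> hankel \<epsilon> t = of_real \<epsilon> * cis t"
  by (simp add: hankel_def hankel_abs_def hankel_arg_def rcis_def)

lemma hankel_off_circle: "t < 0 \<or> t > 2 * pi \<Longrightarrow> hankel \<epsilon> t = of_real (hankel_abs \<epsilon> t)"
  using pi_gt_zero by (auto simp: hankel_def hankel_arg_def rcis_def)

text \<open>Half a turn multiplies \<open>z\<close> by -1 and so reverses the sign of its real part;
  the intermediate value theorem applies on the interval from 0 to \<open>pi\<close>.\<close>

lemma exists_Re_mult_cis_eq_0:
  assumes "Re z \<ge> 0"
  obtains t where "0 \<le> t" "t \<le> 2 * pi" "Re (z * cis t) = 0"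
proof -
  have "\<exists>t\<ge>0. t \<le> pi \<and> Re (z * cis t) = 0"
    by (rule IVT2') (use assms in \<open>auto intro!: continuous_intros\<close>)
  then obtain t where t: "0 \<le> t" "t \<le> pi" "Re (z * cis t) = 0" by blast
  moreover have "t \<le> 2 * pi" using t by linarith
  ultimately show ?thesis using that by blast
qed

text \<open>
  If \<open>\<gamma> $ i $ k\<close> were imaginary, the other coordinates could be put on the circle at points with
  imaginary contribution; then coordinate \<open>i\<close> sweeps \<open>hankel_lin\<close> along the imaginary axis
  into a pole.
\<close>

lemma hankel_avoids_poles_imp_Re_pos:
  fixes \<gamma> :: "complex^'r^'d"
  assumes av: "hankel_avoids_poles \<xi> \<gamma> c \<epsilon>" and \<epsilon>: "\<epsilon> > 0" and x: "norm (\<xi> $ k) = 1"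
    and \<gamma>: "\<And>j. Re (\<gamma> $ j $ k) \<ge> 0" and nz: "\<gamma> $ i $ k \<noteq> 0"
  shows "Re (\<gamma> $ i $ k) > 0"
proof (rule ccontr)
  assume "\<not> ?thesis"
  with \<gamma>[of i] have re0: "Re (\<gamma> $ i $ k) = 0" by linarith
  define a where "a = Im (\<gamma> $ i $ k)"
  have a: "a \<noteq> 0" using nz re0 by (simp add: a_def complex_eq_iff)
  have ga: "\<gamma> $ i $ k = \<i> * of_real a" using re0 by (simp add: a_def complex_eq_iff)
  have "\<exists>t. 0 \<le> t \<and> t \<le> 2 * pi \<and> Re (\<gamma> $ j $ k * cis t) = 0" for j
    using exists_Re_mult_cis_eq_0[OF \<gamma>[of j]] by metis
  then obtain \<tau> where \<tau>: "\<And>j. 0 \<le> \<tau> j" "\<And>j. \<tau> j \<le> 2 * pi" "\<And>j. Re (\<gamma> $ j $ k * cis (\<tau> j)) = 0"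
    by metis
  define S where "S = (\<Sum>j\<in>UNIV - {i}. \<gamma> $ j $ k * (of_real \<epsilon> * cis (\<tau> j)))"
  define b where "b = Im S"
  have "Re (\<gamma> $ j $ k * (of_real \<epsilon> * cis (\<tau> j))) = \<epsilon> * Re (\<gamma> $ j $ k * cis (\<tau> j))" for j
    by (simp add: algebra_simps)
  then have "Re S = 0" unfolding S_def Re_sum by (simp only: \<tau>) simp
  then have S: "S = \<i> * of_real b" by (simp add: b_def complex_eq_iff)
  define \<theta> where "\<theta> = Arg (\<xi> $ k)"
  have "\<xi> $ k \<noteq> 0" using x by auto
  then have \<theta>: "cis \<theta> = \<xi> $ k" using x by (simp add: \<theta>_def cis_Arg sgn_eq)
  have \<theta>b: "\<bar>\<theta>\<bar> \<le> pi" using Arg_bounded[of "\<xi> $ k"] by (simp add: \<theta>_def abs_le_iff)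
  obtain N0 where N0: "\<bar>a\<bar> * (\<epsilon> - (\<theta> - b) / a) / (2 * pi) < real N0" using reals_Archimedean2 by blast
  \<comment> \<open>The successor makes N nonzero, as \<open>ne0\<close> below requires.\<close>
  define N where "N = Suc N0"
  have "\<bar>a\<bar> * (\<epsilon> - (\<theta> - b) / a) / (2 * pi) < real N" using N0 by (simp add: N_def)
  then have N: "\<epsilon> - (\<theta> - b) / a < 2 * pi * real N / \<bar>a\<bar>"
    using a by (simp add: pos_divide_less_eq pos_less_divide_eq mult_ac)
  \<comment> \<open>With the sign of \<open>a\<close>, the shift 2 pi n / a is positive, so
    \<open>X\<close> exceeds the radius and is reached on the straight part of the contour.\<close>
  define n where "n = (if a > 0 then int N else - int N)"
  have n: "real_of_int n / a = real N / \<bar>a\<bar>" using a by (auto simp: n_def)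
  define X where "X = (\<theta> + 2 * pi * n - b) / a"
  have "X = (\<theta> - b) / a + 2 * pi * (real_of_int n / a)" by (simp add: X_def field_simps add_divide_distrib diff_divide_distrib)
  then have X: "X > \<epsilon>" unfolding n using N by simp
  have aX: "a * X + b = \<theta> + 2 * pi * n" using a by (simp add: X_def)
  \<comment> \<open>If \<xi>_k = 1, then \<open>hankel_avoids_poles\<close> exempts the value 0, so
    the pole that is hit must be a different one. As |n| >= 1 and |\<theta>| <= pi, it is.\<close>
  have ne0: "\<theta> + 2 * pi * n \<noteq> 0"
  proof
    assume "\<theta> + 2 * pi * n = 0"
    then have "\<bar>2 * pi * n\<bar> \<le> pi" using \<theta>b by linarith
    then have "\<bar>real_of_int n\<bar> * 2 \<le> 1" by (simp add: abs_mult)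
    then show False by (auto simp: n_def N_def split: if_splits)
  qed
  \<comment> \<open>The parameter \<epsilon> - X is negative and belongs to the point of modulus
    \<open>X\<close> on the upper side.\<close>
  define t :: "real^'d" where "t = (\<chi> j. if j = i then \<epsilon> - X else \<tau> j)"
  have "hankel_lin \<gamma> \<epsilon> t k = \<gamma> $ i $ k * hankel \<epsilon> (t $ i) + (\<Sum>j\<in>UNIV - {i}. \<gamma> $ j $ k * hankel \<epsilon> (t $ j))"
    unfolding hankel_lin_def by (subst sum.remove[of _ i]) auto
  also have "(\<Sum>j\<in>UNIV - {i}. \<gamma> $ j $ k * hankel \<epsilon> (t $ j)) = S"
    unfolding S_def by (intro sum.cong) (auto simp: t_def hankel_circle \<tau>)
  also have "hankel \<epsilon> (t $ i) = of_real X"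
    using X by (simp add: t_def hankel_off_circle hankel_abs_def)
  also have "\<gamma> $ i $ k * of_real X + S = \<i> * of_real (a * X + b)" by (simp add: ga S algebra_simps)
  finally have y: "hankel_lin \<gamma> \<epsilon> t k = \<i> * of_real (\<theta> + 2 * pi * n)" by (simp only: aX)
  have "exp (hankel_lin \<gamma> \<epsilon> t k) = cis (\<theta> + 2 * pi * n)" unfolding y by (simp only: cis_conv_exp)
  also have "\<dots> = \<xi> $ k" by (simp add: \<theta> cis_multiple_2pi flip: cis_mult)
  finally have "exp (hankel_lin \<gamma> \<epsilon> t k) = \<xi> $ k" .
  moreover have "hankel_lin \<gamma> \<epsilon> t k \<noteq> 0" unfolding y using ne0 by (metis mult_eq_0_iff of_real_eq_0_iff complex_i_not_zero)
  ultimately show False using av unfolding hankel_avoids_poles_def by metis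
qed

text \<open>
  At \<open>\<epsilon> = 0\<close> the circle carries weight \<open>0\<close> (because \<open>hankel_deriv 0 t = 0\<close> there) and the contour
  is the doubled positive half-line. Working on this doubled line avoids folding the
  \<open>d\<close>-dimensional integral.
\<close>

definition hankel_weight :: "real \<Rightarrow> real \<Rightarrow> complex \<Rightarrow> complex \<Rightarrow> complex" where
  "hankel_weight \<epsilon> t s b = hankel_power \<epsilon> t (s - 1) * exp (- b * hankel \<epsilon> t) * hankel_deriv \<epsilon> t"

section \<open>Shrinking the contour onto the doubled half-line\<close>

lemma hankel_0: "hankel 0 t = of_real (hankel_abs 0 t)"
  by (cases "t < 0 \<or> t > 2 * pi") (auto simp: hankel_off_circle hankel_circle hankel_abs_def)

lemma hankel_abs_nonneg: "\<epsilon> \<ge> 0 \<Longrightarrow> hankel_abs \<epsilon> t \<ge> 0"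
  by (auto simp: hankel_abs_def)

lemma norm_hankel: "\<epsilon> \<ge> 0 \<Longrightarrow> norm (hankel \<epsilon> t) = hankel_abs \<epsilon> t"
  by (simp add: hankel_def hankel_abs_nonneg)

lemma tendsto_hankel:
  assumes "en \<longlonglongrightarrow> 0"
  shows "(\<lambda>n. hankel (en n) t) \<longlonglongrightarrow> of_real (hankel_abs 0 t)"
proof -
  have "(\<lambda>n. hankel_abs (en n) t) \<longlonglongrightarrow> hankel_abs 0 t"
    using assms unfolding hankel_abs_def by (auto intro!: tendsto_eq_intros)
  then have "(\<lambda>n. hankel (en n) t) \<longlonglongrightarrow> hankel 0 t"
    unfolding hankel_def rcis_def by (intro tendsto_intros)
  then show ?thesis by (simp add: hankel_0)
qed

lemma norm_hankel_minus_hankel_0_le: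
  assumes "\<epsilon> \<ge> 0"
  shows "norm (hankel \<epsilon> t - of_real (hankel_abs 0 t)) \<le> \<epsilon>"
proof (cases "t < 0 \<or> t > 2 * pi")
  case True
  then have "hankel_abs \<epsilon> t - hankel_abs 0 t = \<epsilon>" by (auto simp: hankel_abs_def)
  then have "hankel \<epsilon> t - of_real (hankel_abs 0 t) = of_real \<epsilon>"
    using True by (simp add: hankel_off_circle flip: of_real_diff)
  then show ?thesis using assms by simp
next
  case False
  then show ?thesis using assms by (auto simp: hankel_circle hankel_abs_def norm_mult)
qed

lemma norm_hankel_power_le:
  assumes "hankel_abs \<epsilon> t > 0"
  shows "norm (hankel_power \<epsilon> t a) \<le> hankel_abs \<epsilon> t powr Re a * exp (2 * pi * \<bar>Im a\<bar>)"
proof -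
  have "0 \<le> hankel_arg t" "hankel_arg t \<le> 2 * pi" by (auto simp: hankel_arg_def)
  then have "\<bar>Im a * hankel_arg t\<bar> \<le> \<bar>Im a\<bar> * (2 * pi)"
    unfolding abs_mult by (intro mult_left_mono) auto
  then have "- (Im a * hankel_arg t) \<le> \<bar>Im a\<bar> * (2 * pi)" by linarith
  then have "norm (hankel_power \<epsilon> t a) \<le> exp (Re a * ln (hankel_abs \<epsilon> t) + \<bar>Im a\<bar> * (2 * pi))"
    by (simp add: hankel_power_def algebra_simps)
  also have "\<dots> = hankel_abs \<epsilon> t powr Re a * exp (2 * pi * \<bar>Im a\<bar>)"
    using assms by (simp add: powr_def exp_add mult_ac)
  finally show ?thesis .
qed

text \<open>Off the circle everything is continuous in the radius. On the circle the power need not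
  converge, but for Re s >= 1 it stays bounded while the derivative has norm equal to the radius, so
  the weight tends to 0. This agrees with its value at radius 0.\<close>

lemma tendsto_hankel_weight:
  assumes e: "en \<longlonglongrightarrow> 0" "\<And>n. en n > 0" and s: "Re s \<ge> 1"
  shows "(\<lambda>n. hankel_weight (en n) t s b) \<longlonglongrightarrow> hankel_weight 0 t s b"
proof (cases "t < 0 \<or> t > 2 * pi")
  case True
  have "hankel_abs 0 t > 0" using True pi_gt_zero by (auto simp: hankel_abs_def)
  moreover have "(\<lambda>n. hankel_abs (en n) t) \<longlonglongrightarrow> hankel_abs 0 t"
    using e unfolding hankel_abs_def by (auto intro!: tendsto_eq_intros)
  ultimately have "(\<lambda>n. hankel_power (en n) t (s - 1)) \<longlonglongrightarrow> hankel_power 0 t (s - 1)"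
    unfolding hankel_power_def by (intro tendsto_intros) auto
  moreover have "(\<lambda>n. hankel_deriv (en n) t) \<longlonglongrightarrow> hankel_deriv 0 t"
    using True by (auto simp: hankel_deriv_def)
  moreover have "(\<lambda>n. hankel (en n) t) \<longlonglongrightarrow> hankel 0 t"
    using tendsto_hankel[OF e(1)] by (simp add: hankel_0)
  ultimately show ?thesis unfolding hankel_weight_def by (intro tendsto_intros)
next
  case False
  have lim: "(\<lambda>n. exp (2 * pi * \<bar>Im (s - 1)\<bar>) * norm (exp (- b * hankel (en n) t)) * en n)
    \<longlonglongrightarrow> exp (2 * pi * \<bar>Im (s - 1)\<bar>) * norm (exp (- b * of_real (hankel_abs 0 t))) * 0"
    by (intro tendsto_intros tendsto_hankel e)
  have "\<forall>\<^sub>F n in sequentially. norm (hankel_weight (en n) t s b) \<le>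
    exp (2 * pi * \<bar>Im (s - 1)\<bar>) * norm (exp (- b * hankel (en n) t)) * en n"
    using order_tendstoD(2)[OF e(1) zero_less_one]
  proof eventually_elim
    case (elim n)
    have ha: "hankel_abs (en n) t = en n" using False by (auto simp: hankel_abs_def)
    have "en n powr Re (s - 1) \<le> 1" using elim e(2)[of n] s by (intro powr_le1) auto
    then have "en n powr Re (s - 1) * exp (2 * pi * \<bar>Im (s - 1)\<bar>) \<le> 1 * exp (2 * pi * \<bar>Im (s - 1)\<bar>)"
      by (intro mult_right_mono) auto
    then have "norm (hankel_power (en n) t (s - 1)) \<le> exp (2 * pi * \<bar>Im (s - 1)\<bar>)"
      using norm_hankel_power_le[of "en n" t "s - 1"] e(2)[of n] unfolding ha by linarith
    moreover have "norm (hankel_deriv (en n) t) = en n"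
      using False e(2)[of n] by (simp add: hankel_deriv_def norm_mult)
    ultimately show ?case
      unfolding hankel_weight_def norm_mult using e(2)[of n] by (intro mult_mono) auto
  qed
  then have "(\<lambda>n. hankel_weight (en n) t s b) \<longlonglongrightarrow> 0"
    by (rule Lim_null_comparison) (use lim in simp)
  moreover have "hankel_weight 0 t s b = 0" using False by (simp add: hankel_weight_def hankel_deriv_def)
  ultimately show ?thesis by simp
qed

subsection \<open>The factors of the integrand\<close>

definition hl_des_term :: "complex \<Rightarrow> nat \<Rightarrow> complex \<Rightarrow> complex" where
  "hl_des_term x m y = x ^ m * exp (- of_nat m * y) * (if x = 1 then 1 - of_nat (m + 1) * y else 1)"

text \<open>For x = 1 this is e^y times the derivative at c = 1 of c / (e^(c y) - 1); otherwise it
  is e^y / (e^y - x).\<close>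

definition hl_des_limit :: "complex \<Rightarrow> complex \<Rightarrow> complex" where
  "hl_des_limit x y = (if x = 1 then 1 / (1 - exp (- y)) - y / (1 - exp (- y))\<^sup>2 else 1 / (1 - x * exp (- y)))"

text \<open>The factor \<open>exp y\<close> is the share of the k-th column in the exponentials with
  the sum of the \<gamma>_jk, and 1 - c comes from the prefactor of the defining limit.\<close>

definition des_quotient :: "complex \<Rightarrow> real \<Rightarrow> complex \<Rightarrow> complex" where
  "des_quotient x c y = exp y * des_factor c x y / (if x = 1 then 1 - of_real c else 1)"

text \<open>The entire function (1 - e^(-w)) / w with its singularity removed. It enters with w = (1
  - c) y through e^y - e^(c y) = e^y (1 - e^(-w)).\<close>

definition exp_quotient :: "complex \<Rightarrow> complex" where
  "exp_quotient w = (if w = 0 then 1 else (1 - exp (- w)) / w)"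

lemma norm_exp_minus_1_le: "norm (exp z - 1) \<le> exp (norm z) * norm (z::complex)"
proof -
  have "norm (exp z - 1) \<le> exp \<bar>Re z\<bar> * norm z" using Taylor_exp[of z 0] by simp
  also have "\<dots> \<le> exp (norm z) * norm z" using abs_Re_le_cmod[of z] by (intro mult_right_mono) auto
  finally show ?thesis .
qed

lemma norm_exp_minus_1_minus_le: "norm (exp z - 1 - z) \<le> exp (norm z) * (norm (z::complex))\<^sup>2"
proof -
  have "norm (exp z - 1 - z) \<le> exp \<bar>Re z\<bar> * (norm z)\<^sup>2"
    using Taylor_exp[of z 1] by (simp add: power2_eq_square diff_diff_eq)
  also have "\<dots> \<le> exp (norm z) * (norm z)\<^sup>2" using abs_Re_le_cmod[of z] by (intro mult_right_mono) auto
  finally show ?thesis .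
qed

lemma exp_quotient_bound: "norm (exp_quotient w) \<le> exp (norm w)"
proof (cases "w = 0")
  case False
  then show ?thesis using norm_exp_minus_1_le[of "- w"]
    by (simp add: exp_quotient_def norm_divide field_simps norm_minus_commute)
qed (simp add: exp_quotient_def)

lemma exp_quotient_minus_1_bound: "norm (exp_quotient w - 1) \<le> exp (norm w) * norm w"
proof (cases "w = 0")
  case False
  have "exp_quotient w - 1 = - (exp (- w) - 1 - (- w)) / w"
    using False by (simp add: exp_quotient_def field_simps)
  then have "norm (exp_quotient w - 1) = norm (exp (- w) - 1 - (- w)) / norm w"
    by (simp only: norm_divide norm_minus_cancel)
  also have "\<dots> \<le> exp (norm w) * (norm w)\<^sup>2 / norm w"
    using norm_exp_minus_1_minus_le[of "- w"] by (intro divide_right_mono) auto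
  finally show ?thesis using False by (simp add: power2_eq_square)
qed (simp add: exp_quotient_def)

lemma isCont_exp_quotient: "isCont exp_quotient 0"
proof -
  have "((\<lambda>w::complex. exp (norm w) * norm w) \<longlongrightarrow> exp (norm (0::complex)) * norm (0::complex)) (at 0)"
    by (intro tendsto_intros)
  then have lim: "((\<lambda>w::complex. exp (norm w) * norm w) \<longlongrightarrow> 0) (at 0)" by simp
  have "((\<lambda>w. exp_quotient w - 1) \<longlongrightarrow> 0) (at 0)"
    by (rule Lim_null_comparison[OF always_eventually lim]) (rule allI, rule exp_quotient_minus_1_bound)
  then have "(exp_quotient \<longlongrightarrow> 1) (at 0)" by (rule LIM_zero_cancel)
  then show ?thesis unfolding isCont_def by (simp add: exp_quotient_def)
qed

text \<open>Here \<open>1 - c\<close> is divided out, so that \<open>c \<rightarrow> 1\<close> can be taken jointly with \<open>y\<close>.\<close>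

lemma des_quotient_1:
  assumes "c \<noteq> 1" "y \<noteq> 0" "exp y \<noteq> 1" "exp (of_real c * y) \<noteq> 1"
  shows "des_quotient 1 c y = exp y * (1 / (exp (of_real c * y) - 1)
    - y * exp y * exp_quotient (of_real (1 - c) * y) / ((exp y - 1) * (exp (of_real c * y) - 1)))"
proof -
  have 1: "y * exp_quotient (of_real (1 - c) * y) * (1 - of_real c) = 1 - exp (- (of_real (1 - c) * y))"
    using assms by (simp add: exp_quotient_def field_simps)
  have "exp y * exp (- (of_real (1 - c) * y)) = exp (of_real c * y)"
    by (simp add: mult_exp_exp algebra_simps)
  then have 2: "y * exp y * exp_quotient (of_real (1 - c) * y) * (1 - of_real c) = exp y - exp (of_real c * y)"
    using arg_cong[OF 1, of "\<lambda>w. exp y * w"] by (simp add: algebra_simps)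
  define E F Q where "E = exp y - 1" and "F = exp (of_real c * y) - 1"
    and "Q = y * exp y * exp_quotient (of_real (1 - c) * y)"
  have nz: "E \<noteq> 0" "F \<noteq> 0" "1 - complex_of_real c \<noteq> 0" using assms by (auto simp: E_def F_def)
  have Q: "Q * (1 - of_real c) = E - F" using 2 by (simp add: Q_def E_def F_def)
  have "(1 / E - of_real c / F) = (1 / F - Q / (E * F)) * (1 - of_real c)"
  proof -
    have "(1 / F - Q / (E * F)) * (1 - of_real c) = (E * (1 - of_real c) - Q * (1 - of_real c)) / (E * F)"
      using nz by (simp add: field_simps)
    also have "\<dots> = 1 / E - of_real c / F" unfolding Q using nz by (simp add: field_simps)
    finally show ?thesis by simp
  qed
  then show ?thesis
    using nz assms(2) by (simp add: des_quotient_def des_factor_def E_def F_def Q_def)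
qed

lemma tendsto_des_quotient:
  assumes y: "yn \<longlonglongrightarrow> y" and c: "cn \<longlonglongrightarrow> 1" "\<And>n. cn n \<noteq> (1::real)"
    and x: "norm x \<le> 1" "Re y \<ge> 0" "norm x = 1 \<Longrightarrow> Re y > 0"
  shows "(\<lambda>n. des_quotient x (cn n) (yn n)) \<longlonglongrightarrow> hl_des_limit x y"
proof -
  \<comment> \<open>Comparison of norms: exp (Re y) >= 1 >= |x|, and the hypotheses make one of the
    two inequalities strict.\<close>
  have exp_ne: "exp y \<noteq> x"
  proof
    assume "exp y = x"
    then have "exp (Re y) = norm x" by (metis norm_exp_eq_Re)
    then show False using x using one_le_exp_iff[of "Re y"] one_less_exp_iff[of "Re y"] by (cases "norm x = 1") (auto simp del: one_le_exp_iff one_less_exp_iff)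
  qed
  show ?thesis
  proof (cases "x = 1")
    case False
    have "(\<lambda>n. exp (yn n) / (exp (yn n) - x)) \<longlonglongrightarrow> exp y / (exp y - x)"
      using y exp_ne by (intro tendsto_intros) auto
    moreover have "exp y / (exp y - x) = hl_des_limit x y"
      using False exp_ne by (simp add: hl_des_limit_def exp_minus field_simps)
    ultimately show ?thesis
      using False by (simp add: des_quotient_def des_factor_def)
  next
    case True
    with x have "Re y > 0" by auto
    then have y0: "y \<noteq> 0" by auto
    have cy: "(\<lambda>n. of_real (cn n) * yn n) \<longlonglongrightarrow> y"
      using tendsto_mult[OF tendsto_of_real[OF c(1), where 'a=complex] y] by simp
    have "(\<lambda>n. of_real (1 - cn n) * yn n) \<longlonglongrightarrow> of_real (1 - 1) * y"
      using c y by (intro tendsto_intros)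
    then have q: "(\<lambda>n. exp_quotient (of_real (1 - cn n) * yn n)) \<longlonglongrightarrow> exp_quotient 0"
      by (intro isCont_tendsto_compose[OF isCont_exp_quotient]) simp
    have ey: "(\<lambda>n. exp (yn n)) \<longlonglongrightarrow> exp y" and ecy: "(\<lambda>n. exp (of_real (cn n) * yn n)) \<longlonglongrightarrow> exp y"
      by (intro tendsto_intros y cy)+
    have ev: "\<forall>\<^sub>F n in sequentially. des_quotient x (cn n) (yn n) =
       exp (yn n) * (1 / (exp (of_real (cn n) * yn n) - 1)
    - yn n * exp (yn n) * exp_quotient (of_real (1 - cn n) * yn n) / ((exp (yn n) - 1) * (exp (of_real (cn n) * yn n) - 1)))"
      using tendsto_imp_eventually_ne[OF y y0] tendsto_imp_eventually_ne[OF ey exp_ne]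
        tendsto_imp_eventually_ne[OF ecy exp_ne]
      by eventually_elim (use True c in \<open>simp add: des_quotient_1\<close>)
    have "(\<lambda>n. exp (yn n) * (1 / (exp (of_real (cn n) * yn n) - 1)
    - yn n * exp (yn n) * exp_quotient (of_real (1 - cn n) * yn n) / ((exp (yn n) - 1) * (exp (of_real (cn n) * yn n) - 1))))
       \<longlonglongrightarrow> exp y * (1 / (exp y - 1) - y * exp y * exp_quotient 0 / ((exp y - 1) * (exp y - 1)))"
      using exp_ne True by (intro tendsto_intros y ey ecy q) auto
    also have "exp y * (1 / (exp y - 1) - y * exp y * exp_quotient 0 / ((exp y - 1) * (exp y - 1))) = hl_des_limit x y"
    proof -
      define E where "E = exp y"
      have E: "E \<noteq> 0" "E - 1 \<noteq> 0" using exp_ne True by (auto simp: E_def)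
      have "exp (- y) = 1 / E" by (simp add: E_def exp_minus divide_inverse)
      then have "1 - exp (- y) = (E - 1) / E" using E by (simp add: field_simps)
      then have "hl_des_limit x y = 1 / ((E - 1) / E) - y / ((E - 1) / E)\<^sup>2"
        using True by (simp add: hl_des_limit_def)
      also have "\<dots> = E * (1 / (E - 1) - y * E * exp_quotient 0 / ((E - 1) * (E - 1)))"
      proof -
        have "1 / (F / E) - y / (F / E)\<^sup>2 = E * (1 / F - y * E * exp_quotient 0 / (F * F))" if "F \<noteq> 0" for F
          using E that by (simp add: exp_quotient_def power2_eq_square field_simps)
        then show ?thesis using E by blast
      qed
      finally show ?thesis by (simp add: E_def)
    qed
    finally show ?thesis using tendsto_cong[OF ev] by simp
  qed
qed

text \<open>Geometric series in q = x e^(-y), where |q| < 1 by the alternative between |x| < 1 and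
  Re y > 0; for x = 1 also its derivative, the series with coefficients m + 1.\<close>

lemma sums_hl_des_term:
  assumes x: "norm x \<le> 1" "Re y \<ge> 0" "norm x = 1 \<Longrightarrow> Re y > 0"
  shows "(\<lambda>m. hl_des_term x m y) sums hl_des_limit x y"
proof -
  define q where "q = x * exp (- y)"
  have q: "norm q < 1"
  proof (cases "norm x = 1")
    case True
    then show ?thesis using x by (simp add: q_def norm_mult)
  next
    case False
    have "norm x * exp (- Re y) \<le> norm x * 1" using x by (intro mult_left_mono) auto
    then show ?thesis using False x by (simp add: q_def norm_mult)
  qed
  have pw: "x ^ m * exp (- of_nat m * y) = q ^ m" for m
    by (simp add: q_def power_mult_distrib exp_of_nat_mult[symmetric])
  have geo: "(\<lambda>m. q ^ m) sums (1 / (1 - q))" by (rule geometric_sums[OF q])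
  show ?thesis
  proof (cases "x = 1")
    case False
    then show ?thesis using geo pw by (simp add: hl_des_term_def hl_des_limit_def q_def)
  next
    case True
    have "(\<lambda>m. of_nat (Suc m) * q ^ m) sums (1 / (1 - q)\<^sup>2)"
      by (rule geometric_deriv_sums[OF q])
    then have "(\<lambda>m. q ^ m - y * (of_nat (Suc m) * q ^ m)) sums (1 / (1 - q) - y * (1 / (1 - q)\<^sup>2))"
      by (intro sums_diff geo sums_mult)
    then show ?thesis using True pw[symmetric] by (simp add: hl_des_term_def hl_des_limit_def q_def algebra_simps)
  qed
qed

section \<open>Bounds for the factors, uniform in c and in the radius of the contour\<close>

lemma sector_neighbourhood:
  assumes "0 < \<kappa>" "\<kappa> \<le> 1" "norm (y - y') \<le> \<kappa> * r / 4" "Re y' \<ge> \<kappa> * norm y'" "norm y \<ge> r"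
  shows "Re y \<ge> \<kappa> / 2 * norm y"
proof -
  \<comment> \<open>Replacing y' by y costs at most \<kappa> r / 4 on each side of the sector
    inequality, together at most half of \<kappa> |y|.\<close>
  have "norm y \<le> norm y' + norm (y - y')" by (metis add.commute diff_add_cancel norm_triangle_ineq)
  then have "\<kappa> * norm y \<le> \<kappa> * norm y' + \<kappa> * norm (y - y')"
    using assms mult_left_mono[of "norm y" "norm y' + norm (y - y')" \<kappa>] by (simp add: ring_distribs)
  moreover have "\<kappa> * norm (y - y') \<le> 1 * norm (y - y')" using assms by (intro mult_right_mono) auto
  moreover have "Re y' - Re y \<le> norm (y - y')"
    using abs_Re_le_cmod[of "y - y'"] by simp
  moreover have "\<kappa> * r \<le> \<kappa> * norm y" using assms by (intro mult_left_mono) auto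
  moreover have "\<kappa> / 2 * norm y = \<kappa> * norm y / 2" by simp
  ultimately show ?thesis using assms(3,4) by linarith
qed

text \<open>Trades linear growth for an exponential of arbitrarily small rate, which the decay
  coming from \<beta> can absorb.\<close>

lemma one_plus_le_exp:
  fixes \<eta> t :: real
  assumes "0 < \<eta>" "\<eta> \<le> 1" "t \<ge> 0"
  shows "1 + t \<le> exp (\<eta> * t) / \<eta>"
proof -
  have "\<eta> * (1 + t) \<le> 1 + \<eta> * t" using assms by (simp add: algebra_simps)
  also have "\<dots> \<le> exp (\<eta> * t)" by (rule exp_ge_add_one_self)
  finally show ?thesis using assms by (simp add: field_simps)
qed

lemma exp_half_le: "t \<le> 1/4 \<Longrightarrow> exp t \<le> (2::real)"
  using exp_half_le2 exp_le_cancel_iff[of t "1/2"] by linarith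

lemma norm_exp_minus_1_ge:
  assumes "norm (z::complex) \<le> 1/4"
  shows "norm (exp z - 1) \<ge> norm z / 2"
proof -
  have "norm (exp z - 1 - z) \<le> exp (norm z) * (norm z * norm z)"
    using norm_exp_minus_1_minus_le[of z] by (simp add: power2_eq_square)
  also have "\<dots> \<le> 2 * (1/4 * norm z)"
    using assms exp_half_le[of "norm z"] by (intro mult_mono) auto
  finally show ?thesis
    using norm_triangle_ineq2[of z "z - (exp z - 1)"] by (simp add: norm_minus_commute)
qed

text \<open>At y = 0 the value chosen in \<open>des_factor\<close> gives -1/2. Elsewhere, combining
  the two fractions of \<open>des_quotient_1\<close> cancels the first-order terms: the numerator is
  at most 6 |y|^2 while E F is at least |y|^2 / 8. With |e^y| <= 2 this yields 2 * 6 * 8 =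
  96.\<close>

lemma des_quotient_bound_near_0:
  assumes c: "c \<noteq> 1" "\<bar>c - 1\<bar> \<le> 1/2" and y: "norm y \<le> 1/6"
  shows "norm (des_quotient 1 c y) \<le> 96"
proof (cases "y = 0")
  case True
  have "(complex_of_real c - 1) / 2 / (1 - complex_of_real c) = - 1 / 2"
    using c by (simp add: field_simps)
  then show ?thesis using True by (simp add: des_quotient_def des_factor_def del: divide_divide_eq_left)
next
  case False
  define n where "n = norm y"
  have n: "0 < n" "n \<le> 1/6" using False y by (auto simp: n_def)
  have e2: "exp n \<le> 2" using n by (intro exp_half_le) auto
  have c': "1/2 \<le> c" "c \<le> 3/2" using c by linarith+
  define E F w where "E = exp y - 1" and "F = exp (of_real c * y) - 1" and "w = of_real (1 - c) * y"
  have E: "norm E \<ge> n / 2" unfolding E_def n_def using y by (intro norm_exp_minus_1_ge) auto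
  have ncy: "norm (of_real c * y) = c * n" using c' by (simp add: norm_mult n_def)
  \<comment> \<open>This is the origin of the radius 1/6: as c <= 3/2, the point c y stays in the
    disc of radius 1/4 required by \<open>norm_exp_minus_1_ge\<close>.\<close>
  have "c * n \<le> 3/2 * (1/6)" using c' n by (intro mult_mono) auto
  then have "norm F \<ge> c * n / 2"
    unfolding F_def using norm_exp_minus_1_ge[of "of_real c * y"] by (simp add: ncy)
  moreover have "c * n \<ge> 1/2 * n" using c' n by (intro mult_right_mono) auto
  ultimately have F: "norm F \<ge> n / 4" by linarith
  have nw: "norm w \<le> n / 2"
  proof -
    have "norm w = \<bar>1 - c\<bar> * n" by (simp only: w_def norm_mult norm_of_real n_def)
    then show ?thesis using mult_right_mono[OF c(2), of n] n by (simp add: abs_minus_commute)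
  qed
  have ey: "norm (exp y) \<le> 2" using norm_exp[of y] e2 unfolding n_def by (rule order_trans)
  have "norm (exp_quotient w - 1) \<le> exp (norm w) * norm w" by (rule exp_quotient_minus_1_bound)
  also have "\<dots> \<le> 2 * (n / 2)" using nw n by (intro mult_mono exp_half_le) auto
  finally have q1: "norm (exp_quotient w - 1) \<le> n" by simp
  have En: "norm (exp y - 1) \<le> 2 * n"
    using order_trans[OF norm_exp_minus_1_le[of y] mult_right_mono[OF e2, of n, unfolded n_def]]
    by (simp add: n_def)
  have "norm (exp y * (exp_quotient w - 1) + (exp y - 1)) \<le> 2 * n + 2 * n"
    using mult_mono[OF ey q1] En n by (intro norm_triangle_le) (auto simp: norm_mult)
  then have q2: "norm (exp y * exp_quotient w - 1) \<le> 4 * n" by (simp add: algebra_simps)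
  have "norm (E - y) \<le> exp n * (n * n)"
    using norm_exp_minus_1_minus_le[of y] by (simp add: E_def n_def power2_eq_square)
  also have "\<dots> \<le> 2 * (n * n)" using e2 n by (intro mult_right_mono) auto
  finally have "norm (E - y) \<le> 2 * (n * n)" .
  moreover have "norm (y * (exp y * exp_quotient w - 1)) \<le> n * (4 * n)"
    unfolding norm_mult n_def[symmetric] using q2 n by (intro mult_left_mono) auto
  ultimately have num: "norm ((E - y) - y * (exp y * exp_quotient w - 1)) \<le> 6 * (n * n)"
    by (intro norm_triangle_le_diff) (simp add: algebra_simps)
  have nz: "E \<noteq> 0" "F \<noteq> 0" using E F n by auto
  have "des_quotient 1 c y = exp y * (((E - y) - y * (exp y * exp_quotient w - 1)) / (E * F))"
  proof -
    have ne: "exp y \<noteq> 1" "exp (of_real c * y) \<noteq> 1" using nz by (auto simp: E_def F_def)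
    have "1 / F - y * X * q / (E * F) = ((E - y) - y * (X * q - 1)) / (E * F)" for X q
      using nz by (simp add: field_simps)
    then show ?thesis
      unfolding des_quotient_1[OF c(1) False ne] E_def[symmetric] F_def[symmetric] w_def[symmetric] by simp
  qed
  then have "norm (des_quotient 1 c y) = norm (exp y) * (norm ((E - y) - y * (exp y * exp_quotient w - 1)) / (norm E * norm F))"
    by (simp add: norm_mult norm_divide)
  also have "\<dots> \<le> 2 * (6 * (n * n) / ((n / 2) * (n / 4)))"
    using n E F num ey by (intro mult_mono frac_le) auto
  also have "\<dots> = 96" using n by (simp add: field_simps)
  finally show ?thesis .
qed

lemma norm_one_minus_exp_ge:
  assumes "norm x \<le> 1" "Re y \<ge> a"
  shows "norm (1 - x * exp (- y)) \<ge> 1 - exp (- a)"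
proof -
  have "norm (x * exp (- y)) \<le> 1 * exp (- a)"
    unfolding norm_mult using assms by (intro mult_mono) auto
  then show ?thesis using norm_triangle_ineq2[of 1 "x * exp (- y)"] by simp
qed

text \<open>Extracting e^y and e^(c y) from the denominators leaves 1 - e^(-y) and 1 - e^(-c y),
  both bounded below; a / 2 occurs because c >= 1/2. What can still grow is e^w,
  \<open>exp_quotient w\<close> and the linear factor y. They receive the shares \<eta>/4, \<eta>/4
  and \<eta>/2 of the allowed rate.\<close>

lemma des_quotient_bound_away:
  assumes c: "c \<noteq> 1" "\<bar>c - 1\<bar> \<le> 1/2" "\<bar>c - 1\<bar> \<le> \<eta> / 4" and a: "Re y \<ge> a" "a > 0"
    and \<eta>: "0 < \<eta>" "\<eta> \<le> 1"
  shows "norm (des_quotient 1 c y) \<le> 2 / (\<eta> * (1 - exp (- a / 2))\<^sup>2) * exp (\<eta> * norm y)"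
proof -
  define n \<mu> where "n = norm y" and "\<mu> = 1 - exp (- a / 2)"
  have \<mu>: "0 < \<mu>" "\<mu> \<le> 1" using a by (auto simp: \<mu>_def)
  have c': "1/2 \<le> c" using c by linarith
  have "a / 2 \<le> c * Re y" using mult_mono[of "1/2" c a "Re y"] c' a by simp
  then have 1: "norm (1 - exp (- (of_real c * y))) \<ge> \<mu>"
    using norm_one_minus_exp_ge[of 1 "a / 2" "of_real c * y"] by (simp add: \<mu>_def)
  have 2: "norm (1 - exp (- y)) \<ge> \<mu>"
    using norm_one_minus_exp_ge[of 1 "a / 2" y] a by (simp add: \<mu>_def)
  define A B w where "A = 1 - exp (- (of_real c * y))" and "B = 1 - exp (- y)" and "w = of_real (1 - c) * y"
  have A: "norm A \<ge> \<mu>" and B: "norm B \<ge> \<mu>" using 1 2 by (auto simp: A_def B_def)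
  have nz: "A \<noteq> 0" "B \<noteq> 0" "y \<noteq> 0" using A B \<mu> a by auto
  have e1: "exp (of_real c * y) - 1 = exp (of_real c * y) * A" by (simp add: A_def algebra_simps mult_exp_exp)
  have e2: "exp y - 1 = exp y * B" by (simp add: B_def algebra_simps mult_exp_exp)
  have "des_quotient 1 c y = exp y / exp (of_real c * y) * (1 / A) * (1 - y * exp_quotient w / B)"
  proof -
    have ne: "exp y \<noteq> 1" "exp (of_real c * y) \<noteq> 1" using e1 e2 nz by auto
    have alg: "X * (1 / (Y * A) - y * X * q / ((X * B) * (Y * A))) = X / Y * (1 / A) * (1 - y * q / B)"
      if "X \<noteq> 0" "Y \<noteq> 0" for X Y q
      using that nz by (simp add: field_simps)
    show ?thesis
      unfolding des_quotient_1[OF c(1) nz(3) ne] w_def[symmetric] e1 e2 by (rule alg) auto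
  qed
  also have "exp y / exp (of_real c * y) = exp w" by (simp add: w_def algebra_simps flip: exp_diff)
  finally have eq: "des_quotient 1 c y = exp w * (1 / A) * (1 - y * exp_quotient w / B)" .
  have "norm w = \<bar>1 - c\<bar> * n" by (simp only: w_def norm_mult norm_of_real n_def)
  also have "\<dots> = \<bar>c - 1\<bar> * n" by (simp add: abs_minus_commute)
  also have "\<dots> \<le> \<eta> / 4 * n" using c by (intro mult_right_mono) (auto simp: n_def)
  finally have "exp (norm w) \<le> exp (\<eta> / 4 * n)" by simp
  then have ew: "norm (exp w) \<le> exp (\<eta> / 4 * n)" and qw: "norm (exp_quotient w) \<le> exp (\<eta> / 4 * n)"
    using norm_exp[of w] exp_quotient_bound[of w] by linarith+
  have n0: "n \<ge> 0" by (simp add: n_def)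
  have "0 \<le> \<eta> / 4 * n" using \<eta> n0 by simp
  then have "1 \<le> exp (\<eta> / 4 * n)" by (simp only: one_le_exp_iff)
  from order_trans[OF \<mu>(2) this] have g1: "1 \<le> exp (\<eta> / 4 * n) / \<mu>"
    using \<mu>(1) by (simp add: le_divide_eq)
  have "norm (y * exp_quotient w / B) \<le> n * exp (\<eta> / 4 * n) / \<mu>"
    unfolding norm_divide norm_mult n_def[symmetric] using B qw \<mu> n0 by (intro frac_le mult_mono) auto
  with g1 have "norm (1 - y * exp_quotient w / B) \<le> exp (\<eta> / 4 * n) / \<mu> + n * exp (\<eta> / 4 * n) / \<mu>"
    using norm_triangle_ineq4[of 1 "y * exp_quotient w / B"] unfolding norm_one by linarith
  also have "\<dots> = (1 + n) * (exp (\<eta> / 4 * n) / \<mu>)" by (simp add: distrib_right add_divide_distrib)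
  also have "\<dots> \<le> exp (\<eta> / 2 * n) / (\<eta> / 2) * (exp (\<eta> / 4 * n) / \<mu>)"
    using \<eta> \<mu> n0 by (intro mult_right_mono one_plus_le_exp) auto
  finally have 3: "norm (1 - y * exp_quotient w / B) \<le> exp (\<eta> / 2 * n) / (\<eta> / 2) * (exp (\<eta> / 4 * n) / \<mu>)" .
  have "norm (des_quotient 1 c y) = norm (exp w) * (1 / norm A) * norm (1 - y * exp_quotient w / B)"
    unfolding eq by (simp add: norm_mult norm_divide)
  also have "\<dots> \<le> exp (\<eta> / 4 * n) * (1 / \<mu>) * (exp (\<eta> / 2 * n) / (\<eta> / 2) * (exp (\<eta> / 4 * n) / \<mu>))"
    using A ew 3 \<mu> by (intro mult_mono frac_le mult_nonneg_nonneg) auto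
  also have "\<dots> = 2 / (\<eta> * \<mu>\<^sup>2) * (exp (\<eta> / 4 * n) * (exp (\<eta> / 2 * n) * exp (\<eta> / 4 * n)))"
    using \<eta> \<mu> by (simp add: field_simps power2_eq_square)
  also have "exp (\<eta> / 4 * n) * (exp (\<eta> / 2 * n) * exp (\<eta> / 4 * n)) = exp (\<eta> * n)"
    unfolding mult_exp_exp by (rule arg_cong[where f = exp]) (simp add: field_simps)
  finally show ?thesis by (simp add: n_def \<mu>_def)
qed

text \<open>Here y' is the value on the half-lines and y the value on a nearby contour. For x = 1
  the quotient is bounded near 0 by the removable singularity, and for other x on the unit circle by
  continuity of 1 - x e^(-y); in both cases the sector keeps Re y away from 0 farther out. If |x| <
  1, a slightly negative Re y still keeps |x e^(-y)| below 1.\<close>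

lemma des_quotient_bound:
  assumes x: "norm x \<le> 1" and \<kappa>: "0 < \<kappa>" "\<kappa> \<le> 1" and \<eta>: "0 < \<eta>" "\<eta> \<le> 1"
  shows "\<exists>K>0. \<exists>\<rho>>0. \<forall>c y y'. c \<noteq> 1 \<and> \<bar>c - 1\<bar> < \<rho> \<and> norm (y - y') < \<rho> \<and> Re y' \<ge> 0 \<and>
    (norm x = 1 \<longrightarrow> Re y' \<ge> \<kappa> * norm y') \<longrightarrow> norm (des_quotient x c y) \<le> K * exp (\<eta> * norm y)"
proof -
  consider "x = 1" | "x \<noteq> 1" "norm x = 1" | "norm x < 1" using x by fastforce
  then show ?thesis
  proof cases
    case 1
    \<comment> \<open>Outside the disc of radius 1/6 the sector with constant \<kappa> / 2 gives Re
      y >= \<kappa> / 12. The third entry of \<rho> is the tolerance of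
      \<open>sector_neighbourhood\<close> for r = 1/6.\<close>
    define a where "a = \<kappa> / 12"
    define K where "K = 96 + 2 / (\<eta> * (1 - exp (- a / 2))\<^sup>2)"
    define \<rho> where "\<rho> = min (\<eta> / 4) (min (1/2) (\<kappa> * (1/6) / 4))"
    have K1: "96 \<le> K" "2 / (\<eta> * (1 - exp (- a / 2))\<^sup>2) \<le> K" using \<eta> by (auto simp: K_def)
    have bd: "norm (des_quotient x c y) \<le> K * exp (\<eta> * norm y)"
      if h: "c \<noteq> 1" "\<bar>c - 1\<bar> < \<rho>" "norm (y - y') < \<rho>" "Re y' \<ge> 0"
        "norm x = 1 \<longrightarrow> Re y' \<ge> \<kappa> * norm y'" for c y y'
    proof (cases "norm y \<le> 1/6")
      case True
      then have "norm (des_quotient x c y) \<le> 96" unfolding 1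
        using h by (intro des_quotient_bound_near_0) (auto simp: \<rho>_def)
      also have "\<dots> \<le> K * exp (\<eta> * norm y)"
        using mult_mono[of 96 K 1 "exp (\<eta> * norm y)"] K1 \<eta> by simp
      finally show ?thesis .
    next
      case False
      have "Re y \<ge> \<kappa> / 2 * norm y"
        using False h 1 \<kappa> by (intro sector_neighbourhood[of \<kappa> y y' "1/6"]) (auto simp: \<rho>_def)
      moreover have "\<kappa> / 2 * norm y \<ge> \<kappa> / 2 * (1/6)" using False \<kappa> by (intro mult_left_mono) auto
      ultimately have "Re y \<ge> a" by (simp add: a_def)
      then have "norm (des_quotient x c y) \<le> 2 / (\<eta> * (1 - exp (- a / 2))\<^sup>2) * exp (\<eta> * norm y)"
        unfolding 1 using h \<kappa> \<eta> by (intro des_quotient_bound_away) (auto simp: \<rho>_def a_def)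
      also have "\<dots> \<le> K * exp (\<eta> * norm y)" using K1 by (intro mult_right_mono) auto
      finally show ?thesis .
    qed
    have "K > 0" "\<rho> > 0" using K1 \<kappa> \<eta> by (auto simp: \<rho>_def)
    then show ?thesis using bd by blast
  next
    case 2
    define d where "d = norm (1 - x) / 2"
    have d: "d > 0" using 2 by (simp add: d_def)
    have "((\<lambda>y. norm (1 - x * exp (- y))) \<longlongrightarrow> norm (1 - x * exp (- 0))) (at 0)"
      by (intro tendsto_intros)
    then have "\<forall>\<^sub>F y in at 0. norm (1 - x * exp (- y)) > d"
      using d by (intro order_tendstoD) (auto simp: d_def)
    then obtain r where r: "r > 0" "\<And>y. y \<noteq> 0 \<Longrightarrow> norm y < r \<Longrightarrow> norm (1 - x * exp (- y)) > d"
      by (auto simp: eventually_at)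
    define a where "a = \<kappa> / 2 * r"
    have a: "a > 0" using \<kappa> r by (simp add: a_def)
    define \<mu> where "\<mu> = min d (1 - exp (- a))"
    have \<mu>: "\<mu> > 0" using d a by (auto simp: \<mu>_def)
    have bd: "norm (des_quotient x c y) \<le> 1 / \<mu> * exp (\<eta> * norm y)"
      if h: "norm (y - y') < \<kappa> * r / 4" "norm x = 1 \<longrightarrow> Re y' \<ge> \<kappa> * norm y'" for c y y'
    proof -
      have "norm (1 - x * exp (- y)) \<ge> \<mu>"
      proof (cases "norm y < r")
        case True
        then have "norm (1 - x * exp (- y)) \<ge> d"
          using r(2)[of y] by (cases "y = 0") (auto simp: d_def)
        then show ?thesis by (simp add: \<mu>_def)
      next
        case False
        have "Re y \<ge> \<kappa> / 2 * norm y"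
          using False h 2 \<kappa> by (intro sector_neighbourhood[of \<kappa> y y' r]) auto
        moreover have "\<kappa> / 2 * norm y \<ge> \<kappa> / 2 * r" using False \<kappa> by (intro mult_left_mono) auto
        ultimately have "Re y \<ge> a" by (simp add: a_def)
        then show ?thesis using norm_one_minus_exp_ge[of x a y] 2 by (simp add: \<mu>_def)
      qed
      moreover have "des_quotient x c y = 1 / (1 - x * exp (- y))"
      proof -
        have "exp y - x = exp y * (1 - x * exp (- y))" by (simp add: algebra_simps exp_minus_inverse)
        then show ?thesis using 2 by (simp add: des_quotient_def des_factor_def)
      qed
      ultimately have "norm (des_quotient x c y) \<le> 1 / \<mu> * 1"
        using \<mu> by (simp add: norm_divide frac_le)
      also have "\<dots> \<le> 1 / \<mu> * exp (\<eta> * norm y)" using \<mu> \<eta> by (intro mult_left_mono) auto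
      finally show ?thesis .
    qed
    have "1 / \<mu> > 0" "\<kappa> * r / 4 > 0" using \<mu> \<kappa> r by auto
    then show ?thesis using bd by blast
  next
    case 3
    have "((\<lambda>t. norm x * exp t) \<longlongrightarrow> norm x * exp 0) (at (0::real))"
      by (intro tendsto_intros)
    then have "\<forall>\<^sub>F t in at 0. norm x * exp t < (1 + norm x) / 2"
      using 3 by (intro order_tendstoD) auto
    then obtain r where r: "r > 0" "\<And>t. t \<noteq> 0 \<Longrightarrow> \<bar>t\<bar> < r \<Longrightarrow> norm x * exp t < (1 + norm x) / 2"
      by (auto simp: eventually_at dist_norm)
    define \<mu> where "\<mu> = (1 - norm x) / 2"
    have \<mu>: "\<mu> > 0" using 3 by (simp add: \<mu>_def)
    have bd: "norm (des_quotient x c y) \<le> 1 / \<mu> * exp (\<eta> * norm y)"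
      if h: "norm (y - y') < r / 2" "Re y' \<ge> 0" for c y y'
    proof -
      have "Re y \<ge> - (r / 2)" using h abs_Re_le_cmod[of "y - y'"] by simp
      then have "norm x * exp (- Re y) \<le> norm x * exp (r / 2)" by (intro mult_left_mono) auto
      also have "\<dots> < (1 + norm x) / 2" using r by simp
      finally have "norm (x * exp (- y)) < (1 + norm x) / 2" by (simp add: norm_mult)
      then have "norm (1 - x * exp (- y)) \<ge> \<mu>"
        using norm_triangle_ineq2[of 1 "x * exp (- y)"] by (simp add: \<mu>_def field_simps)
      moreover have "des_quotient x c y = 1 / (1 - x * exp (- y))"
      proof -
        have "exp y - x = exp y * (1 - x * exp (- y))" by (simp add: algebra_simps exp_minus_inverse)
        then show ?thesis using 3 by (auto simp: des_quotient_def des_factor_def)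
      qed
      ultimately have "norm (des_quotient x c y) \<le> 1 / \<mu> * 1"
        using \<mu> by (simp add: norm_divide frac_le)
      also have "\<dots> \<le> 1 / \<mu> * exp (\<eta> * norm y)" using \<mu> \<eta> by (intro mult_left_mono) auto
      finally show ?thesis .
    qed
    have "1 / \<mu> > 0" "r / 2 > 0" using \<mu> r by auto
    then show ?thesis using bd by blast
  qed
qed

text \<open>For |x| = 1 the series with coefficients m + 1 has a double pole in Re y at 0, but it
  carries the factor |y|, which the sector bounds by Re y / \<kappa>. So only a simple pole remains,
  uniformly in the length of the partial sum.\<close>

lemma sum_hl_des_term_bound:
  assumes x: "norm x \<le> 1" and \<kappa>: "0 < \<kappa>" "\<kappa> \<le> 1" and \<eta>: "0 < \<eta>" "\<eta> \<le> 1"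
  shows "\<exists>K>0. \<forall>N y. Re y \<ge> 0 \<and> (norm x = 1 \<longrightarrow> Re y > 0 \<and> Re y \<ge> \<kappa> * norm y) \<longrightarrow>
    norm (\<Sum>m<N. hl_des_term x m y) \<le> K * (if norm x = 1 then 1 + 1 / Re y else 1) * exp (\<eta> * norm y)"
proof (cases "norm x = 1")
  case False
  then have x1: "norm x < 1" "x \<noteq> 1" using x by auto
  have "norm (\<Sum>m<N. hl_des_term x m y) \<le> 1 / (1 - norm x) * exp (\<eta> * norm y)" if "Re y \<ge> 0" for N y
  proof -
    have "norm (\<Sum>m<N. hl_des_term x m y) \<le> (\<Sum>m<N. norm x ^ m)"
    proof (rule sum_norm_le)
      fix m
      have "norm (hl_des_term x m y) = norm x ^ m * exp (- (real m * Re y))"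
        using x1 by (simp add: hl_des_term_def norm_mult norm_power)
      also have "\<dots> \<le> norm x ^ m * 1" using that by (intro mult_left_mono) auto
      finally show "norm (hl_des_term x m y) \<le> norm x ^ m" by simp
    qed
    also have "\<dots> \<le> suminf (\<lambda>m. norm x ^ m)" using x1 by (intro sum_le_suminf) (auto simp: summable_geometric)
    also have "\<dots> = 1 / (1 - norm x)" using x1 by (simp add: suminf_geometric)
    also have "\<dots> \<le> 1 / (1 - norm x) * exp (\<eta> * norm y)" using x1 \<eta> mult_left_mono[of 1 "exp (\<eta> * norm y)" "1 / (1 - norm x)"] by simp
    finally show ?thesis .
  qed
  then show ?thesis using False x1 by (intro exI[of _ "1 / (1 - norm x)"]) auto
next
  case True
  have "norm (\<Sum>m<N. hl_des_term x m y) \<le> 2 / (\<kappa> * \<eta>) * (1 + 1 / Re y) * exp (\<eta> * norm y)"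
    if y: "Re y > 0" "Re y \<ge> \<kappa> * norm y" for N y
  proof -
    define r q where "r = Re y" and "q = exp (- r)"
    have q: "0 < q" "q < 1" using y by (auto simp: q_def r_def)
    have r: "r > 0" using y by (simp add: r_def)
    have ny: "norm y \<le> r / \<kappa>" using y \<kappa> by (simp add: r_def field_simps)
    have "norm (\<Sum>m<N. hl_des_term x m y) \<le> (\<Sum>m<N. q ^ m + norm y * (of_nat (Suc m) * q ^ m))"
    proof (rule sum_norm_le)
      fix m
      have "norm (if x = 1 then 1 - of_nat (m + 1) * y else 1) \<le> 1 + real (Suc m) * norm y"
        using norm_triangle_ineq4[of 1 "of_nat (m + 1) * y"] by (auto simp: norm_mult simp flip: of_nat_Suc)
      then have "norm (hl_des_term x m y) \<le> exp (- (real m * Re y)) * (1 + real (Suc m) * norm y)"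
        using True unfolding hl_des_term_def norm_mult by (simp add: norm_power)
      also have "exp (- (real m * Re y)) = q ^ m" by (simp add: q_def r_def flip: exp_of_nat_mult)
      finally show "norm (hl_des_term x m y) \<le> q ^ m + norm y * (of_nat (Suc m) * q ^ m)"
        by (simp add: algebra_simps)
    qed
    also have "\<dots> \<le> 1 / (1 - q) + norm y * (1 / (1 - q)\<^sup>2)"
    proof -
      have s: "(\<lambda>m. q ^ m + norm y * (of_nat (Suc m) * q ^ m)) sums (1 / (1 - q) + norm y * (1 / (1 - q)\<^sup>2))"
        using q by (intro sums_add sums_mult geometric_sums geometric_deriv_sums) auto
      show ?thesis unfolding sums_unique[OF s]
        using q sums_summable[OF s] by (intro sum_le_suminf) auto
    qed
    also have "\<dots> \<le> (1 + 1 / r) + r / \<kappa> * (1 + 1 / r)\<^sup>2"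
    proof -
      have "1 + r \<le> exp r" by (rule exp_ge_add_one_self)
      then have "q \<le> 1 / (1 + r)" using r by (simp add: q_def exp_minus inverse_eq_divide frac_le)
      then have "1 - q \<ge> r / (1 + r)" using r by (simp add: field_simps)
      then have b: "1 / (1 - q) \<le> 1 / (r / (1 + r))" using r by (intro frac_le) auto
      then have b: "1 / (1 - q) \<le> 1 + 1 / r" using r by (simp add: field_simps)
      moreover have "norm y * (1 / (1 - q))\<^sup>2 \<le> r / \<kappa> * (1 + 1 / r)\<^sup>2"
        using b ny q r \<kappa> by (intro mult_mono power_mono) auto
      ultimately show ?thesis by (simp add: power_divide)
    qed
    also have "\<dots> = (1 + 1 / r) * (1 + (1 + r) / \<kappa>)" using r \<kappa> by (simp add: field_simps power2_eq_square)
    also have "\<dots> \<le> (1 + 1 / r) * ((1 + r) / \<kappa> + (1 + r) / \<kappa>)"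
      using r \<kappa> by (intro mult_left_mono add_right_mono) (auto simp: field_simps)
    also have "\<dots> \<le> (1 + 1 / r) * (2 / \<kappa> * (exp (\<eta> * norm y) / \<eta>))"
    proof (intro mult_left_mono)
      have "r \<le> norm y" using complex_Re_le_cmod[of y] by (simp add: r_def)
      then have "1 + r \<le> exp (\<eta> * norm y) / \<eta>"
        using one_plus_le_exp[of \<eta> "norm y"] \<eta> by simp
      then show "(1 + r) / \<kappa> + (1 + r) / \<kappa> \<le> 2 / \<kappa> * (exp (\<eta> * norm y) / \<eta>)"
        using \<kappa> mult_left_mono[of "1 + r" "exp (\<eta> * norm y) / \<eta>" "2 / \<kappa>"] by (simp add: add_divide_distrib)
    qed (use r in auto)
    finally show ?thesis by (simp add: r_def algebra_simps)
  qed
  then show ?thesis using True \<kappa> \<eta> by (intro exI[of _ "2 / (\<kappa> * \<eta>)"]) auto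
qed

subsection \<open>Gamma integrals over the Hankel contour\<close>

text \<open>Fubini for product integrands. Lebesgue measure on vectors is the image under
  \<open>T\<close> of the product measure indexed by \<open>Basis\<close>, and \<open>axis\<close>
  identifies \<open>Basis\<close> with the index type.\<close>

lemma has_bochner_integral_lborel_vec_prod:
  fixes f :: "'d::finite \<Rightarrow> real \<Rightarrow> 'a::{real_normed_field,banach,second_countable_topology}"
  assumes "\<And>j. has_bochner_integral lborel (f j) (I j)"
  shows "has_bochner_integral lborel (\<lambda>t::real^'d. \<Prod>j\<in>UNIV. f j (t $ j)) (\<Prod>j\<in>UNIV. I j)"
proof -
  interpret product_sigma_finite "\<lambda>_::real^'d. lborel :: real measure" by standard
  have int: "integrable lborel (f j)" and I: "integral\<^sup>L lborel (f j) = I j" for j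
    using assms[of j] by (auto simp: has_bochner_integral_iff)
  have B: "Basis = range (\<lambda>j. axis j 1 :: real^'d)"
    by (auto simp: Basis_vec_def)
  have inj: "inj (\<lambda>j. axis j 1 :: real^'d)"
    by (auto simp: inj_def axis_eq_axis)
  define F where "F = (\<lambda>b::real^'d. f (axis_index b))"
  define P where "P = (\<Pi>\<^sub>M b\<in>(Basis::(real^'d) set). (lborel :: real measure))"
  define T where "T = (\<lambda>g::real^'d \<Rightarrow> real. \<Sum>b\<in>Basis. g b *\<^sub>R b)"
  have comp: "T g $ j = g (axis j 1)" for g j
    unfolding T_def B by (subst sum.reindex[OF inj]) (simp add: axis_def if_distrib cong: if_cong)
  have ev: "(\<Prod>j\<in>UNIV. f j (T g $ j)) = (\<Prod>b\<in>Basis. F b (g b))" for g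
    unfolding comp B by (subst prod.reindex[OF inj]) (simp add: F_def)
  have prodI: "(\<Prod>b\<in>Basis. integral\<^sup>L lborel (F b)) = (\<Prod>j\<in>UNIV. I j)"
    unfolding B by (subst prod.reindex[OF inj]) (simp add: F_def I)
  have "has_bochner_integral P (\<lambda>g. \<Prod>b\<in>Basis. F b (g b)) (\<Prod>j\<in>UNIV. I j)"
    unfolding has_bochner_integral_iff P_def
    using product_integrable_prod[of "Basis::(real^'d) set" F] product_integral_prod[of "Basis::(real^'d) set" F]
    by (simp add: F_def int flip: prodI)
  then have "has_bochner_integral P (\<lambda>g. \<Prod>j\<in>UNIV. f j (T g $ j)) (\<Prod>j\<in>UNIV. I j)"
    by (simp add: ev)
  moreover have [measurable]: "f j \<in> borel_measurable borel" for j
    using int[of j] by (simp add: borel_measurable_integrable)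
  moreover have "T \<in> measurable P borel" unfolding T_def P_def by measurable
  ultimately have "has_bochner_integral (distr P borel T) (\<lambda>t::real^'d. \<Prod>j\<in>UNIV. f j (t $ j)) (\<Prod>j\<in>UNIV. I j)"
    by (intro has_bochner_integral_distr) (auto intro!: borel_measurable_prod measurable_compose[of "\<lambda>t::real^'d. t $ i" borel borel for i]
        borel_measurable_continuous_onI continuous_intros)
  moreover have "(lborel :: (real^'d) measure) = distr P borel T"
    unfolding P_def T_def by (rule lborel_eq)
  ultimately show ?thesis by simp
qed

text \<open>The Gamma integral over the completed measure passes to \<open>lborel\<close> because
  the integrand is Borel measurable.\<close>

lemma has_bochner_integral_Gamma:
  assumes "Re s > 0"
  shows "has_bochner_integral lborel
    (\<lambda>x. indicator {0<..} x *\<^sub>R (complex_of_real x powr (s - 1) * exp (- of_real x))) (Gamma s)"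
proof -
  let ?f = "\<lambda>t. complex_of_real t powr (s - 1) / of_real (exp t)"
  have ai: "?f absolutely_integrable_on {0<..}"
    by (rule absolutely_integrable_Gamma_integral'[OF assms])
  have "integral {0<..} ?f = Gamma s"
    using Gamma_integral_complex'[OF assms] by blast
  then have e: "(LINT t:{0<..}|lebesgue. ?f t) = Gamma s"
    using set_lebesgue_integral_eq_integral(2)[OF ai] by simp
  let ?g = "\<lambda>x. indicator {0<..} x *\<^sub>R ?f x"
  have m: "?g \<in> borel_measurable lborel" by measurable
  have "integrable lborel ?g"
    using ai m unfolding set_integrable_def by (simp add: integrable_completion)
  moreover have "integral\<^sup>L lborel ?g = Gamma s"
    using e m unfolding set_lebesgue_integral_def by (simp add: integral_completion)
  ultimately have "has_bochner_integral lborel ?g (Gamma s)"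
    by (simp add: has_bochner_integral_iff)
  then show ?thesis
    by (simp add: exp_minus divide_inverse exp_of_real)
qed

lemma has_bochner_integral_Gamma_real_scale:
  assumes s: "Re s > 0" and c: "c > 0"
  shows "has_bochner_integral lborel
    (\<lambda>x. indicator {0<..} x *\<^sub>R (complex_of_real x powr (s - 1) * exp (- of_real (c * x))))
    (Gamma s * of_real c powr (- s))"
proof -
  have "has_bochner_integral lborel
     (\<lambda>x. indicator {0<..} (0 + c * x) *\<^sub>R (complex_of_real (0 + c * x) powr (s - 1) * exp (- of_real (0 + c * x))))
     (Gamma s /\<^sub>R \<bar>c\<bar>)"
    using c has_bochner_integral_Gamma[OF s]
    by (subst lborel_has_bochner_integral_real_affine_iff[symmetric]) auto
  then have "has_bochner_integral lborel
     (\<lambda>x. of_real c powr (1 - s) * (indicator {0<..} (0 + c * x) *\<^sub>R (complex_of_real (0 + c * x) powr (s - 1) * exp (- of_real (0 + c * x)))))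
     (of_real c powr (1 - s) * (Gamma s /\<^sub>R \<bar>c\<bar>))"
    by (intro has_bochner_integral_mult_right) auto
  also have "of_real c powr (1 - s) * (Gamma s /\<^sub>R \<bar>c\<bar>) = Gamma s * of_real c powr (- s)"
    using c powr_diff[of "of_real c" "1 - s" 1] by (simp add: scaleR_conv_of_real field_simps)
  also have "(\<lambda>x. of_real c powr (1 - s) * (indicator {0<..} (0 + c * x) *\<^sub>R (complex_of_real (0 + c * x) powr (s - 1) * exp (- of_real (0 + c * x)))))
    = (\<lambda>x. indicator {0<..} x *\<^sub>R (complex_of_real x powr (s - 1) * exp (- of_real (c * x))))"
  proof
    fix x
    have "of_real c powr (1 - s) * complex_of_real (c * x) powr (s - 1) = complex_of_real x powr (s - 1)" if "x > 0"
    proof -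
      have "complex_of_real (c * x) powr (s - 1) = of_real c powr (s - 1) * complex_of_real x powr (s - 1)"
        using c that by (simp add: powr_times_real)
      moreover have "of_real c powr (1 - s) * of_real c powr (s - 1) = (1::complex)"
        using c by (simp flip: powr_add)
      ultimately show ?thesis by (simp add: mult.assoc[symmetric])
    qed
    then show "of_real c powr (1 - s) * (indicator {0<..} (0 + c * x) *\<^sub>R (complex_of_real (0 + c * x) powr (s - 1) * exp (- of_real (0 + c * x))))
      = indicator {0<..} x *\<^sub>R (complex_of_real x powr (s - 1) * exp (- of_real (c * x)))"
      using c by (auto simp: indicator_def zero_less_mult_iff mult.assoc[symmetric])
  qed
  finally show ?thesis .
qed

text \<open>
  For complex \<open>z\<close>, expand \<open>exp (- z * x)\<close> around a real \<open>c\<close> with \<open>cmod (c - z) < c\<close> and sum the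
  resulting Gamma integrals by the binomial series.
\<close>

lemma has_bochner_integral_Gamma_scale:
  assumes s: "Re s > 0" and z: "Re z > 0"
  shows "has_bochner_integral lborel
    (\<lambda>x. indicator {0<..} x *\<^sub>R (complex_of_real x powr (s - 1) * exp (- z * of_real x)))
    (Gamma s * z powr (- s))"
proof -
  \<comment> \<open>As |c - z|^2 = c^2 - 2 c Re z + |z|^2, the inequality |c - z| < c amounts to c >
    |z|^2 / (2 Re z); the added ones give slack.\<close>
  define c where "c = ((cmod z)\<^sup>2 + 1) / (2 * Re z) + 1"
  have c: "c > 0" using z unfolding c_def by (intro add_nonneg_pos divide_nonneg_pos add_nonneg_nonneg) auto
  have near: "cmod (of_real c - z) < c"
  proof -
    have "(cmod z)\<^sup>2 < 2 * c * Re z" using z by (simp add: c_def field_simps add_pos_pos)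
    moreover have "(cmod (of_real c - z))\<^sup>2 = c\<^sup>2 - 2 * c * Re z + (cmod z)\<^sup>2"
      unfolding cmod_power2 by (simp add: power2_eq_square algebra_simps)
    ultimately have "(cmod (of_real c - z))\<^sup>2 < c\<^sup>2" by linarith
    then show ?thesis using c by (simp add: power_less_imp_less_base)
  qed
  define w where "w = of_real c - z"
  define q where "q = w / of_real c"
  define g where "g = (\<lambda>n x. indicator {0<..} x *\<^sub>R (complex_of_real x powr (s + of_nat n - 1) * exp (- of_real (c * x))))"
  have g: "has_bochner_integral lborel (g n) (Gamma (s + of_nat n) * of_real c powr (- (s + of_nat n)))" for n
    unfolding g_def using s c by (intro has_bochner_integral_Gamma_real_scale) auto
  define f where "f = (\<lambda>N x. \<Sum>n<N. w ^ n / fact n * g n x)"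
  have geq: "g n x = indicator {0<..} x *\<^sub>R (complex_of_real x powr (s - 1) * exp (- of_real (c * x)) * of_real x ^ n)" for n x
    by (auto simp: g_def indicator_def powr_add powr_diff powr_nat' field_simps)
  have fint: "has_bochner_integral lborel (f N) (\<Sum>n<N. w ^ n / fact n * (Gamma (s + of_nat n) * of_real c powr (- (s + of_nat n))))" for N
    unfolding f_def by (intro has_bochner_integral_sum has_bochner_integral_mult_right g)
  have s0: "s \<notin> \<int>\<^sub>\<le>\<^sub>0" using s by (auto elim!: nonpos_Ints_cases)
  \<comment> \<open>Since Gamma (s + n) = (s)_n Gamma s, the terms are those of the binomial series
    of (1 - q)^(-s), and 1 - q = z / c.\<close>
  have trm: "w ^ n / fact n * (Gamma (s + of_nat n) * of_real c powr (- (s + of_nat n)))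
      = Gamma s * of_real c powr (- s) * (((- s) gchoose n) * (- q) ^ n)" for n
  proof -
    have "Gamma (s + of_nat n) = pochhammer s n * Gamma s"
      using pochhammer_Gamma[OF s0, of n] s0 by (simp add: Gamma_eq_zero_iff)
    moreover have "complex_of_real c powr (- (s + of_nat n)) = of_real c powr (- s) / of_real c ^ n"
      using c by (simp add: powr_add powr_diff powr_minus divide_inverse powr_nat')
    ultimately show ?thesis
      using c by (simp add: gbinomial_pochhammer q_def power_divide power_minus' field_simps)
  qed
  have "cmod (- q) < 1" using near c by (simp add: q_def w_def norm_divide)
  from gen_binomial_complex[OF this, of "- s"]
  have "(\<lambda>N. \<Sum>n<N. w ^ n / fact n * (Gamma (s + of_nat n) * of_real c powr (- (s + of_nat n))))
     \<longlonglongrightarrow> Gamma s * of_real c powr (- s) * (1 + - q) powr (- s)"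
    unfolding trm sums_def by (simp flip: sum_distrib_left add: tendsto_mult_left)
  also have "Gamma s * of_real c powr (- s) * (1 + - q) powr (- s) = Gamma s * z powr (- s)"
  proof -
    have "1 + - q = z / of_real c" using c by (simp add: q_def w_def field_simps)
    moreover have "z \<noteq> 0" using z by auto
    \<comment> \<open>A positive real factor leaves the argument unchanged, so the principal
      branches multiply.\<close>
    then have "Ln (of_real c * (z / of_real c)) = of_real (ln c) + Ln (z / of_real c)"
      using c Ln_times_of_real[of c "z / of_real c"] by (simp add: Ln_of_real)
    then have "Ln z = of_real (ln c) + Ln (z / of_real c)" using c by simp
    ultimately show ?thesis using c \<open>z \<noteq> 0\<close>
      by (simp add: powr_def Ln_of_real exp_add[symmetric] ring_distribs)
  qed
  finally have lim1: "(\<lambda>N. \<Sum>n<N. w ^ n / fact n * (Gamma (s + of_nat n) * of_real c powr (- (s + of_nat n))))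
     \<longlonglongrightarrow> Gamma s * z powr (- s)" .
  let ?F = "\<lambda>x. indicator {0<..} x *\<^sub>R (complex_of_real x powr (s - 1) * exp (- z * of_real x))"
  have lim2: "(\<lambda>N. f N x) \<longlonglongrightarrow> ?F x" for x
  proof -
    have "(\<lambda>n. (w * of_real x) ^ n /\<^sub>R fact n) sums exp (w * of_real x)" by (rule exp_converges)
    then have "(\<lambda>N. (indicator {0<..} x *\<^sub>R (complex_of_real x powr (s - 1) * exp (- of_real (c * x)))) * (\<Sum>n<N. (w * of_real x) ^ n /\<^sub>R fact n))
       \<longlonglongrightarrow> (indicator {0<..} x *\<^sub>R (complex_of_real x powr (s - 1) * exp (- of_real (c * x)))) * exp (w * of_real x)"
      unfolding sums_def by (rule tendsto_mult_left)
    also have "(\<lambda>N. (indicator {0<..} x *\<^sub>R (complex_of_real x powr (s - 1) * exp (- of_real (c * x)))) * (\<Sum>n<N. (w * of_real x) ^ n /\<^sub>R fact n)) = (\<lambda>N. f N x)"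
      by (simp add: f_def geq sum_distrib_left scaleR_conv_of_real power_mult_distrib field_simps)
    also have "(indicator {0<..} x *\<^sub>R (complex_of_real x powr (s - 1) * exp (- of_real (c * x)))) * exp (w * of_real x) = ?F x"
      by (simp add: w_def mult_exp_exp algebra_simps)
    finally show ?thesis .
  qed
  \<comment> \<open>The partial sums of e^(w x) are bounded by e^(|w| x); the remaining rate c - |w|
    is positive by \<open>near\<close>.\<close>
  define W where "W = (\<lambda>x. indicator {0<..} x *\<^sub>R (complex_of_real x powr (of_real (Re s) - 1) * exp (- of_real ((c - cmod w) * x))))"
  have Wint: "integrable lborel W"
    using has_bochner_integral_Gamma_real_scale[of "of_real (Re s)" "c - cmod w"] s near
    unfolding W_def has_bochner_integral_iff w_def by simp
  have bound: "norm (f N x) \<le> norm (W x)" for N x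
  proof (cases "x > 0")
    case True
    have "norm (\<Sum>n<N. (w * of_real x) ^ n /\<^sub>R fact n) \<le> (\<Sum>n<N. norm ((w * of_real x) ^ n /\<^sub>R fact n))"
      by (rule norm_sum)
    also have "\<dots> = (\<Sum>n<N. (cmod w * x) ^ n /\<^sub>R fact n)"
      using True by (simp add: norm_power norm_mult)
    also have "\<dots> \<le> exp (cmod w * x)"
      unfolding exp_def using True by (intro sum_le_suminf summable_exp_generic) auto
    finally have *: "norm (\<Sum>n<N. (w * of_real x) ^ n /\<^sub>R fact n) \<le> exp (cmod w * x)" .
    have "f N x = complex_of_real x powr (s - 1) * exp (- of_real (c * x)) * (\<Sum>n<N. (w * of_real x) ^ n /\<^sub>R fact n)"
      using True by (simp add: f_def geq sum_distrib_left scaleR_conv_of_real power_mult_distrib field_simps)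
    then have "norm (f N x) \<le> x powr (Re s - 1) * exp (- (c * x)) * exp (cmod w * x)"
      using True * by (simp add: norm_mult norm_powr_real_powr)
    also have "\<dots> = norm (W x)"
      using True by (simp add: W_def norm_mult norm_powr_real_powr mult.assoc mult_exp_exp algebra_simps)
    finally show ?thesis .
  qed (auto simp: f_def g_def W_def)
  have m: "?F \<in> borel_measurable lborel" by measurable
  have fm: "f N \<in> borel_measurable lborel" for N
    using fint[of N] by (auto simp: has_bochner_integral_iff)
  have Wn: "integrable lborel (\<lambda>x. norm (W x))" using Wint by simp
  have "integrable lborel ?F"
    by (rule integrable_dominated_convergence[where s = f, OF m fm Wn]) (use lim2 bound in auto)
  moreover have "(\<lambda>N. integral\<^sup>L lborel (f N)) \<longlonglongrightarrow> integral\<^sup>L lborel ?F"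
    by (rule integral_dominated_convergence[where s = f, OF m fm Wn]) (use lim2 bound in auto)
  moreover have "integral\<^sup>L lborel (f N) = (\<Sum>n<N. w ^ n / fact n * (Gamma (s + of_nat n) * of_real c powr (- (s + of_nat n))))" for N
    using fint[of N] by (simp add: has_bochner_integral_iff)
  ultimately show ?thesis
    using lim1 LIMSEQ_unique by (simp add: has_bochner_integral_iff) blast
qed

lemma hankel_abs_0: "hankel_abs 0 t = (if t < 0 then - t else if t \<le> 2 * pi then 0 else t - 2 * pi)"
  by (simp add: hankel_abs_def)

text \<open>The upper side is traversed towards 0 and contributes minus the Gamma integral. The
  lower side contributes it with the factor e^(2 pi i (s - 1)) = e^(2 pi i s). The extra power of
  degree l raises Gamma s to Gamma (s + l), hence the Pochhammer symbol.\<close>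

lemma has_bochner_integral_hankel_0:
  assumes s: "Re s > 0" and z: "Re z > 0"
  shows "has_bochner_integral lborel (\<lambda>t. hankel_power 0 t (s - 1) * hankel_deriv 0 t *
      (of_real (hankel_abs 0 t) ^ l * exp (- z * of_real (hankel_abs 0 t))))
    ((exp (2 * of_real pi * \<i> * s) - 1) * Gamma s * pochhammer s l * z powr (- s - of_nat l))"
proof -
  define e where "e = exp (2 * of_real pi * \<i> * s)"
  define g where "g = (\<lambda>x. indicator {0<..} x *\<^sub>R (complex_of_real x powr (s + of_nat l - 1) * exp (- z * of_real x)))"
  define I where "I = Gamma (s + of_nat l) * z powr (- (s + of_nat l))"
  have s0: "s \<notin> \<int>\<^sub>\<le>\<^sub>0" using s by (auto elim!: nonpos_Ints_cases)
  have g: "has_bochner_integral lborel g I"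
    unfolding g_def I_def using s by (intro has_bochner_integral_Gamma_scale z) auto
  have g1: "has_bochner_integral lborel (\<lambda>t. g (0 + (-1) * t)) (I /\<^sub>R \<bar>-1\<bar>)"
    using g by (subst lborel_has_bochner_integral_real_affine_iff[symmetric]) auto
  have g2: "has_bochner_integral lborel (\<lambda>t. g (- 2 * pi + 1 * t)) (I /\<^sub>R \<bar>1\<bar>)"
    using g by (subst lborel_has_bochner_integral_real_affine_iff[symmetric]) auto
  have "has_bochner_integral lborel (\<lambda>t. e * g (- 2 * pi + 1 * t) - g (0 + (-1) * t))
      (e * (I /\<^sub>R \<bar>1\<bar>) - I /\<^sub>R \<bar>-1\<bar>)"
    by (intro has_bochner_integral_diff has_bochner_integral_mult_right g1 g2)
  also have "e * (I /\<^sub>R \<bar>1\<bar>) - I /\<^sub>R \<bar>-1\<bar> = (e - 1) * Gamma s * pochhammer s l * z powr (- s - of_nat l)"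
  proof -
    have "Gamma (s + of_nat l) = pochhammer s l * Gamma s"
      using pochhammer_Gamma[OF s0, of l] s0 by (simp add: Gamma_eq_zero_iff)
    then show ?thesis by (simp add: I_def algebra_simps)
  qed
  also have "(\<lambda>t. e * g (- 2 * pi + 1 * t) - g (0 + (-1) * t)) =
    (\<lambda>t. hankel_power 0 t (s - 1) * hankel_deriv 0 t *
      (of_real (hankel_abs 0 t) ^ l * exp (- z * of_real (hankel_abs 0 t))))"
  proof
    fix t :: real
    have pw: "complex_of_real x powr (s + of_nat l - 1) = exp ((s - 1) * of_real (ln x)) * of_real x ^ l"
      if "x > 0" for x
      using that by (simp add: powr_def Ln_of_real exp_add exp_diff algebra_simps exp_of_nat_mult exp_of_real)
    consider "t < 0" | "0 \<le> t" "t \<le> 2 * pi" | "t > 2 * pi" by linarith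
    then show "e * g (- 2 * pi + 1 * t) - g (0 + (-1) * t) =
      hankel_power 0 t (s - 1) * hankel_deriv 0 t *
      (of_real (hankel_abs 0 t) ^ l * exp (- z * of_real (hankel_abs 0 t)))"
    proof cases
      case 1
      then have "\<not> t > 2 * pi" using pi_gt_zero by linarith
      with 1 show ?thesis
        using pw[of "- t"]
        by (simp add: g_def hankel_power_def hankel_abs_0 hankel_arg_def hankel_deriv_def)
    next
      case 2
      then show ?thesis by (simp add: g_def hankel_deriv_def)
    next
      case 3
      then have t: "t > 0" using pi_gt_zero by linarith
      have "exp ((s - 1) * (of_real (ln (t - 2 * pi)) + \<i> * (2 * of_real pi))) = e * exp ((s - 1) * of_real (ln (t - 2 * pi)))"
      proof -
        have "(s - 1) * (of_real (ln (t - 2 * pi)) + \<i> * (2 * of_real pi)) =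
          2 * of_real pi * \<i> * s + (s - 1) * of_real (ln (t - 2 * pi)) - 2 * of_real pi * \<i>"
          by (simp add: algebra_simps)
        then show ?thesis by (simp add: exp_add exp_diff e_def)
      qed
      with 3 t show ?thesis
        using pw[of "t - 2 * pi"]
        by (simp add: g_def hankel_power_def hankel_abs_0 hankel_arg_def hankel_deriv_def)
    qed
  qed
  finally show ?thesis by (simp add: e_def)
qed

section \<open>Integrable majorants for the contour weights\<close>

lemma powr_times_exp_bounded:
  fixes b p :: real
  assumes "b > 0" "p \<ge> 0"
  shows "\<exists>K>0. \<forall>a\<ge>0. (1 + a) powr p * exp (- (b * a)) \<le> K"
proof -
  \<comment> \<open>Chosen so that \<theta> p <= b: raising 1 + a <= e^(\<theta> a) / \<theta> to
    the power p then costs no more than e^(b a). The p + 1 keeps the quotient meaningful for p =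
    0.\<close>
  define \<theta> where "\<theta> = min 1 (b / (p + 1))"
  have \<theta>: "0 < \<theta>" "\<theta> \<le> 1" using assms by (auto simp: \<theta>_def)
  have "\<theta> * p \<le> b / (p + 1) * p" using assms by (intro mult_right_mono) (auto simp: \<theta>_def)
  also have "\<dots> = b * (p / (p + 1))" by simp
  also have "\<dots> \<le> b * 1" using assms by (intro mult_left_mono) auto
  finally have \<theta>p: "\<theta> * p \<le> b" by simp
  have "(1 + a) powr p * exp (- (b * a)) \<le> (1 / \<theta>) powr p" if a: "a \<ge> 0" for a
  proof -
    have "(1 + a) powr p \<le> (exp (\<theta> * a) / \<theta>) powr p"
      using a \<theta> assms by (intro powr_mono2 one_plus_le_exp) auto
    also have "\<dots> = exp (\<theta> * p * a) * (1 / \<theta>) powr p"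
      using \<theta> by (simp add: powr_def ln_div mult_exp_exp algebra_simps)
    also have "\<dots> \<le> exp (b * a) * (1 / \<theta>) powr p"
      using \<theta>p a by (intro mult_right_mono) (auto intro: mult_right_mono)
    finally show ?thesis by (simp add: exp_minus field_simps)
  qed
  moreover have "(1 / \<theta>) powr p > 0" using \<theta> by simp
  ultimately show ?thesis by blast
qed

lemma abs_le_hankel_abs: "\<epsilon> \<ge> 0 \<Longrightarrow> \<bar>t\<bar> \<le> hankel_abs \<epsilon> t + 2 * pi"
  using pi_gt_zero by (auto simp: hankel_abs_def)

lemma norm_hankel_weight_off_circle:
  assumes "t < 0 \<or> t > 2 * pi" "\<epsilon> \<ge> 0"
  shows "norm (hankel_weight \<epsilon> t s b) \<le> exp (2 * pi * \<bar>Im s\<bar>) *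
    (hankel_abs \<epsilon> t powr (Re s - 1) * exp (- (Re b * hankel_abs \<epsilon> t)))"
proof -
  have a: "hankel_abs \<epsilon> t > 0" using assms pi_gt_zero by (auto simp: hankel_abs_def)
  have "norm (hankel_deriv \<epsilon> t) = 1" using assms(1) pi_gt_zero by (auto simp: hankel_deriv_def)
  moreover have "norm (exp (- b * hankel \<epsilon> t)) = exp (- (Re b * hankel_abs \<epsilon> t))"
    using assms(1) by (simp add: hankel_off_circle)
  ultimately have "norm (hankel_weight \<epsilon> t s b) = norm (hankel_power \<epsilon> t (s - 1)) * exp (- (Re b * hankel_abs \<epsilon> t))"
    by (simp add: hankel_weight_def norm_mult)
  also have "\<dots> \<le> (hankel_abs \<epsilon> t powr Re (s - 1) * exp (2 * pi * \<bar>Im (s - 1)\<bar>)) * exp (- (Re b * hankel_abs \<epsilon> t))"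
    by (intro mult_right_mono norm_hankel_power_le a) auto
  finally show ?thesis by (simp add: mult_ac)
qed

lemma norm_hankel_weight_circle:
  assumes "\<not> (t < 0 \<or> t > 2 * pi)" "0 < \<epsilon>" "\<epsilon> \<le> 1" "Re s \<ge> 1"
  shows "norm (hankel_weight \<epsilon> t s b) \<le> exp (2 * pi * \<bar>Im s\<bar>) * exp (norm b)"
proof -
  have ha: "hankel_abs \<epsilon> t = \<epsilon>" using assms by (auto simp: hankel_abs_def)
  have "norm (hankel_power \<epsilon> t (s - 1)) \<le> \<epsilon> powr (Re s - 1) * exp (2 * pi * \<bar>Im s\<bar>)"
    using norm_hankel_power_le[of \<epsilon> t "s - 1"] assms unfolding ha by simp
  also have "\<dots> \<le> 1 * exp (2 * pi * \<bar>Im s\<bar>)"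
    using assms by (intro mult_right_mono powr_le1) auto
  finally have 1: "norm (hankel_power \<epsilon> t (s - 1)) \<le> exp (2 * pi * \<bar>Im s\<bar>)" by simp
  have "norm (- b * hankel \<epsilon> t) = norm b * \<epsilon>" using assms by (simp add: norm_mult norm_hankel ha)
  also have "\<dots> \<le> norm b" using assms mult_left_mono[of \<epsilon> 1 "norm b"] by simp
  finally have "exp (norm (- b * hankel \<epsilon> t)) \<le> exp (norm b)" by (simp only: exp_le_cancel_iff)
  with norm_exp[of "- b * hankel \<epsilon> t"] have 2: "norm (exp (- b * hankel \<epsilon> t)) \<le> exp (norm b)" by (rule order_trans)
  have 3: "norm (hankel_deriv \<epsilon> t) \<le> 1" using assms by (auto simp: hankel_deriv_def norm_mult)
  have "norm (hankel_weight \<epsilon> t s b) \<le> exp (2 * pi * \<bar>Im s\<bar>) * exp (norm b) * 1"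
    unfolding hankel_weight_def norm_mult by (intro mult_mono 1 2 3 mult_nonneg_nonneg) auto
  then show ?thesis by simp
qed

text \<open>Of the surplus decay 2 b, one half absorbs the power of the modulus and the other half
  remains as decay in t. The factor e^(2 pi b) in \<open>K'\<close> accounts for the difference
  between |t| and the modulus, and for the bounded parameter range of the circle.\<close>

lemma hankel_weight_bound:
  assumes s: "Re s \<ge> 1" and b: "b > 0" "\<eta> \<ge> 0" "\<eta> + 2 * b \<le> Re \<beta>"
  shows "\<exists>K>0. \<forall>\<epsilon> t. 0 < \<epsilon> \<and> \<epsilon> \<le> 1 \<longrightarrow>
    norm (hankel_weight \<epsilon> t s \<beta>) * exp (\<eta> * hankel_abs \<epsilon> t) \<le> K * exp (- (b * \<bar>t\<bar>))"
proof -
  obtain K where K: "K > 0" "\<And>a. a \<ge> 0 \<Longrightarrow> (1 + a) powr (Re s - 1) * exp (- (b * a)) \<le> K"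
    using powr_times_exp_bounded[of b "Re s - 1"] s b by auto
  define e where "e = exp (2 * pi * \<bar>Im s\<bar>)"
  define K' where "K' = e * exp (b * (2 * pi)) * (K + exp (norm \<beta>) * exp \<eta>)"
  have e: "e > 0" by (simp add: e_def)
  have "norm (hankel_weight \<epsilon> t s \<beta>) * exp (\<eta> * hankel_abs \<epsilon> t) \<le> K' * exp (- (b * \<bar>t\<bar>))"
    if \<epsilon>: "0 < \<epsilon>" "\<epsilon> \<le> 1" for \<epsilon> t
  proof (cases "t < 0 \<or> t > 2 * pi")
    case True
    define a where "a = hankel_abs \<epsilon> t"
    have a: "a \<ge> 0" "b * \<bar>t\<bar> \<le> b * a + b * (2 * pi)"
      using abs_le_hankel_abs[of \<epsilon> t] \<epsilon> b hankel_abs_nonneg[of \<epsilon> t]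
      by (auto simp: a_def simp flip: ring_distribs)
    have "norm (hankel_weight \<epsilon> t s \<beta>) * exp (\<eta> * a) \<le> e * (a powr (Re s - 1) * exp (- (Re \<beta> * a))) * exp (\<eta> * a)"
      unfolding a_def e_def using True \<epsilon> by (intro mult_right_mono norm_hankel_weight_off_circle) auto
    also have "\<dots> = e * (a powr (Re s - 1) * exp (\<eta> * a - Re \<beta> * a))"
      by (simp add: exp_diff exp_minus field_simps)
    also have "\<dots> \<le> e * ((1 + a) powr (Re s - 1) * exp (- (b * a) - b * a))"
      using a b s e mult_right_mono[OF b(3) a(1)]
      by (intro mult_left_mono mult_mono powr_mono2) (auto simp: algebra_simps)
    also have "\<dots> = e * (((1 + a) powr (Re s - 1) * exp (- (b * a))) * exp (- (b * a)))"
      by (simp add: mult.assoc mult_exp_exp)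
    also have "\<dots> \<le> e * (K * exp (b * (2 * pi) - b * \<bar>t\<bar>))"
      using K a b e by (intro mult_left_mono mult_mono) auto
    also have "\<dots> = e * exp (b * (2 * pi)) * K * exp (- (b * \<bar>t\<bar>))"
      by (simp add: exp_diff exp_minus field_simps)
    also have "\<dots> \<le> K' * exp (- (b * \<bar>t\<bar>))"
      unfolding K'_def using e by (intro mult_right_mono mult_left_mono) auto
    finally show ?thesis by (simp add: a_def)
  next
    case False
    have a: "hankel_abs \<epsilon> t \<le> 1" "b * \<bar>t\<bar> \<le> b * (2 * pi)"
      using False \<epsilon> b by (auto simp: hankel_abs_def)
    have "norm (hankel_weight \<epsilon> t s \<beta>) * exp (\<eta> * hankel_abs \<epsilon> t) \<le> (e * exp (norm \<beta>)) * exp \<eta>"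
      unfolding e_def using False \<epsilon> s b mult_left_mono[OF a(1) b(2)]
      by (intro mult_mono norm_hankel_weight_circle) auto
    also have "\<dots> \<le> (e * exp (norm \<beta>)) * exp \<eta> * exp (b * (2 * pi) - b * \<bar>t\<bar>)"
      using a e mult_left_mono[of 1 "exp (b * (2 * pi) - b * \<bar>t\<bar>)" "(e * exp (norm \<beta>)) * exp \<eta>"] by simp
    also have "\<dots> = e * exp (b * (2 * pi)) * (exp (norm \<beta>) * exp \<eta>) * exp (- (b * \<bar>t\<bar>))"
      by (simp add: exp_diff exp_minus field_simps)
    also have "\<dots> \<le> K' * exp (- (b * \<bar>t\<bar>))"
      unfolding K'_def using e K by (intro mult_right_mono mult_left_mono) auto
    finally show ?thesis .
  qed
  moreover have "K' > 0" unfolding K'_def using e K by (intro mult_pos_pos add_pos_pos) auto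
  ultimately show ?thesis by blast
qed

text \<open>The modulus a occurs to the power Re s - 1 >= r, which cancels the pole of (1 + 1 / a)^r
  = ((1 + a) / a)^r and leaves at most (1 + a)^(Re s - 1).\<close>

lemma hankel_weight_0_bound:
  assumes s: "Re s \<ge> 1 + real r" and b: "b > 0" "\<eta> \<ge> 0" "\<eta> + 2 * b \<le> Re \<beta>"
  shows "\<exists>K>0. \<forall>t. norm (hankel_weight 0 t s \<beta>) * exp (\<eta> * hankel_abs 0 t) * (1 + 1 / hankel_abs 0 t) ^ r
    \<le> K * exp (- (b * \<bar>t\<bar>))"
proof -
  obtain K where K: "K > 0" "\<And>a. a \<ge> 0 \<Longrightarrow> (1 + a) powr (Re s - 1) * exp (- (b * a)) \<le> K"
    using powr_times_exp_bounded[of b "Re s - 1"] s b by auto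
  define e where "e = exp (2 * pi * \<bar>Im s\<bar>)"
  define K' where "K' = e * exp (b * (2 * pi)) * K"
  have e: "e > 0" by (simp add: e_def)
  have K': "K' > 0" unfolding K'_def using e K by (intro mult_pos_pos) auto
  have "norm (hankel_weight 0 t s \<beta>) * exp (\<eta> * hankel_abs 0 t) * (1 + 1 / hankel_abs 0 t) ^ r \<le> K' * exp (- (b * \<bar>t\<bar>))" for t
  proof (cases "t < 0 \<or> t > 2 * pi")
    case True
    define a where "a = hankel_abs 0 t"
    have a: "a > 0" "b * \<bar>t\<bar> \<le> b * a + b * (2 * pi)"
      using abs_le_hankel_abs[of 0 t] b True pi_gt_zero
      by (auto simp: a_def hankel_abs_def simp flip: ring_distribs)
    have pw: "a powr (Re s - 1) * (1 + 1 / a) ^ r \<le> (1 + a) powr (Re s - 1)"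
    proof -
      have "a powr (Re s - 1) * (1 + 1 / a) ^ r = a powr (Re s - 1) * ((1 + a) powr real r / a powr real r)"
        using a by (simp add: powr_realpow field_simps flip: power_divide)
      also have "\<dots> = a powr (Re s - 1 - real r) * (1 + a) powr real r"
        by (simp add: powr_diff)
      also have "\<dots> \<le> (1 + a) powr (Re s - 1 - real r) * (1 + a) powr real r"
        using a s by (intro mult_right_mono powr_mono2) auto
      also have "\<dots> = (1 + a) powr (Re s - 1)" by (simp flip: powr_add)
      finally show ?thesis .
    qed
    have "norm (hankel_weight 0 t s \<beta>) * exp (\<eta> * a) * (1 + 1 / a) ^ r
       \<le> e * (a powr (Re s - 1) * exp (- (Re \<beta> * a))) * exp (\<eta> * a) * (1 + 1 / a) ^ r"
      unfolding a_def e_def using True a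
      by (intro mult_right_mono norm_hankel_weight_off_circle) (auto simp: a_def)
    also have "\<dots> = e * ((a powr (Re s - 1) * (1 + 1 / a) ^ r) * exp (\<eta> * a - Re \<beta> * a))"
      by (simp add: exp_diff exp_minus field_simps)
    also have "\<dots> \<le> e * ((1 + a) powr (Re s - 1) * exp (- (b * a) - b * a))"
      using a b e mult_right_mono[OF b(3), of a]
      by (intro mult_left_mono mult_mono pw) (auto simp: algebra_simps)
    also have "\<dots> = e * (((1 + a) powr (Re s - 1) * exp (- (b * a))) * exp (- (b * a)))"
      by (simp add: mult.assoc mult_exp_exp)
    also have "\<dots> \<le> e * (K * exp (b * (2 * pi) - b * \<bar>t\<bar>))"
      using K a b e by (intro mult_left_mono mult_mono) auto
    also have "\<dots> = K' * exp (- (b * \<bar>t\<bar>))"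
      by (simp add: K'_def exp_diff exp_minus field_simps)
    finally show ?thesis by (simp add: a_def)
  next
    case False
    then show ?thesis using K' by (simp add: hankel_weight_def hankel_deriv_def)
  qed
  with K' show ?thesis by blast
qed

lemma integrable_exp_minus_abs:
  assumes "b > 0" shows "integrable lborel (\<lambda>t::real. exp (- (b * \<bar>t\<bar>)))"
proof -
  define g where "g = (\<lambda>x. indicator {0<..} x * exp (- (b * x)))"
  have "integrable lborel (\<lambda>x. norm (indicator {0<..} x *\<^sub>R (complex_of_real x powr (1 - 1) * exp (- of_real (b * x)))))"
    using has_bochner_integral_Gamma_real_scale[of 1 b] assms by (intro integrable_norm) (auto simp: has_bochner_integral_iff)
  also have "(\<lambda>x. norm (indicator {0<..} x *\<^sub>R (complex_of_real x powr (1 - 1) * exp (- of_real (b * x))))) = g"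
    by (auto simp: g_def indicator_def norm_mult)
  finally have g: "integrable lborel g" .
  have "integrable lborel (\<lambda>x. g (0 + (-1) * x))"
    by (rule lborel_integrable_real_affine[OF g]) simp
  \<comment> \<open>Both halves vanish at 0, where the two-sided exponential equals 1; the indicator
    restores this one point.\<close>
  then have "integrable lborel (\<lambda>x. g x + g (- x) + indicator {0} x)"
    using g by (intro Bochner_Integration.integrable_add) auto
  also have "(\<lambda>x. g x + g (- x) + indicator {0} x) = (\<lambda>t. exp (- (b * \<bar>t\<bar>)))"
    by (auto simp: g_def indicator_def fun_eq_iff)
  finally show ?thesis .
qed

subsection \<open>Absolute convergence of the zeta series\<close>

text \<open>Cubes are used because every finite set lies in one, so they compute unordered sums, and
  because a sum of products over a cube factors into one-variable partial sums.\<close>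

definition nat_box :: "nat \<Rightarrow> (nat^'r) set" where
  "nat_box N = {m. \<forall>k. m $ k < N}"

lemma nat_box_eq: "nat_box N = vec_lambda ` (PiE UNIV (\<lambda>_. {..<N}))"
proof -
  have "m \<in> vec_lambda ` (PiE UNIV (\<lambda>_. {..<N}))" if "m \<in> nat_box N" for m :: "nat^'r"
    using that by (intro image_eqI[of _ _ "vec_nth m"]) (auto simp: nat_box_def)
  then show ?thesis by (auto simp: nat_box_def PiE_def Pi_def)
qed

lemma finite_nat_box: "finite (nat_box N :: (nat^'r::finite) set)"
  unfolding nat_box_eq by (intro finite_imageI finite_PiE) auto

lemma finite_subset_nat_box:
  assumes "finite X" shows "\<exists>N. X \<subseteq> (nat_box N :: (nat^'r::finite) set)"
proof -
  let ?N = "Suc (\<Sum>m\<in>X. \<Sum>k\<in>UNIV. m $ k)"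
  have "m $ k < ?N" if "m \<in> X" for m k
  proof -
    have "m $ k \<le> (\<Sum>k\<in>UNIV. m $ k)" by (intro member_le_sum) auto
    also have "\<dots> \<le> (\<Sum>m\<in>X. \<Sum>k\<in>UNIV. m $ k)"
      using that assms by (intro member_le_sum[of m X "\<lambda>m. \<Sum>k\<in>UNIV. m $ k"]) auto
    finally show ?thesis by simp
  qed
  then show ?thesis by (intro exI[of _ ?N]) (auto simp: nat_box_def)
qed

lemma nat_box_mono: "N \<le> M \<Longrightarrow> nat_box N \<subseteq> nat_box M"
  by (auto simp: nat_box_def intro: less_le_trans)

lemma filterlim_nat_box:
  "filterlim (nat_box :: nat \<Rightarrow> (nat^'r::finite) set) (finite_subsets_at_top UNIV) sequentially"
  unfolding filterlim_finite_subsets_at_top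
proof (intro allI impI)
  fix X :: "(nat^'r) set" assume "finite X \<and> X \<subseteq> UNIV"
  then obtain N where "X \<subseteq> nat_box N" using finite_subset_nat_box by blast
  then show "\<forall>\<^sub>F n in sequentially. finite (nat_box n :: (nat^'r) set) \<and> X \<subseteq> nat_box n \<and> nat_box n \<subseteq> (UNIV :: (nat^'r) set)"
    using nat_box_mono finite_nat_box unfolding eventually_sequentially by (metis subset_UNIV subset_trans)
qed

lemma sum_nat_box_prod:
  fixes f :: "'r::finite \<Rightarrow> nat \<Rightarrow> 'a::comm_semiring_1"
  shows "(\<Sum>m\<in>nat_box N. \<Prod>k\<in>UNIV. f k (m $ k)) = (\<Prod>k\<in>UNIV. \<Sum>m<N. f k m)"
proof -
  have inj: "inj_on vec_lambda (PiE UNIV (\<lambda>_::'r. {..<N}))"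
    by (auto simp: inj_on_def vec_lambda_inject)
  show ?thesis
    unfolding nat_box_eq by (subst sum.reindex[OF inj]) (simp add: prod_sum_PiE)
qed

text \<open>The last two assumptions are derived, not postulated, in the final section: the first of
  them from the pole-free contours of the desingularization, the second from the relation between
  \<open>C\<close> and \<gamma>.\<close>

locale hl_data =
  fixes \<xi> :: "complex^'r::finite" and \<gamma> :: "complex^'r^'d::finite" and \<beta> :: "complex^'d"
  assumes norm_\<xi>: "norm (\<xi> $ k) \<le> 1"
    and Re_\<gamma>: "Re (\<gamma> $ j $ k) \<ge> 0"
    and Re_\<beta>: "Re (\<beta> $ j) > 0"
    and Re_\<gamma>_pos: "norm (\<xi> $ k) = 1 \<Longrightarrow> \<gamma> $ j $ k \<noteq> 0 \<Longrightarrow> Re (\<gamma> $ j $ k) > 0"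
    and \<gamma>_nonzero: "\<exists>j. \<gamma> $ j $ k \<noteq> 0"
begin

definition hl_base :: "nat^'r \<Rightarrow> 'd \<Rightarrow> complex" where
  "hl_base m j = \<beta> $ j + (\<Sum>k\<in>UNIV. \<gamma> $ j $ k * of_nat (m $ k))"

definition \<beta>0 :: real where "\<beta>0 = Min (range (\<lambda>j. Re (\<beta> $ j)))"

lemma \<beta>0: "\<beta>0 > 0" "\<beta>0 \<le> Re (\<beta> $ j)"
  unfolding \<beta>0_def using Re_\<beta> by (auto intro!: Min_le)

lemma Re_hl_base: "Re (hl_base m j) = Re (\<beta> $ j) + (\<Sum>k\<in>UNIV. Re (\<gamma> $ j $ k) * real (m $ k))"
  by (simp add: hl_base_def)

lemma Re_hl_base_ge: "Re (hl_base m j) \<ge> \<beta>0 + Re (\<gamma> $ j $ k) * real (m $ k)"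
proof -
  have "Re (\<gamma> $ j $ k) * real (m $ k) \<le> (\<Sum>k\<in>UNIV. Re (\<gamma> $ j $ k) * real (m $ k))"
    using Re_\<gamma> by (intro member_le_sum) auto
  then show ?thesis using \<beta>0(2)[of j] by (simp add: Re_hl_base)
qed

lemma Re_hl_base_ge_\<beta>0: "Re (hl_base m j) \<ge> \<beta>0"
proof -
  have "0 \<le> (\<Sum>k\<in>UNIV. Re (\<gamma> $ j $ k) * real (m $ k))"
    using Re_\<gamma> by (intro sum_nonneg) auto
  then show ?thesis using \<beta>0(2)[of j] by (simp add: Re_hl_base)
qed

lemma Re_hl_base_pos: "Re (hl_base m j) > 0"
  using Re_hl_base_ge_\<beta>0[of m j] \<beta>0(1) by linarith

definition hl_majorant :: "'r \<Rightarrow> nat \<Rightarrow> real" where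
  "hl_majorant k m = (if norm (\<xi> $ k) = 1 then (1 / real (Suc m))\<^sup>2 else norm (\<xi> $ k) ^ m)"

lemma summable_hl_majorant: "summable (hl_majorant k)"
proof (cases "norm (\<xi> $ k) = 1")
  case True
  have "summable (\<lambda>n. inverse ((real (Suc n))\<^sup>2))"
    using inverse_power_summable[of 2, where 'a = real] by (subst summable_Suc_iff) simp
  then show ?thesis using True by (simp add: hl_majorant_def[abs_def] power_divide divide_inverse power_inverse)
next
  case False
  then have "norm (\<xi> $ k) < 1" using norm_\<xi>[of k] by simp
  then show ?thesis using False by (simp add: hl_majorant_def[abs_def] summable_geometric)
qed

lemma hl_majorant_nonneg: "hl_majorant k m \<ge> 0"
  by (simp add: hl_majorant_def)

text \<open>If |\<xi>_k| = 1, some coordinate i has Re \<gamma>_ik > 0, so its base grows linearly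
  in m_k and its inverse square gives the decay; the other coordinates are bounded through \<beta>0.
  One set of inverse squares is spent per index k.\<close>

lemma hl_majorant_bound:
  "\<exists>K\<ge>0. \<forall>m. norm (\<xi> $ k) ^ (m $ k) * (\<Prod>j\<in>UNIV. (1 / Re (hl_base m j))\<^sup>2) \<le> K * hl_majorant k (m $ k)"
proof (cases "norm (\<xi> $ k) = 1")
  case False
  have "norm (\<xi> $ k) ^ (m $ k) * (\<Prod>j\<in>UNIV. (1 / Re (hl_base m j))\<^sup>2)
    \<le> (\<Prod>j\<in>(UNIV::'d set). (1 / \<beta>0)\<^sup>2) * norm (\<xi> $ k) ^ (m $ k)" for m
    unfolding mult.commute[of "norm (\<xi> $ k) ^ (m $ k)"]
    using Re_hl_base_ge_\<beta>0 \<beta>0(1) Re_hl_base_pos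
    by (intro mult_right_mono prod_mono conjI power_mono frac_le) (auto simp: less_imp_le)
  then show ?thesis using False
    by (intro exI[of _ "\<Prod>j\<in>(UNIV::'d set). (1 / \<beta>0)\<^sup>2"]) (auto simp: hl_majorant_def prod_nonneg)
next
  case True
  obtain i where i: "\<gamma> $ i $ k \<noteq> 0" using \<gamma>_nonzero by blast
  define g where "g = min \<beta>0 (Re (\<gamma> $ i $ k))"
  have g: "g > 0" using \<beta>0 Re_\<gamma>_pos[OF True i] by (simp add: g_def)
  have "norm (\<xi> $ k) ^ (m $ k) * (\<Prod>j\<in>UNIV. (1 / Re (hl_base m j))\<^sup>2) \<le>
    ((1 / g)\<^sup>2 * (\<Prod>j\<in>UNIV - {i}. (1 / \<beta>0)\<^sup>2)) * (1 / real (Suc (m $ k)))\<^sup>2" for m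
  proof -
    have "g * real (m $ k) \<le> Re (\<gamma> $ i $ k) * real (m $ k)" by (intro mult_right_mono) (auto simp: g_def)
    moreover have "g \<le> \<beta>0" by (simp add: g_def)
    ultimately have "Re (hl_base m i) \<ge> g * real (Suc (m $ k))"
      using Re_hl_base_ge[of i k m] by (simp add: algebra_simps)
    then have "1 / Re (hl_base m i) \<le> 1 / (g * real (Suc (m $ k)))"
      using g by (intro frac_le mult_pos_pos) auto
    then have 1: "(1 / Re (hl_base m i))\<^sup>2 \<le> (1 / (g * real (Suc (m $ k))))\<^sup>2"
      using Re_hl_base_pos[of m i] by (intro power_mono) auto
    have 2: "(\<Prod>j\<in>UNIV - {i}. (1 / Re (hl_base m j))\<^sup>2) \<le> (\<Prod>j\<in>UNIV - {i}. (1 / \<beta>0)\<^sup>2)"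
      using Re_hl_base_ge_\<beta>0 \<beta>0(1) Re_hl_base_pos
      by (intro prod_mono conjI power_mono frac_le) (auto simp: less_imp_le)
    have "(\<Prod>j\<in>UNIV. (1 / Re (hl_base m j))\<^sup>2) = (1 / Re (hl_base m i))\<^sup>2 * (\<Prod>j\<in>UNIV - {i}. (1 / Re (hl_base m j))\<^sup>2)"
      by (rule prod.remove) auto
    also have "\<dots> \<le> (1 / (g * real (Suc (m $ k))))\<^sup>2 * (\<Prod>j\<in>UNIV - {i}. (1 / \<beta>0)\<^sup>2)"
      using 1 2 by (intro mult_mono) (auto simp: prod_nonneg)
    also have "\<dots> = ((1 / g)\<^sup>2 * (\<Prod>j\<in>UNIV - {i}. (1 / \<beta>0)\<^sup>2)) * (1 / real (Suc (m $ k)))\<^sup>2"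
      by (simp add: power_divide power_mult_distrib)
    finally show ?thesis using True by simp
  qed
  then show ?thesis using True
    by (intro exI[of _ "(1 / g)\<^sup>2 * (\<Prod>j\<in>UNIV - {i}. (1 / \<beta>0)\<^sup>2)"])
      (auto simp: hl_majorant_def prod_nonneg)
qed

text \<open>In the right half-plane the argument is at most pi, which bounds the effect of Im s. Of
  the power Re s, the part n is kept as decay and the surplus is estimated by the lower bound
  b.\<close>

lemma norm_inverse_powr_le:
  assumes z: "Re z \<ge> b" "b > 0" and s: "Re s \<ge> real n"
  shows "1 / norm (z powr s) \<le> exp (\<bar>Im s\<bar> * pi) * (1 / b) powr (Re s - real n) * (1 / Re z) ^ n"
proof -
  have z0: "z \<noteq> 0" "Re z > 0" using z by auto
  have nz: "Re z \<le> norm z" by (rule complex_Re_le_cmod)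
  have "\<bar>Im s * Im (Ln z)\<bar> \<le> \<bar>Im s\<bar> * pi"
    unfolding abs_mult using Im_Ln_le_pi[OF z0(1)] mpi_less_Im_Ln[OF z0(1)] by (intro mult_left_mono) auto
  then have "Im s * Im (Ln z) \<le> \<bar>Im s\<bar> * pi" by linarith
  then have le: "- (Re s * ln (norm z)) + Im s * Im (Ln z) \<le> \<bar>Im s\<bar> * pi - Re s * ln (norm z)" by linarith
  have "1 / norm (z powr s) = 1 / exp (Re (s * Ln z))"
    using z0 by (simp add: powr_def)
  also have "\<dots> = exp (- Re (s * Ln z))" by (simp only: exp_minus inverse_eq_divide)
  also have "\<dots> = exp (- (Re s * ln (norm z)) + Im s * Im (Ln z))" using z0 by simp
  also have "\<dots> \<le> exp (\<bar>Im s\<bar> * pi - Re s * ln (norm z))" using le by (simp only: exp_le_cancel_iff)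
  also have "\<dots> = exp (\<bar>Im s\<bar> * pi) * (1 / norm z) powr Re s"
  proof -
    have "(1 / norm z) powr Re s = exp (- (Re s * ln (norm z)))" using z0 by (simp add: powr_def ln_div)
    then show ?thesis by (simp add: exp_diff exp_minus inverse_eq_divide)
  qed
  also have "(1 / norm z) powr Re s = (1 / norm z) powr (Re s - real n) * (1 / norm z) ^ n"
    using z0 by (simp add: powr_diff powr_realpow)
  also have "exp (\<bar>Im s\<bar> * pi) * \<dots> \<le> exp (\<bar>Im s\<bar> * pi) * ((1 / b) powr (Re s - real n) * (1 / Re z) ^ n)"
    using z z0 nz s by (intro mult_left_mono mult_mono powr_mono2 power_mono frac_le) auto
  finally show ?thesis by (simp add: mult.assoc)
qed

text \<open>Each of the r indices consumes one inverse square of every base in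
  \<open>hl_majorant_bound\<close>; this is why every Re s_j is at least 2 r.\<close>

lemma norm_hl_term_le:
  assumes s: "\<And>j. Re (s $ j) \<ge> 2 * real CARD('r)"
  shows "\<exists>K\<ge>0. \<forall>m. norm (hl_term \<xi> \<gamma> \<beta> s m) \<le> K * (\<Prod>k\<in>UNIV. hl_majorant k (m $ k))"
proof -
  obtain K where K: "\<And>k. K k \<ge> 0" "\<And>k m. norm (\<xi> $ k) ^ (m $ k) * (\<Prod>j\<in>UNIV. (1 / Re (hl_base m j))\<^sup>2) \<le> K k * hl_majorant k (m $ k)"
    using hl_majorant_bound by metis
  define A where "A = (\<lambda>j. exp (\<bar>Im (s $ j)\<bar> * pi) * (1 / \<beta>0) powr (Re (s $ j) - real (2 * CARD('r))))"
  have "norm (hl_term \<xi> \<gamma> \<beta> s m) \<le> ((\<Prod>j\<in>UNIV. A j) * (\<Prod>k\<in>UNIV. K k)) * (\<Prod>k\<in>UNIV. hl_majorant k (m $ k))" for m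
  proof -
    have "norm (hl_term \<xi> \<gamma> \<beta> s m) = (\<Prod>k\<in>UNIV. norm (\<xi> $ k) ^ (m $ k)) * (\<Prod>j\<in>UNIV. 1 / norm (hl_base m j powr (s $ j)))"
      by (simp add: hl_term_def hl_base_def norm_divide prod_norm[symmetric] norm_power prod_dividef)
    also have "\<dots> \<le> (\<Prod>k\<in>UNIV. norm (\<xi> $ k) ^ (m $ k)) * (\<Prod>j\<in>UNIV. A j * (1 / Re (hl_base m j)) ^ (2 * CARD('r)))"
      unfolding A_def using s Re_hl_base_ge_\<beta>0 \<beta>0(1)
      by (intro mult_left_mono prod_mono conjI norm_inverse_powr_le prod_nonneg) auto
    also have "\<dots> = (\<Prod>j\<in>UNIV. A j) * ((\<Prod>k\<in>UNIV. norm (\<xi> $ k) ^ (m $ k)) * (\<Prod>j\<in>UNIV. (1 / Re (hl_base m j))\<^sup>2) ^ CARD('r))"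
      by (simp add: prod.distrib power_mult prod_power_distrib)
    also have "\<dots> = (\<Prod>j\<in>UNIV. A j) * (\<Prod>k\<in>UNIV. norm (\<xi> $ k) ^ (m $ k) * (\<Prod>j\<in>UNIV. (1 / Re (hl_base m j))\<^sup>2))"
      by (simp add: prod.distrib)
    also have "\<dots> \<le> (\<Prod>j\<in>UNIV. A j) * (\<Prod>k\<in>UNIV. K k * hl_majorant k (m $ k))"
      by (intro mult_left_mono prod_mono conjI K(2) prod_nonneg mult_nonneg_nonneg) (auto simp: A_def)
    finally show ?thesis by (simp add: prod.distrib mult.assoc)
  qed
  moreover have "(\<Prod>j\<in>UNIV. A j) * (\<Prod>k\<in>UNIV. K k) \<ge> 0"
    using K(1) by (intro mult_nonneg_nonneg prod_nonneg) (auto simp: A_def)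
  ultimately show ?thesis by blast
qed

lemma summable_on_norm_hl_term:
  assumes s: "\<And>j. Re (s $ j) \<ge> 2 * real CARD('r)"
  shows "(\<lambda>m. norm (hl_term \<xi> \<gamma> \<beta> s m)) summable_on UNIV"
proof -
  obtain K where K: "K \<ge> 0" "\<And>m. norm (hl_term \<xi> \<gamma> \<beta> s m) \<le> K * (\<Prod>k\<in>UNIV. hl_majorant k (m $ k))"
    using norm_hl_term_le[OF s] by blast
  have "sum (\<lambda>m. norm (hl_term \<xi> \<gamma> \<beta> s m)) F \<le> K * (\<Prod>k\<in>UNIV. suminf (hl_majorant k))" if F: "finite F" for F
  proof -
    obtain N where N: "F \<subseteq> nat_box N" using finite_subset_nat_box[OF F] by blast
    have "sum (\<lambda>m. norm (hl_term \<xi> \<gamma> \<beta> s m)) F \<le> sum (\<lambda>m. norm (hl_term \<xi> \<gamma> \<beta> s m)) (nat_box N)"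
      by (intro sum_mono2 finite_nat_box N) auto
    also have "\<dots> \<le> (\<Sum>m\<in>nat_box N. K * (\<Prod>k\<in>UNIV. hl_majorant k (m $ k)))"
      by (intro sum_mono K)
    also have "\<dots> = K * (\<Prod>k\<in>UNIV. \<Sum>m<N. hl_majorant k m)"
      by (simp add: sum_nat_box_prod flip: sum_distrib_left)
    also have "\<dots> \<le> K * (\<Prod>k\<in>UNIV. suminf (hl_majorant k))"
      by (intro mult_left_mono prod_mono conjI sum_nonneg sum_le_suminf summable_hl_majorant K(1))
         (auto simp: hl_majorant_nonneg)
    finally show ?thesis .
  qed
  then show ?thesis
    by (intro nonneg_bdd_above_summable_on bdd_aboveI) auto
qed

subsection \<open>Passage to the limit under the integral\<close>

definition hl_lin :: "('d \<Rightarrow> real) \<Rightarrow> 'r \<Rightarrow> complex" where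
  "hl_lin x k = (\<Sum>j\<in>UNIV. \<gamma> $ j $ k * of_real (x j))"

text \<open>A common bound for all row and column sums of |\<gamma>_jk|; the added 1 allows division
  by it.\<close>

definition \<gamma>_size :: real where
  "\<gamma>_size = 1 + (\<Sum>j\<in>UNIV. \<Sum>k\<in>UNIV. norm (\<gamma> $ j $ k))"

lemma \<gamma>_size_ge_1: "\<gamma>_size \<ge> 1"
  unfolding \<gamma>_size_def by (simp add: sum_nonneg)

lemma sum_norm_\<gamma>_le: "(\<Sum>k\<in>UNIV. norm (\<gamma> $ j $ k)) \<le> \<gamma>_size"
proof -
  have "(\<Sum>k\<in>UNIV. norm (\<gamma> $ j $ k)) \<le> (\<Sum>j\<in>UNIV. \<Sum>k\<in>UNIV. norm (\<gamma> $ j $ k))"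
    by (intro member_le_sum[of j UNIV "\<lambda>j. \<Sum>k\<in>UNIV. norm (\<gamma> $ j $ k)"]) (auto intro: sum_nonneg)
  then show ?thesis by (simp add: \<gamma>_size_def)
qed

lemma hankel_lin_0: "hankel_lin \<gamma> 0 t k = hl_lin (\<lambda>j. hankel_abs 0 (t $ j)) k"
  by (simp add: hankel_lin_def hl_lin_def hankel_0)

lemma sum_norm_hankel_lin_le:
  assumes "\<epsilon> \<ge> 0"
  shows "(\<Sum>k\<in>UNIV. norm (hankel_lin \<gamma> \<epsilon> t k)) \<le> \<gamma>_size * (\<Sum>j\<in>UNIV. hankel_abs \<epsilon> (t $ j))"
proof -
  have "(\<Sum>k\<in>UNIV. norm (hankel_lin \<gamma> \<epsilon> t k)) \<le> (\<Sum>k\<in>UNIV. \<Sum>j\<in>UNIV. norm (\<gamma> $ j $ k) * hankel_abs \<epsilon> (t $ j))"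
    unfolding hankel_lin_def using assms
    by (intro sum_mono sum_norm_le) (simp add: norm_mult norm_hankel)
  also have "\<dots> = (\<Sum>j\<in>UNIV. (\<Sum>k\<in>UNIV. norm (\<gamma> $ j $ k)) * hankel_abs \<epsilon> (t $ j))"
    by (subst sum.swap) (simp add: sum_distrib_right)
  also have "\<dots> \<le> (\<Sum>j\<in>UNIV. \<gamma>_size * hankel_abs \<epsilon> (t $ j))"
    using assms by (intro sum_mono mult_right_mono sum_norm_\<gamma>_le hankel_abs_nonneg)
  finally show ?thesis by (simp add: sum_distrib_left)
qed

lemma norm_hankel_lin_diff_le:
  assumes "\<epsilon> \<ge> 0"
  shows "norm (hankel_lin \<gamma> \<epsilon> t k - hankel_lin \<gamma> 0 t k) \<le> \<gamma>_size * \<epsilon>"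
proof -
  have "hankel_lin \<gamma> \<epsilon> t k - hankel_lin \<gamma> 0 t k
      = (\<Sum>j\<in>UNIV. \<gamma> $ j $ k * (hankel \<epsilon> (t $ j) - of_real (hankel_abs 0 (t $ j))))"
    by (simp add: hankel_lin_def hankel_0 sum_subtractf right_diff_distrib)
  also have "norm \<dots> \<le> (\<Sum>j\<in>UNIV. norm (\<gamma> $ j $ k) * \<epsilon>)"
    unfolding norm_mult[symmetric] using assms
    by (intro sum_norm_le) (simp add: norm_mult mult_left_mono norm_hankel_minus_hankel_0_le)
  also have "\<dots> = (\<Sum>j\<in>UNIV. norm (\<gamma> $ j $ k)) * \<epsilon>" by (simp add: sum_distrib_right)
  also have "\<dots> \<le> \<gamma>_size * \<epsilon>"
  proof (rule mult_right_mono[OF _ assms])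
    have "(\<Sum>j\<in>UNIV. norm (\<gamma> $ j $ k)) \<le> (\<Sum>j\<in>UNIV. \<Sum>k\<in>UNIV. norm (\<gamma> $ j $ k))"
      by (intro sum_mono member_le_sum) auto
    then show "(\<Sum>j\<in>UNIV. norm (\<gamma> $ j $ k)) \<le> \<gamma>_size" by (simp add: \<gamma>_size_def)
  qed
  finally show ?thesis .
qed

lemma Re_hl_lin: "Re (hl_lin x k) = (\<Sum>j\<in>UNIV. Re (\<gamma> $ j $ k) * x j)"
  by (simp add: hl_lin_def)

lemma Re_hl_lin_nonneg: "(\<And>j. x j \<ge> 0) \<Longrightarrow> Re (hl_lin x k) \<ge> 0"
  unfolding Re_hl_lin using Re_\<gamma> by (intro sum_nonneg mult_nonneg_nonneg) auto

lemma Re_hl_lin_ge: "(\<And>j. x j \<ge> 0) \<Longrightarrow> Re (hl_lin x k) \<ge> Re (\<gamma> $ i $ k) * x i"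
  unfolding Re_hl_lin using Re_\<gamma>
  by (intro member_le_sum[of i UNIV "\<lambda>j. Re (\<gamma> $ j $ k) * x j"] mult_nonneg_nonneg) auto

text \<open>The least ratio Re \<gamma>_jk / |\<gamma>_jk| over the nonzero entries of the relevant
  columns works: a sector around the positive axis is a convex cone, so it contains all nonnegative
  combinations.\<close>

lemma sector_constant:
  obtains \<kappa> where "0 < \<kappa>" "\<kappa> \<le> 1"
    "\<And>x k. (\<And>j. x j \<ge> 0) \<Longrightarrow> norm (\<xi> $ k) = 1 \<Longrightarrow> \<kappa> * norm (hl_lin x k) \<le> Re (hl_lin x k)"
proof -
  define q where "q = (\<lambda>(j, k). if \<gamma> $ j $ k = 0 \<or> norm (\<xi> $ k) \<noteq> 1 then 1 else Re (\<gamma> $ j $ k) / norm (\<gamma> $ j $ k))"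
  define \<kappa> where "\<kappa> = Min (insert 1 (range q))"
  have "q p > 0" for p using Re_\<gamma>_pos by (auto simp: q_def split: prod.split)
  then have 1: "\<kappa> > 0" unfolding \<kappa>_def by auto
  have 2: "\<kappa> \<le> 1" unfolding \<kappa>_def by (intro Min_le) auto
  have 3: "\<kappa> * norm (\<gamma> $ j $ k) \<le> Re (\<gamma> $ j $ k)" if "norm (\<xi> $ k) = 1" for j k
  proof (cases "\<gamma> $ j $ k = 0")
    case False
    have "\<kappa> \<le> q (j, k)" unfolding \<kappa>_def by (intro Min_le) auto
    then show ?thesis using that False by (simp add: q_def field_simps)
  qed simp
  have "\<kappa> * norm (hl_lin x k) \<le> Re (hl_lin x k)" if x: "\<And>j. x j \<ge> 0" "norm (\<xi> $ k) = 1" for x k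
  proof -
    have "norm (hl_lin x k) \<le> (\<Sum>j\<in>UNIV. norm (\<gamma> $ j $ k) * x j)"
      unfolding hl_lin_def using x by (intro sum_norm_le) (simp add: norm_mult)
    then have "\<kappa> * norm (hl_lin x k) \<le> \<kappa> * (\<Sum>j\<in>UNIV. norm (\<gamma> $ j $ k) * x j)"
      using 1 by (intro mult_left_mono) auto
    also have "\<dots> = (\<Sum>j\<in>UNIV. \<kappa> * norm (\<gamma> $ j $ k) * x j)" by (simp add: sum_distrib_left mult.assoc)
    also have "\<dots> \<le> Re (hl_lin x k)" unfolding Re_hl_lin by (intro sum_mono mult_right_mono 3 x)
    finally show ?thesis .
  qed
  with 1 2 show ?thesis using that by blast
qed

lemma Re_hl_lin_pos:
  assumes "\<And>j. x j > 0" "norm (\<xi> $ k) = 1"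
  shows "Re (hl_lin x k) > 0"
proof -
  obtain i where i: "\<gamma> $ i $ k \<noteq> 0" using \<gamma>_nonzero by blast
  have "0 < Re (\<gamma> $ i $ k) * x i" using Re_\<gamma>_pos[OF assms(2) i] assms(1) by simp
  also have "\<dots> \<le> Re (hl_lin x k)" using assms(1) by (intro Re_hl_lin_ge) (simp add: less_imp_le)
  finally show ?thesis .
qed

section \<open>The integrand with 1 - c divided out\<close>

definition des_normalized :: "complex^'d \<Rightarrow> real \<Rightarrow> real \<Rightarrow> real^'d \<Rightarrow> complex" where
  "des_normalized s c \<epsilon> t = (\<Prod>j\<in>UNIV. hankel_weight \<epsilon> (t $ j) (s $ j) (\<beta> $ j)) *
     (\<Prod>k\<in>UNIV. des_quotient (\<xi> $ k) c (hankel_lin \<gamma> \<epsilon> t k))"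

text \<open>The exponentials of \<gamma>_jk x_j, grouped by j in the integrand, regroup by k into
  the product of the e^(y_k) built into \<open>des_quotient\<close>.\<close>

lemma des_integrand_eq:
  assumes "c \<noteq> 1"
  shows "des_integrand \<xi> \<gamma> \<beta> s c \<epsilon> t = (\<Prod>k\<in>UNIV. 1 - hl_delta \<xi> k * of_real c) * des_normalized s c \<epsilon> t"
proof -
  have split: "exp (((\<Sum>k\<in>UNIV. \<gamma> $ j $ k) - \<beta> $ j) * hankel \<epsilon> (t $ j)) =
    exp (\<Sum>k\<in>UNIV. \<gamma> $ j $ k * hankel \<epsilon> (t $ j)) * exp (- \<beta> $ j * hankel \<epsilon> (t $ j))" for j
    by (simp add: mult_exp_exp left_diff_distrib sum_distrib_right)
  have swap: "(\<Prod>j\<in>UNIV. exp (\<Sum>k\<in>UNIV. \<gamma> $ j $ k * hankel \<epsilon> (t $ j))) = (\<Prod>k\<in>UNIV. exp (hankel_lin \<gamma> \<epsilon> t k))"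
    by (simp add: hankel_lin_def flip: exp_sum) (subst sum.swap, rule refl)
  have quot: "(1 - hl_delta \<xi> k * of_real c) * des_quotient (\<xi> $ k) c y = exp y * des_factor c (\<xi> $ k) y" for k y
    using assms by (simp add: hl_delta_def des_quotient_def)
  have "(\<Prod>k\<in>UNIV. 1 - hl_delta \<xi> k * of_real c) * des_normalized s c \<epsilon> t =
    (\<Prod>j\<in>UNIV. hankel_weight \<epsilon> (t $ j) (s $ j) (\<beta> $ j)) *
      (\<Prod>k\<in>UNIV. (1 - hl_delta \<xi> k * of_real c) * des_quotient (\<xi> $ k) c (hankel_lin \<gamma> \<epsilon> t k))"
    by (simp add: des_normalized_def prod.distrib mult_ac)
  also have "\<dots> = (\<Prod>j\<in>UNIV. hankel_weight \<epsilon> (t $ j) (s $ j) (\<beta> $ j)) *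
      ((\<Prod>k\<in>UNIV. exp (hankel_lin \<gamma> \<epsilon> t k)) * (\<Prod>k\<in>UNIV. des_factor c (\<xi> $ k) (hankel_lin \<gamma> \<epsilon> t k)))"
    by (simp add: quot prod.distrib)
  also have "\<dots> = des_integrand \<xi> \<gamma> \<beta> s c \<epsilon> t"
    unfolding des_integrand_def split swap[symmetric] by (simp add: hankel_weight_def prod.distrib mult_ac)
  finally show ?thesis by simp
qed

text \<open>With this rate the growth allowed to all factors together consumes at most half of the
  decay e^(-\<beta>0 x_j) in each coordinate.\<close>

definition \<eta>0 :: real where "\<eta>0 = min 1 (\<beta>0 / 2 / \<gamma>_size)"

lemma \<eta>0: "0 < \<eta>0" "\<eta>0 \<le> 1" "\<eta>0 * \<gamma>_size \<le> \<beta>0 / 2"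
proof -
  show "0 < \<eta>0" "\<eta>0 \<le> 1" using \<beta>0(1) \<gamma>_size_ge_1 by (auto simp: \<eta>0_def)
  have "\<eta>0 * \<gamma>_size \<le> \<beta>0 / 2 / \<gamma>_size * \<gamma>_size"
    using \<gamma>_size_ge_1 by (intro mult_right_mono) (auto simp: \<eta>0_def)
  then show "\<eta>0 * \<gamma>_size \<le> \<beta>0 / 2" using \<gamma>_size_ge_1 by simp
qed

lemma prod_exp_hankel_lin_le:
  assumes "\<epsilon> \<ge> 0"
  shows "(\<Prod>k\<in>UNIV. exp (\<eta>0 * norm (hankel_lin \<gamma> \<epsilon> t k))) \<le> (\<Prod>j\<in>UNIV. exp (\<beta>0 / 2 * hankel_abs \<epsilon> (t $ j)))"
proof -
  have S: "(\<Sum>j\<in>UNIV. hankel_abs \<epsilon> (t $ j)) \<ge> 0" using assms by (intro sum_nonneg hankel_abs_nonneg)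
  have "\<eta>0 * (\<Sum>k\<in>UNIV. norm (hankel_lin \<gamma> \<epsilon> t k)) \<le> \<eta>0 * (\<gamma>_size * (\<Sum>j\<in>UNIV. hankel_abs \<epsilon> (t $ j)))"
    using \<eta>0(1) by (intro mult_left_mono sum_norm_hankel_lin_le assms) auto
  also have "\<dots> \<le> \<beta>0 / 2 * (\<Sum>j\<in>UNIV. hankel_abs \<epsilon> (t $ j))"
    using mult_right_mono[OF \<eta>0(3) S] by (simp add: mult.assoc)
  finally show ?thesis by (simp only: exp_sum[OF finite, symmetric] sum_distrib_left[symmetric] exp_le_cancel_iff)
qed

lemma norm_des_normalized_le:
  "\<exists>K>0. \<exists>\<rho>>0. \<rho> \<le> 1 \<and> (\<forall>s c \<epsilon> t. c \<noteq> 1 \<and> \<bar>c - 1\<bar> < \<rho> \<and> 0 < \<epsilon> \<and> \<epsilon> < \<rho> \<longrightarrow>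
    norm (des_normalized s c \<epsilon> t) \<le>
      K * (\<Prod>j\<in>UNIV. norm (hankel_weight \<epsilon> (t $ j) (s $ j) (\<beta> $ j)) * exp (\<beta>0 / 2 * hankel_abs \<epsilon> (t $ j))))"
proof -
  obtain \<kappa> where \<kappa>: "0 < \<kappa>" "\<kappa> \<le> 1"
    "\<And>x k. (\<And>j. x j \<ge> 0) \<Longrightarrow> norm (\<xi> $ k) = 1 \<Longrightarrow> \<kappa> * norm (hl_lin x k) \<le> Re (hl_lin x k)"
    using sector_constant by blast
  have "\<forall>k. \<exists>K \<rho>. K > 0 \<and> \<rho> > 0 \<and> (\<forall>c y y'. c \<noteq> 1 \<and> \<bar>c - 1\<bar> < \<rho> \<and> norm (y - y') < \<rho> \<and> Re y' \<ge> 0 \<and>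
    (norm (\<xi> $ k) = 1 \<longrightarrow> Re y' \<ge> \<kappa> * norm y') \<longrightarrow> norm (des_quotient (\<xi> $ k) c y) \<le> K * exp (\<eta>0 * norm y))"
    using des_quotient_bound[OF norm_\<xi> \<kappa>(1,2) \<eta>0(1,2)] by blast
  then obtain K \<rho> where K: "\<And>k. K k > 0" "\<And>k. \<rho> k > 0"
    and bd: "\<And>k c y y'. c \<noteq> 1 \<Longrightarrow> \<bar>c - 1\<bar> < \<rho> k \<Longrightarrow> norm (y - y') < \<rho> k \<Longrightarrow> Re y' \<ge> 0 \<Longrightarrow>
      (norm (\<xi> $ k) = 1 \<Longrightarrow> Re y' \<ge> \<kappa> * norm y') \<Longrightarrow> norm (des_quotient (\<xi> $ k) c y) \<le> K k * exp (\<eta>0 * norm y)"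
    by metis
  define \<rho>1 where "\<rho>1 = Min (range \<rho>)"
  have \<rho>1: "\<rho>1 > 0" "\<And>k. \<rho>1 \<le> \<rho> k" unfolding \<rho>1_def using K(2) by auto
  \<comment> \<open>Passing from radius 0 to radius \<epsilon> moves each y_k by at most
    \<open>\<gamma>_size * \<epsilon>\<close>, which thus stays below \<rho>1.\<close>
  define \<rho>2 where "\<rho>2 = min 1 (\<rho>1 / \<gamma>_size)"
  have "\<rho>1 / \<gamma>_size \<le> \<rho>1 / 1" using \<rho>1(1) \<gamma>_size_ge_1 by (intro divide_left_mono) auto
  then have \<rho>2: "\<rho>2 > 0" "\<rho>2 \<le> 1" "\<rho>2 \<le> \<rho>1" "\<rho>2 \<le> \<rho>1 / \<gamma>_size"
    using \<rho>1(1) \<gamma>_size_ge_1 by (auto simp: \<rho>2_def)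
  define K1 where "K1 = (\<Prod>k\<in>UNIV. K k)"
  have K1: "K1 > 0" unfolding K1_def using K(1) by (intro prod_pos) auto
  have "norm (des_normalized s c \<epsilon> t) \<le>
      K1 * (\<Prod>j\<in>UNIV. norm (hankel_weight \<epsilon> (t $ j) (s $ j) (\<beta> $ j)) * exp (\<beta>0 / 2 * hankel_abs \<epsilon> (t $ j)))"
    if c: "c \<noteq> 1" "\<bar>c - 1\<bar> < \<rho>2" and \<epsilon>: "0 < \<epsilon>" "\<epsilon> < \<rho>2" for s c \<epsilon> t
  proof -
    have q: "norm (des_quotient (\<xi> $ k) c (hankel_lin \<gamma> \<epsilon> t k)) \<le> K k * exp (\<eta>0 * norm (hankel_lin \<gamma> \<epsilon> t k))" for k
    proof (rule bd[of c k _ "hankel_lin \<gamma> 0 t k"])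
      show "c \<noteq> 1" by fact
      show "\<bar>c - 1\<bar> < \<rho> k" using c \<rho>2(3) \<rho>1(2)[of k] by linarith
      have "norm (hankel_lin \<gamma> \<epsilon> t k - hankel_lin \<gamma> 0 t k) \<le> \<gamma>_size * \<epsilon>"
        using \<epsilon> by (intro norm_hankel_lin_diff_le) auto
      also have "\<dots> < \<gamma>_size * (\<rho>1 / \<gamma>_size)"
        using \<epsilon> \<rho>2(4) \<gamma>_size_ge_1 by (intro mult_strict_left_mono) auto
      also have "\<dots> = \<rho>1" using \<gamma>_size_ge_1 by simp
      finally show "norm (hankel_lin \<gamma> \<epsilon> t k - hankel_lin \<gamma> 0 t k) < \<rho> k" using \<rho>1(2)[of k] by linarith
      show "Re (hankel_lin \<gamma> 0 t k) \<ge> 0" unfolding hankel_lin_0 by (intro Re_hl_lin_nonneg hankel_abs_nonneg) auto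
      show "norm (\<xi> $ k) = 1 \<Longrightarrow> \<kappa> * norm (hankel_lin \<gamma> 0 t k) \<le> Re (hankel_lin \<gamma> 0 t k)"
        unfolding hankel_lin_0 by (intro \<kappa>(3) hankel_abs_nonneg) auto
    qed
    have "(\<Prod>k\<in>UNIV. norm (des_quotient (\<xi> $ k) c (hankel_lin \<gamma> \<epsilon> t k))) \<le> (\<Prod>k\<in>UNIV. K k * exp (\<eta>0 * norm (hankel_lin \<gamma> \<epsilon> t k)))"
      using q by (intro prod_mono) auto
    also have "\<dots> = K1 * (\<Prod>k\<in>UNIV. exp (\<eta>0 * norm (hankel_lin \<gamma> \<epsilon> t k)))"
      by (simp add: prod.distrib K1_def)
    also have "\<dots> \<le> K1 * (\<Prod>j\<in>UNIV. exp (\<beta>0 / 2 * hankel_abs \<epsilon> (t $ j)))"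
      using K1 \<epsilon> by (intro mult_left_mono prod_exp_hankel_lin_le) auto
    finally have "norm (des_normalized s c \<epsilon> t) \<le> (\<Prod>j\<in>UNIV. norm (hankel_weight \<epsilon> (t $ j) (s $ j) (\<beta> $ j))) *
       (K1 * (\<Prod>j\<in>UNIV. exp (\<beta>0 / 2 * hankel_abs \<epsilon> (t $ j))))"
      unfolding des_normalized_def norm_mult prod_norm[symmetric] by (intro mult_left_mono prod_nonneg) auto
    then show ?thesis by (simp add: prod.distrib mult_ac)
  qed
  with K1 \<rho>2 show ?thesis by blast
qed

definition des_limit_integrand :: "complex^'d \<Rightarrow> real^'d \<Rightarrow> complex" where
  "des_limit_integrand s t = (\<Prod>j\<in>UNIV. hankel_weight 0 (t $ j) (s $ j) (\<beta> $ j)) *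
     (\<Prod>k\<in>UNIV. hl_des_limit (\<xi> $ k) (hankel_lin \<gamma> 0 t k))"

lemma off_circle_hankel_lin:
  assumes "\<And>j. t $ j < 0 \<or> t $ j > 2 * pi"
  shows "Re (hankel_lin \<gamma> 0 t k) \<ge> 0" "norm (\<xi> $ k) = 1 \<Longrightarrow> Re (hankel_lin \<gamma> 0 t k) > 0"
proof -
  have pos: "hankel_abs 0 (t $ j) > 0" for j using assms[of j] pi_gt_zero by (auto simp: hankel_abs_def)
  then show "Re (hankel_lin \<gamma> 0 t k) \<ge> 0" "norm (\<xi> $ k) = 1 \<Longrightarrow> Re (hankel_lin \<gamma> 0 t k) > 0"
    unfolding hankel_lin_0 by (auto intro!: Re_hl_lin_nonneg Re_hl_lin_pos simp: less_imp_le)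
qed

lemma on_circle_hankel_weight_0: "\<not> (t < 0 \<or> t > 2 * pi) \<Longrightarrow> hankel_weight 0 t s b = 0"
  by (simp add: hankel_weight_def hankel_deriv_def)

lemma tendsto_des_normalized:
  assumes s: "\<And>j. Re (s $ j) \<ge> 1"
    and c: "cn \<longlonglongrightarrow> 1" "\<And>n. cn n \<noteq> 1" and e: "en \<longlonglongrightarrow> 0" "\<And>n. en n > 0"
  shows "(\<lambda>n. des_normalized s (cn n) (en n) t) \<longlonglongrightarrow> des_limit_integrand s t"
proof (cases "\<forall>j. t $ j < 0 \<or> t $ j > 2 * pi")
  case True
  have "(\<lambda>n. hankel_lin \<gamma> (en n) t k) \<longlonglongrightarrow> hankel_lin \<gamma> 0 t k" for k
    unfolding hankel_lin_def hankel_0 by (intro tendsto_intros tendsto_hankel e)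
  then show ?thesis
    unfolding des_normalized_def des_limit_integrand_def using True
    by (intro tendsto_mult tendsto_prod tendsto_hankel_weight tendsto_des_quotient e s c norm_\<xi>
        off_circle_hankel_lin) auto
next
  case False
  then obtain i where i: "\<not> (t $ i < 0 \<or> t $ i > 2 * pi)" by blast
  obtain K \<rho> where K: "K > 0" "\<rho> > 0" and bd: "\<And>s c \<epsilon> t. c \<noteq> 1 \<Longrightarrow> \<bar>c - 1\<bar> < \<rho> \<Longrightarrow> 0 < \<epsilon> \<Longrightarrow> \<epsilon> < \<rho> \<Longrightarrow>
    norm (des_normalized s c \<epsilon> t) \<le>
      K * (\<Prod>j\<in>UNIV. norm (hankel_weight \<epsilon> (t $ j) (s $ j) (\<beta> $ j)) * exp (\<beta>0 / 2 * hankel_abs \<epsilon> (t $ j)))"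
    using norm_des_normalized_le by blast
  define B where "B = (\<lambda>\<epsilon>. K * (\<Prod>j\<in>UNIV. norm (hankel_weight \<epsilon> (t $ j) (s $ j) (\<beta> $ j)) * exp (\<beta>0 / 2 * hankel_abs \<epsilon> (t $ j))))"
  have ha: "(\<lambda>n. hankel_abs (en n) u) \<longlonglongrightarrow> hankel_abs 0 u" for u
    using e unfolding hankel_abs_def by (auto intro!: tendsto_eq_intros)
  have "(\<lambda>n. B (en n)) \<longlonglongrightarrow> B 0"
    unfolding B_def by (intro tendsto_intros tendsto_hankel_weight e s ha)
  moreover have "B 0 = 0"
    unfolding B_def using i on_circle_hankel_weight_0[OF i] by (auto simp: prod_zero_iff)
  ultimately have B: "(\<lambda>n. B (en n)) \<longlonglongrightarrow> 0" by simp
  have "\<forall>\<^sub>F n in sequentially. dist (cn n) 1 < \<rho>" using tendstoD[OF c(1) K(2)] .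
  moreover have "\<forall>\<^sub>F n in sequentially. en n < \<rho>" using order_tendstoD(2)[OF e(1) K(2)] .
  ultimately have "\<forall>\<^sub>F n in sequentially. norm (des_normalized s (cn n) (en n) t) \<le> B (en n)"
    unfolding B_def by eventually_elim (intro bd c e, auto simp: dist_real_def)
  then have "(\<lambda>n. des_normalized s (cn n) (en n) t) \<longlonglongrightarrow> 0"
    using B by (rule Lim_null_comparison)
  moreover have "des_limit_integrand s t = 0"
    unfolding des_limit_integrand_def using on_circle_hankel_weight_0[OF i] by (auto simp: prod_zero_iff)
  ultimately show ?thesis by simp
qed

lemma integrable_prod_exp_abs:
  assumes "b > 0"
  shows "integrable lborel (\<lambda>t::real^'d. K * (\<Prod>j\<in>UNIV. exp (- (b * \<bar>t $ j\<bar>))))"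
proof -
  have "has_bochner_integral lborel (\<lambda>t::real^'d. \<Prod>j\<in>UNIV. exp (- (b * \<bar>t $ j\<bar>))) (\<Prod>j\<in>(UNIV::'d set). integral\<^sup>L lborel (\<lambda>t. exp (- (b * \<bar>t\<bar>))))"
    using integrable_exp_minus_abs[OF assms] by (intro has_bochner_integral_lborel_vec_prod) (auto simp: has_bochner_integral_iff)
  then show ?thesis by (auto simp: has_bochner_integral_iff)
qed

text \<open>Dominated convergence along joint sequences of c and of radii. Measurability of the
  limit integrand is recorded too, since it is inherited from the approximating integrands and
  serves the second limit passage.\<close>

lemma des_integral_limit:
  assumes s: "\<And>j. Re (s $ j) \<ge> 1"
    and c: "cn \<longlonglongrightarrow> 1" "\<And>n. cn n \<noteq> 1" and e: "en \<longlonglongrightarrow> 0" "\<And>n. en n > 0"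
    and I: "\<And>n. has_bochner_integral lborel (des_integrand \<xi> \<gamma> \<beta> s (cn n) (en n)) (I n)"
  shows "(\<lambda>n. 1 / (\<Prod>k\<in>UNIV. 1 - hl_delta \<xi> k * of_real (cn n)) * I n) \<longlonglongrightarrow> integral\<^sup>L lborel (des_limit_integrand s)"
    and "des_limit_integrand s \<in> borel_measurable lborel"
proof -
  define P where "P = (\<lambda>n. \<Prod>k\<in>UNIV. 1 - hl_delta \<xi> k * complex_of_real (cn n))"
  have P: "P n \<noteq> 0" for n using c(2)[of n] by (auto simp: P_def prod_zero_iff hl_delta_def)
  have F: "has_bochner_integral lborel (des_normalized s (cn n) (en n)) (1 / P n * I n)" for n
  proof -
    have "has_bochner_integral lborel (\<lambda>t. 1 / P n * des_integrand \<xi> \<gamma> \<beta> s (cn n) (en n) t) (1 / P n * I n)"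
      by (intro has_bochner_integral_mult_right I)
    also have "(\<lambda>t. 1 / P n * des_integrand \<xi> \<gamma> \<beta> s (cn n) (en n) t) = des_normalized s (cn n) (en n)"
      using P[of n] by (simp add: des_integrand_eq[OF c(2)] P_def)
    finally show ?thesis .
  qed
  have meas: "des_normalized s (cn n) (en n) \<in> borel_measurable lborel" for n
    using F[of n] by (auto simp: has_bochner_integral_iff)
  have lim: "(\<lambda>n. des_normalized s (cn n) (en n) t) \<longlonglongrightarrow> des_limit_integrand s t" for t
    by (rule tendsto_des_normalized[OF s c e])
  show m: "des_limit_integrand s \<in> borel_measurable lborel"
    by (rule borel_measurable_LIMSEQ_metric[OF meas lim])
  obtain K \<rho> where K: "K > 0" "\<rho> > 0" "\<rho> \<le> 1" and bd: "\<And>s c \<epsilon> t. c \<noteq> 1 \<Longrightarrow> \<bar>c - 1\<bar> < \<rho> \<Longrightarrow> 0 < \<epsilon> \<Longrightarrow> \<epsilon> < \<rho> \<Longrightarrow>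
    norm (des_normalized s c \<epsilon> t) \<le>
      K * (\<Prod>j\<in>UNIV. norm (hankel_weight \<epsilon> (t $ j) (s $ j) (\<beta> $ j)) * exp (\<beta>0 / 2 * hankel_abs \<epsilon> (t $ j)))"
    using norm_des_normalized_le by blast
  \<comment> \<open>The decay budget: \<beta>0 / 2 pays for the factors, and twice \<beta>0 / 4 for
    the power of the modulus and for integrability.\<close>
  have "\<exists>K>0. \<forall>\<epsilon> t. 0 < \<epsilon> \<and> \<epsilon> \<le> 1 \<longrightarrow>
    norm (hankel_weight \<epsilon> t (s $ j) (\<beta> $ j)) * exp (\<beta>0 / 2 * hankel_abs \<epsilon> t) \<le> K * exp (- (\<beta>0 / 4 * \<bar>t\<bar>))" for j
    using s \<beta>0(1) \<beta>0(2)[of j] by (intro hankel_weight_bound) auto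
  then obtain A where A: "\<And>j. A j > 0" "\<And>j \<epsilon> t. 0 < \<epsilon> \<Longrightarrow> \<epsilon> \<le> 1 \<Longrightarrow>
    norm (hankel_weight \<epsilon> t (s $ j) (\<beta> $ j)) * exp (\<beta>0 / 2 * hankel_abs \<epsilon> t) \<le> A j * exp (- (\<beta>0 / 4 * \<bar>t\<bar>))"
    by metis
  define W where "W = (\<lambda>t::real^'d. K * (\<Prod>j\<in>UNIV. A j) * (\<Prod>j\<in>UNIV. exp (- (\<beta>0 / 4 * \<bar>t $ j\<bar>))))"
  have W: "integrable lborel W" unfolding W_def using \<beta>0(1) by (intro integrable_prod_exp_abs) auto
  have bdW: "norm (des_normalized s (cn n) (en n) t) \<le> W t" if "\<bar>cn n - 1\<bar> < \<rho>" "en n < \<rho>" for n t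
  proof -
    have "norm (des_normalized s (cn n) (en n) t) \<le>
      K * (\<Prod>j\<in>UNIV. norm (hankel_weight (en n) (t $ j) (s $ j) (\<beta> $ j)) * exp (\<beta>0 / 2 * hankel_abs (en n) (t $ j)))"
      by (rule bd) (use that c e in auto)
    also have "\<dots> \<le> K * (\<Prod>j\<in>UNIV. A j * exp (- (\<beta>0 / 4 * \<bar>t $ j\<bar>)))"
      using K that e(2)[of n] by (intro mult_left_mono prod_mono conjI A) auto
    finally show ?thesis by (simp add: W_def prod.distrib mult.assoc)
  qed
  have "\<forall>\<^sub>F n in sequentially. dist (cn n) 1 < \<rho> \<and> en n < \<rho>"
    using tendstoD[OF c(1) K(2)] order_tendstoD(2)[OF e(1) K(2)] by eventually_elim auto
  \<comment> \<open>The majorant holds only eventually, so the sequence is shifted by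
    \<open>n0\<close>.\<close>
  then obtain n0 where n0: "\<And>n. n \<ge> n0 \<Longrightarrow> \<bar>cn n - 1\<bar> < \<rho> \<and> en n < \<rho>"
    by (auto simp: eventually_sequentially dist_real_def)
  have "(\<lambda>n. integral\<^sup>L lborel (des_normalized s (cn (n + n0)) (en (n + n0)))) \<longlonglongrightarrow> integral\<^sup>L lborel (des_limit_integrand s)"
    by (rule integral_dominated_convergence[where w = W and s = "\<lambda>n. des_normalized s (cn (n + n0)) (en (n + n0))"])
       (use m meas W bdW n0 LIMSEQ_ignore_initial_segment[OF lim] in auto)
  then have "(\<lambda>n. 1 / P (n + n0) * I (n + n0)) \<longlonglongrightarrow> integral\<^sup>L lborel (des_limit_integrand s)"
    using F by (simp add: has_bochner_integral_iff)
  then show "(\<lambda>n. 1 / (\<Prod>k\<in>UNIV. 1 - hl_delta \<xi> k * of_real (cn n)) * I n) \<longlonglongrightarrow> integral\<^sup>L lborel (des_limit_integrand s)"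
    unfolding P_def by (rule LIMSEQ_offset)
qed

section \<open>Truncated series and their majorant\<close>

definition des_partial :: "complex^'d \<Rightarrow> nat \<Rightarrow> real^'d \<Rightarrow> complex" where
  "des_partial s N t = (\<Prod>j\<in>UNIV. hankel_weight 0 (t $ j) (s $ j) (\<beta> $ j)) *
     (\<Prod>k\<in>UNIV. \<Sum>m<N. hl_des_term (\<xi> $ k) m (hankel_lin \<gamma> 0 t k))"

lemma tendsto_des_partial: "(\<lambda>N. des_partial s N t) \<longlonglongrightarrow> des_limit_integrand s t"
proof (cases "\<forall>j. t $ j < 0 \<or> t $ j > 2 * pi")
  case True
  have "(\<lambda>N. \<Sum>m<N. hl_des_term (\<xi> $ k) m (hankel_lin \<gamma> 0 t k)) \<longlonglongrightarrow> hl_des_limit (\<xi> $ k) (hankel_lin \<gamma> 0 t k)" for k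
    using sums_hl_des_term[OF norm_\<xi>[of k], of "hankel_lin \<gamma> 0 t k"] off_circle_hankel_lin[of t k] True
    by (simp add: sums_def)
  then show ?thesis unfolding des_partial_def des_limit_integrand_def by (intro tendsto_intros)
next
  case False
  then obtain i where "hankel_weight 0 (t $ i) (s $ i) (\<beta> $ i) = 0" using on_circle_hankel_weight_0 by blast
  then have P0: "(\<Prod>j\<in>UNIV. hankel_weight 0 (t $ j) (s $ j) (\<beta> $ j)) = 0" by (auto simp: prod_zero_iff)
  show ?thesis unfolding des_partial_def des_limit_integrand_def P0 by simp
qed

text \<open>Each factor costs a constant times 1 + 1 / Re y_k, and Re y_k dominates a multiple of
  some x_i. The r factors together are bounded by r-th powers of the 1 + 1 / x_j, which
  \<open>hankel_weight_0_bound\<close> absorbs since Re s_j >= 1 + r.\<close>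

lemma norm_des_partial_le:
  assumes s: "\<And>j. Re (s $ j) \<ge> 1 + real CARD('r)"
  shows "\<exists>K. \<forall>N t. norm (des_partial s N t) \<le> K * (\<Prod>j\<in>UNIV. exp (- (\<beta>0 / 4 * \<bar>t $ j\<bar>)))"
proof -
  obtain \<kappa> where \<kappa>: "0 < \<kappa>" "\<kappa> \<le> 1"
    "\<And>x k. (\<And>j. x j \<ge> 0) \<Longrightarrow> norm (\<xi> $ k) = 1 \<Longrightarrow> \<kappa> * norm (hl_lin x k) \<le> Re (hl_lin x k)"
    using sector_constant by blast
  have "\<forall>k. \<exists>K>0. \<forall>N y. Re y \<ge> 0 \<and> (norm (\<xi> $ k) = 1 \<longrightarrow> Re y > 0 \<and> Re y \<ge> \<kappa> * norm y) \<longrightarrow>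
    norm (\<Sum>m<N. hl_des_term (\<xi> $ k) m y) \<le> K * (if norm (\<xi> $ k) = 1 then 1 + 1 / Re y else 1) * exp (\<eta>0 * norm y)"
    using sum_hl_des_term_bound[OF norm_\<xi> \<kappa>(1,2) \<eta>0(1,2)] by blast
  then obtain K where K: "\<And>k. K k > 0"
    and bd: "\<And>k N y. Re y \<ge> 0 \<Longrightarrow> (norm (\<xi> $ k) = 1 \<Longrightarrow> Re y > 0 \<and> Re y \<ge> \<kappa> * norm y) \<Longrightarrow>
    norm (\<Sum>m<N. hl_des_term (\<xi> $ k) m y) \<le> K k * (if norm (\<xi> $ k) = 1 then 1 + 1 / Re y else 1) * exp (\<eta>0 * norm y)"
    by metis
  obtain i where i: "\<And>k. \<gamma> $ i k $ k \<noteq> 0" using \<gamma>_nonzero by metis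
  define G where "G = (\<lambda>k. max 1 (1 / Re (\<gamma> $ i k $ k)))"
  have G: "G k \<ge> 1" for k by (simp add: G_def)
  have "\<exists>K>0. \<forall>t. norm (hankel_weight 0 t (s $ j) (\<beta> $ j)) * exp (\<beta>0 / 2 * hankel_abs 0 t) *
      (1 + 1 / hankel_abs 0 t) ^ CARD('r) \<le> K * exp (- (\<beta>0 / 4 * \<bar>t\<bar>))" for j
    using s[of j] \<beta>0(1) \<beta>0(2)[of j] by (intro hankel_weight_0_bound) auto
  then obtain A where A: "\<And>j. A j > 0" "\<And>j t. norm (hankel_weight 0 t (s $ j) (\<beta> $ j)) * exp (\<beta>0 / 2 * hankel_abs 0 t) *
      (1 + 1 / hankel_abs 0 t) ^ CARD('r) \<le> A j * exp (- (\<beta>0 / 4 * \<bar>t\<bar>))"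
    by metis
  define K1 where "K1 = (\<Prod>k\<in>UNIV. K k * G k)"
  have K1: "K1 \<ge> 0" unfolding K1_def using K G by (intro prod_nonneg mult_nonneg_nonneg) (auto simp: less_imp_le order_trans[OF zero_le_one])
  define K2 where "K2 = K1 * (\<Prod>j\<in>UNIV. A j)"
  have K2: "K2 \<ge> 0" unfolding K2_def using K1 A by (intro mult_nonneg_nonneg prod_nonneg) (auto simp: less_imp_le)
  have "norm (des_partial s N t) \<le> K2 * (\<Prod>j\<in>UNIV. exp (- (\<beta>0 / 4 * \<bar>t $ j\<bar>)))" for N t
  proof (cases "\<forall>j. t $ j < 0 \<or> t $ j > 2 * pi")
    case False
    then obtain i where "hankel_weight 0 (t $ i) (s $ i) (\<beta> $ i) = 0" using on_circle_hankel_weight_0 by blast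
    then have P0: "(\<Prod>j\<in>UNIV. hankel_weight 0 (t $ j) (s $ j) (\<beta> $ j)) = 0" by (auto simp: prod_zero_iff)
    show ?thesis unfolding des_partial_def P0 using K2 by (simp add: prod_nonneg)
  next
    case True
    define x where "x = (\<lambda>j. hankel_abs 0 (t $ j))"
    have x: "x j > 0" for j using True[rule_format, of j] pi_gt_zero by (auto simp: hankel_abs_def x_def)
    \<comment> \<open>The coordinate \<open>i k\<close> that controls y_k varies with k; the product
      over all coordinates bounds every case at once.\<close>
    define X where "X = (\<Prod>j\<in>UNIV. 1 + 1 / x j)"
    have X: "1 + 1 / x j \<le> X" for j
    proof -
      have "(1 + 1 / x j) * 1 \<le> (1 + 1 / x j) * (\<Prod>j\<in>UNIV - {j}. 1 + 1 / x j)"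
        using x by (intro mult_left_mono prod_ge_1) (auto simp: less_imp_le add_nonneg_nonneg)
      also have "\<dots> = X" unfolding X_def by (rule prod.remove[symmetric]) auto
      finally show ?thesis by simp
    qed
    have X1: "X \<ge> 1" unfolding X_def using x by (intro prod_ge_1) (auto simp: less_imp_le)
    have lin: "hankel_lin \<gamma> 0 t k = hl_lin x k" for k by (simp add: hankel_lin_0 x_def)
    have q: "norm (\<Sum>m<N. hl_des_term (\<xi> $ k) m (hankel_lin \<gamma> 0 t k)) \<le>
       (K k * G k) * X * exp (\<eta>0 * norm (hankel_lin \<gamma> 0 t k))" for k
    proof -
      have "norm (\<Sum>m<N. hl_des_term (\<xi> $ k) m (hankel_lin \<gamma> 0 t k)) \<le>
        K k * (if norm (\<xi> $ k) = 1 then 1 + 1 / Re (hankel_lin \<gamma> 0 t k) else 1) * exp (\<eta>0 * norm (hankel_lin \<gamma> 0 t k))"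
        unfolding lin using x \<kappa>(3) by (intro bd Re_hl_lin_nonneg conjI Re_hl_lin_pos) (auto simp: less_imp_le)
      also have "(if norm (\<xi> $ k) = 1 then 1 + 1 / Re (hankel_lin \<gamma> 0 t k) else 1) \<le> G k * X"
      proof (cases "norm (\<xi> $ k) = 1")
        case True
        have g: "Re (\<gamma> $ i k $ k) > 0" using Re_\<gamma>_pos[OF True i] .
        have "Re (hl_lin x k) \<ge> Re (\<gamma> $ i k $ k) * x (i k)" using x by (intro Re_hl_lin_ge) (simp add: less_imp_le)
        then have "1 / Re (hl_lin x k) \<le> 1 / (Re (\<gamma> $ i k $ k) * x (i k))"
          using g x by (intro frac_le mult_pos_pos) auto
        also have "\<dots> = 1 / Re (\<gamma> $ i k $ k) * (1 / x (i k))" by simp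
        also have "\<dots> \<le> G k * (1 / x (i k))"
          using x[of "i k"] by (intro mult_right_mono) (auto simp: G_def)
        finally have "1 + 1 / Re (hl_lin x k) \<le> G k * (1 + 1 / x (i k))"
          using G[of k] by (simp add: distrib_left)
        also have "\<dots> \<le> G k * X" using G[of k] by (intro mult_left_mono X) auto
        finally show ?thesis using True by (simp add: lin)
      next
        case False
        then show ?thesis using mult_mono[OF G[of k] X1] G[of k] by simp
      qed
      finally show ?thesis using K[of k] by (simp add: mult.assoc mult_right_mono)
    qed
    have "(\<Prod>k\<in>UNIV. norm (\<Sum>m<N. hl_des_term (\<xi> $ k) m (hankel_lin \<gamma> 0 t k)))
      \<le> (\<Prod>k\<in>UNIV. (K k * G k) * X * exp (\<eta>0 * norm (hankel_lin \<gamma> 0 t k)))"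
      using q by (intro prod_mono) auto
    also have "\<dots> = K1 * X ^ CARD('r) * (\<Prod>k\<in>UNIV. exp (\<eta>0 * norm (hankel_lin \<gamma> 0 t k)))"
      by (simp add: prod.distrib K1_def)
    also have "\<dots> \<le> K1 * X ^ CARD('r) * (\<Prod>j\<in>UNIV. exp (\<beta>0 / 2 * hankel_abs 0 (t $ j)))"
      using K1 X1 by (intro mult_left_mono prod_exp_hankel_lin_le) auto
    finally have "norm (des_partial s N t) \<le> (\<Prod>j\<in>UNIV. norm (hankel_weight 0 (t $ j) (s $ j) (\<beta> $ j))) *
        (K1 * X ^ CARD('r) * (\<Prod>j\<in>UNIV. exp (\<beta>0 / 2 * hankel_abs 0 (t $ j))))"
      unfolding des_partial_def norm_mult prod_norm[symmetric] by (intro mult_left_mono prod_nonneg) auto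
    also have "\<dots> = K1 * (\<Prod>j\<in>UNIV. norm (hankel_weight 0 (t $ j) (s $ j) (\<beta> $ j)) * exp (\<beta>0 / 2 * hankel_abs 0 (t $ j)) *
      (1 + 1 / hankel_abs 0 (t $ j)) ^ CARD('r))"
      by (simp add: prod.distrib X_def x_def prod_power_distrib mult_ac)
    also have "\<dots> \<le> K1 * (\<Prod>j\<in>UNIV. A j * exp (- (\<beta>0 / 4 * \<bar>t $ j\<bar>)))"
      using K1 x by (intro mult_left_mono prod_mono conjI A(2) mult_nonneg_nonneg zero_le_power) (auto simp: x_def less_imp_le)
    finally show ?thesis by (simp add: K2_def prod.distrib mult.assoc)
  qed
  then show ?thesis by blast
qed

section \<open>From integrals to shifted zeta functions\<close>

definition gamma_factor :: "complex^'d \<Rightarrow> complex" where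
  "gamma_factor s = (\<Prod>j\<in>UNIV. (exp (2 * of_real pi * \<i> * s $ j) - 1) * Gamma (s $ j))"

text \<open>The function \<open>f\<close> is kept abstract because this linear combination is formed
  for a single term, for a partial sum and for the zeta function.\<close>

definition hl_term_combination :: "complex^'d^'r \<Rightarrow> (complex^'d \<Rightarrow> complex) \<Rightarrow> complex^'d \<Rightarrow> complex" where
  "hl_term_combination C f s = (\<Sum>(l, n)\<in>Poly_Mapping.keys (hl_G \<xi> \<gamma> \<beta> C).
     Poly_Mapping.lookup (hl_G \<xi> \<gamma> \<beta> C) (l, n) * (\<Prod>j\<in>UNIV. pochhammer (s $ j) (l $ j)) *
     f (\<chi> j. s $ j + of_int (n $ j)))"

text \<open>For fixed m the exponentials e^(-m_k y_k) regroup by coordinate and join e^(-\<beta>_j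
  x_j) to form e^(-z_j x_j) with z_j = \<open>hl_base m j\<close>. Then
  \<open>hl_G_expansion\<close> splits the polynomial factor.\<close>

lemma prod_hl_des_term:
  assumes C: "\<And>m k. (\<Sum>j\<in>UNIV. C $ m $ j * \<gamma> $ j $ k) = (if m = k then 1 else 0)"
  shows "(\<Prod>j\<in>UNIV. hankel_weight 0 (t $ j) (s $ j) (\<beta> $ j)) *
      (\<Prod>k\<in>UNIV. hl_des_term (\<xi> $ k) (m $ k) (hankel_lin \<gamma> 0 t k)) =
    (\<Sum>(l, n)\<in>Poly_Mapping.keys (hl_G \<xi> \<gamma> \<beta> C). Poly_Mapping.lookup (hl_G \<xi> \<gamma> \<beta> C) (l, n) *
      (\<Prod>k\<in>UNIV. \<xi> $ k ^ (m $ k)) *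
      (\<Prod>j\<in>UNIV. hankel_power 0 (t $ j) (s $ j - 1) * hankel_deriv 0 (t $ j) *
        (of_real (hankel_abs 0 (t $ j)) ^ (l $ j) * exp (- hl_base m j * of_real (hankel_abs 0 (t $ j)))) *
        hl_base m j powi (int (l $ j) - n $ j)))"
proof -
  define x where "x = (\<lambda>j. complex_of_real (hankel_abs 0 (t $ j)))"
  define w where "w = (\<lambda>j. hankel_power 0 (t $ j) (s $ j - 1) * hankel_deriv 0 (t $ j))"
  have lin: "hankel_lin \<gamma> 0 t k = (\<Sum>j\<in>UNIV. \<gamma> $ j $ k * x j)" for k
    by (simp add: hankel_lin_def hankel_0 x_def)
  have z: "hl_base m j \<noteq> 0" for j using Re_hl_base_pos[of m j] by auto
  have term_eq: "hl_des_term (\<xi> $ k) (m $ k) y = \<xi> $ k ^ (m $ k) * exp (- of_nat (m $ k) * y) *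
      (1 - hl_delta \<xi> k * of_nat (m $ k + 1) * y)" for k y
    by (simp add: hl_des_term_def hl_delta_def)
  have "(\<Prod>k\<in>UNIV. exp (- of_nat (m $ k) * hankel_lin \<gamma> 0 t k)) =
      exp (\<Sum>k\<in>UNIV. \<Sum>j\<in>UNIV. - (\<gamma> $ j $ k * of_nat (m $ k)) * x j)"
    by (simp add: exp_sum lin sum_distrib_left mult_ac)
  also have "\<dots> = (\<Prod>j\<in>UNIV. exp (- (\<Sum>k\<in>UNIV. \<gamma> $ j $ k * of_nat (m $ k)) * x j))"
    by (subst sum.swap, subst exp_sum[OF finite, symmetric]) (simp add: sum_distrib_right sum_negf)
  finally have 1: "(\<Prod>k\<in>UNIV. exp (- of_nat (m $ k) * hankel_lin \<gamma> 0 t k)) =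
      (\<Prod>j\<in>UNIV. exp (- (\<Sum>k\<in>UNIV. \<gamma> $ j $ k * of_nat (m $ k)) * x j))" .
  have 2: "hankel_weight 0 (t $ j) (s $ j) (\<beta> $ j) * exp (- (\<Sum>k\<in>UNIV. \<gamma> $ j $ k * of_nat (m $ k)) * x j)
     = w j * exp (- hl_base m j * x j)" for j
    by (simp add: hankel_weight_def w_def hankel_0 x_def hl_base_def mult_exp_exp algebra_simps)
  have "(\<Prod>j\<in>UNIV. hankel_weight 0 (t $ j) (s $ j) (\<beta> $ j)) *
      (\<Prod>k\<in>UNIV. hl_des_term (\<xi> $ k) (m $ k) (hankel_lin \<gamma> 0 t k)) =
    (\<Prod>k\<in>UNIV. \<xi> $ k ^ (m $ k)) * (\<Prod>j\<in>UNIV. w j * exp (- hl_base m j * x j)) *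
    (\<Prod>k\<in>UNIV. 1 - hl_delta \<xi> k * of_nat (m $ k + 1) * hankel_lin \<gamma> 0 t k)"
    unfolding term_eq prod.distrib 1 2[symmetric] by (simp only: mult_ac)
  also have "(\<Prod>k\<in>UNIV. 1 - hl_delta \<xi> k * of_nat (m $ k + 1) * hankel_lin \<gamma> 0 t k) =
    (\<Sum>(l, n)\<in>Poly_Mapping.keys (hl_G \<xi> \<gamma> \<beta> C). Poly_Mapping.lookup (hl_G \<xi> \<gamma> \<beta> C) (l, n) *
      (\<Prod>j\<in>UNIV. x j ^ (l $ j) * hl_base m j powi (int (l $ j) - n $ j)))"
    unfolding lin using hl_G_expansion[OF C, of \<beta> m \<xi> x] z by (simp add: hl_base_def)
  finally show ?thesis
    by (simp add: sum_distrib_left case_prod_unfold prod.distrib w_def x_def mult_ac)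
qed

lemma has_bochner_integral_des_partial:
  assumes C: "\<And>m k. (\<Sum>j\<in>UNIV. C $ m $ j * \<gamma> $ j $ k) = (if m = k then 1 else 0)"
    and s: "\<And>j. Re (s $ j) > 0"
  shows "has_bochner_integral lborel (des_partial s N)
    (\<Sum>m\<in>nat_box N. gamma_factor s * hl_term_combination C (\<lambda>s'. hl_term \<xi> \<gamma> \<beta> s' m) s)"
proof -
  let ?T = "\<lambda>m l n (t::real^'d). Poly_Mapping.lookup (hl_G \<xi> \<gamma> \<beta> C) (l, n) *
      (\<Prod>k\<in>UNIV. \<xi> $ k ^ (m $ k)) *
      (\<Prod>j\<in>UNIV. hankel_power 0 (t $ j) (s $ j - 1) * hankel_deriv 0 (t $ j) *
        (of_real (hankel_abs 0 (t $ j)) ^ (l $ j) * exp (- hl_base m j * of_real (hankel_abs 0 (t $ j)))) *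
        hl_base m j powi (int (l $ j) - n $ j))"
  have eq: "des_partial s N = (\<lambda>t. \<Sum>m\<in>nat_box N. \<Sum>p\<in>Poly_Mapping.keys (hl_G \<xi> \<gamma> \<beta> C). ?T m (fst p) (snd p) t)"
    unfolding des_partial_def sum_nat_box_prod[symmetric] sum_distrib_left prod_hl_des_term[OF C]
    by (simp add: case_prod_unfold)
  have T: "has_bochner_integral lborel (?T m l n) (gamma_factor s * (Poly_Mapping.lookup (hl_G \<xi> \<gamma> \<beta> C) (l, n) *
      (\<Prod>j\<in>UNIV. pochhammer (s $ j) (l $ j)) * hl_term \<xi> \<gamma> \<beta> (\<chi> j. s $ j + of_int (n $ j)) m))" for m l n
  proof -
    have z: "hl_base m j \<noteq> 0" for j using Re_hl_base_pos[of m j] by auto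
    have "has_bochner_integral lborel (?T m l n) (Poly_Mapping.lookup (hl_G \<xi> \<gamma> \<beta> C) (l, n) *
      (\<Prod>k\<in>UNIV. \<xi> $ k ^ (m $ k)) *
      (\<Prod>j\<in>UNIV. ((exp (2 * of_real pi * \<i> * s $ j) - 1) * Gamma (s $ j) * pochhammer (s $ j) (l $ j) *
         hl_base m j powr (- s $ j - of_nat (l $ j))) * hl_base m j powi (int (l $ j) - n $ j)))"
      by (intro has_bochner_integral_mult_right has_bochner_integral_lborel_vec_prod
          has_bochner_integral_mult_left has_bochner_integral_hankel_0 s Re_hl_base_pos)
    also have "(\<Prod>j\<in>UNIV. ((exp (2 * of_real pi * \<i> * s $ j) - 1) * Gamma (s $ j) * pochhammer (s $ j) (l $ j) *
         hl_base m j powr (- s $ j - of_nat (l $ j))) * hl_base m j powi (int (l $ j) - n $ j)) =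
      gamma_factor s * (\<Prod>j\<in>UNIV. pochhammer (s $ j) (l $ j)) * (\<Prod>j\<in>UNIV. 1 / hl_base m j powr (s $ j + of_int (n $ j)))"
      unfolding gamma_factor_def prod.distrib[symmetric] by (simp only: mult.assoc powr_mult_powi[OF z])
    finally show ?thesis
      by (simp add: hl_term_def hl_base_def prod_dividef mult_ac)
  qed
  show ?thesis
    unfolding eq hl_term_combination_def case_prod_unfold sum_distrib_left
    by (intro has_bochner_integral_sum) (use T[where l = "fst p" and n = "snd p" for p] in simp)
qed

lemma sum_hl_term_tendsto:
  assumes Z: "is_hl_zeta \<xi> \<gamma> \<beta> Z" and s: "\<And>j. Re (s $ j) \<ge> 2 * real CARD('r)"
  shows "(\<lambda>N. \<Sum>m\<in>nat_box N. hl_term \<xi> \<gamma> \<beta> s m) \<longlonglongrightarrow> Z s"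
proof -
  have sm: "(\<lambda>m. norm (hl_term \<xi> \<gamma> \<beta> s m)) summable_on UNIV"
    by (rule summable_on_norm_hl_term[OF s])
  then have "Z s = infsum (hl_term \<xi> \<gamma> \<beta> s) UNIV" using Z by (simp add: is_hl_zeta_def)
  moreover have "hl_term \<xi> \<gamma> \<beta> s summable_on UNIV" using sm by (rule abs_summable_summable)
  ultimately have "(hl_term \<xi> \<gamma> \<beta> s has_sum Z s) UNIV" by simp
  then show ?thesis unfolding has_sum_def by (rule filterlim_compose[OF _ filterlim_nat_box])
qed

text \<open>The second dominated convergence, now in the truncation. The bound on Re s_j supplies
  the majorant, and \<open>sn\<close> places all shifted arguments where the series converges
  absolutely to \<open>Z\<close>.\<close>

lemma integral_des_limit_integrand:
  assumes C: "\<And>m k. (\<Sum>j\<in>UNIV. C $ m $ j * \<gamma> $ j $ k) = (if m = k then 1 else 0)"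
    and Z: "is_hl_zeta \<xi> \<gamma> \<beta> Z" and s: "\<And>j. Re (s $ j) \<ge> 1 + real CARD('r)"
    and sn: "\<And>l n j. (l, n) \<in> Poly_Mapping.keys (hl_G \<xi> \<gamma> \<beta> C) \<Longrightarrow> Re (s $ j) + of_int (n $ j) \<ge> 2 * real CARD('r)"
    and meas: "des_limit_integrand s \<in> borel_measurable lborel"
  shows "integral\<^sup>L lborel (des_limit_integrand s) = gamma_factor s * hl_term_combination C Z s"
proof -
  have s0: "Re (s $ j) > 0" for j using s[of j] by linarith
  note P = has_bochner_integral_des_partial[OF C s0]
  obtain K where K: "\<And>N t. norm (des_partial s N t) \<le> K * (\<Prod>j\<in>UNIV. exp (- (\<beta>0 / 4 * \<bar>t $ j\<bar>)))"
    using norm_des_partial_le[OF s] by blast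
  have W: "integrable lborel (\<lambda>t::real^'d. K * (\<Prod>j\<in>UNIV. exp (- (\<beta>0 / 4 * \<bar>t $ j\<bar>))))"
    using \<beta>0(1) by (intro integrable_prod_exp_abs) auto
  have "(\<lambda>N. integral\<^sup>L lborel (des_partial s N)) \<longlonglongrightarrow> integral\<^sup>L lborel (des_limit_integrand s)"
    by (rule integral_dominated_convergence[where s = "des_partial s", OF meas _ W])
       (use borel_measurable_has_bochner_integral[OF P] K tendsto_des_partial in auto)
  moreover have "(\<lambda>N. integral\<^sup>L lborel (des_partial s N)) \<longlonglongrightarrow> gamma_factor s * hl_term_combination C Z s"
  proof -
    have "integral\<^sup>L lborel (des_partial s N) = gamma_factor s *
       hl_term_combination C (\<lambda>s'. \<Sum>m\<in>nat_box N. hl_term \<xi> \<gamma> \<beta> s' m) s" for N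
    proof -
      have "integral\<^sup>L lborel (des_partial s N) = gamma_factor s * (\<Sum>m\<in>nat_box N. hl_term_combination C (\<lambda>s'. hl_term \<xi> \<gamma> \<beta> s' m) s)"
        using P[of N] by (simp add: has_bochner_integral_iff sum_distrib_left)
      also have "(\<Sum>m\<in>nat_box N. hl_term_combination C (\<lambda>s'. hl_term \<xi> \<gamma> \<beta> s' m) s) =
        hl_term_combination C (\<lambda>s'. \<Sum>m\<in>nat_box N. hl_term \<xi> \<gamma> \<beta> s' m) s"
        unfolding hl_term_combination_def by (subst sum.swap) (simp add: sum_distrib_left case_prod_unfold)
      finally show ?thesis .
    qed
    moreover have "(\<lambda>N. gamma_factor s * hl_term_combination C (\<lambda>s'. \<Sum>m\<in>nat_box N. hl_term \<xi> \<gamma> \<beta> s' m) s)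
      \<longlonglongrightarrow> gamma_factor s * hl_term_combination C Z s"
      unfolding hl_term_combination_def case_prod_unfold
      by (intro tendsto_mult tendsto_const tendsto_sum sum_hl_term_tendsto[OF Z]) (use sn in auto)
    ultimately show ?thesis by simp
  qed
  ultimately show ?thesis by (rule LIMSEQ_unique)
qed

text \<open>
  Since the contour integral does not depend on a small radius, a radius \<open>e n\<close> can be chosen for
  each \<open>c n\<close>; both limits are then taken by one dominated convergence.
\<close>

lemma desingularization_eq_combination:
  assumes C: "\<And>m k. (\<Sum>j\<in>UNIV. C $ m $ j * \<gamma> $ j $ k) = (if m = k then 1 else 0)"
    and Z: "is_hl_zeta \<xi> \<gamma> \<beta> Z" and D: "is_hl_desingularization \<xi> \<gamma> \<beta> D"
    and s: "\<And>j. Re (s $ j) \<ge> 1 + real CARD('r)" "\<And>j. s $ j \<notin> \<int>"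
    and sn: "\<And>l n j. (l, n) \<in> Poly_Mapping.keys (hl_G \<xi> \<gamma> \<beta> C) \<Longrightarrow> Re (s $ j) + of_int (n $ j) \<ge> 2 * real CARD('r)"
  shows "D s = hl_term_combination C Z s"
proof -
  obtain I where I: "\<forall>\<^sub>F c in at 1. has_des_integral \<xi> \<gamma> \<beta> s c (I c)"
    and lim: "((\<lambda>c. 1 / (\<Prod>k\<in>UNIV. 1 - hl_delta \<xi> k * of_real c) * (1 / gamma_factor s) * I c) \<longlongrightarrow> D s) (at 1)"
    using D s(2) unfolding is_hl_desingularization_def gamma_factor_def by meson
  obtain d where d: "d > 0" "\<And>c. c \<noteq> 1 \<Longrightarrow> dist c 1 < d \<Longrightarrow> has_des_integral \<xi> \<gamma> \<beta> s c (I c)"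
    using I unfolding eventually_at by auto
  \<comment> \<open>The denominator n + 2 keeps the distance to 1 strictly below d, already for n =
    0.\<close>
  define c where "c = (\<lambda>n. 1 + d / real (n + 2))"
  have c1: "c n \<noteq> 1" for n using d(1) by (simp add: c_def)
  have "dist (c n) 1 < d" for n
    using d(1) by (simp add: c_def dist_real_def field_simps add_pos_nonneg)
  then have hd: "has_des_integral \<xi> \<gamma> \<beta> s (c n) (I (c n))" for n using d(2) c1 by blast
  have clim: "c \<longlonglongrightarrow> 1"
    unfolding c_def by real_asymp
  have "\<exists>e. 0 < e \<and> e < 1 / real (Suc n) \<and> has_bochner_integral lborel (des_integrand \<xi> \<gamma> \<beta> s (c n) e) (I (c n))" for n
  proof -
    have "\<forall>\<^sub>F e in at_right 0. has_bochner_integral lborel (des_integrand \<xi> \<gamma> \<beta> s (c n) e) (I (c n))"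
      using hd[of n] unfolding has_des_integral_def by eventually_elim simp
    moreover have "\<forall>\<^sub>F e in at_right (0::real). e \<in> {0<..<1 / real (Suc n)}"
      by (rule eventually_at_right_real) simp
    ultimately have "\<forall>\<^sub>F e in at_right (0::real). 0 < e \<and> e < 1 / real (Suc n) \<and> has_bochner_integral lborel (des_integrand \<xi> \<gamma> \<beta> s (c n) e) (I (c n))"
      by eventually_elim auto
    then show ?thesis using eventually_happens by fastforce
  qed
  then obtain e where e: "\<And>n. 0 < e n" "\<And>n. e n < 1 / real (Suc n)"
    and bi: "\<And>n. has_bochner_integral lborel (des_integrand \<xi> \<gamma> \<beta> s (c n) (e n)) (I (c n))"
    by metis
  have elim: "e \<longlonglongrightarrow> 0"
    by (rule tendsto_sandwich[OF _ _ tendsto_const LIMSEQ_inverse_real_of_nat])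
       (auto intro!: always_eventually less_imp_le e simp flip: divide_inverse_commute simp: inverse_eq_divide simp del: of_nat_Suc)
  have s1: "Re (s $ j) \<ge> 1" for j using s(1)[of j] by linarith
  note L = des_integral_limit[OF s1 clim c1 elim e(1) bi]
  have g0: "gamma_factor s \<noteq> 0"
  proof -
    have "exp (2 * of_real pi * \<i> * s $ j) \<noteq> 1" for j
    proof
      assume "exp (2 * of_real pi * \<i> * s $ j) = 1"
      then obtain n :: int where n: "Re (2 * of_real pi * \<i> * s $ j) = 0" "Im (2 * of_real pi * \<i> * s $ j) = of_int (2 * n) * pi"
        unfolding exp_eq_1 by blast
      then have "s $ j = of_int n" by (simp add: complex_eq_iff)
      then show False using s(2)[of j] by simp
    qed
    moreover have "Gamma (s $ j) \<noteq> 0" for j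
      using s(2)[of j] nonpos_Ints_Int by (auto simp: Gamma_eq_zero_iff)
    ultimately show ?thesis by (simp add: gamma_factor_def prod_zero_iff)
  qed
  have "filterlim c (at 1) sequentially"
    using clim c1 by (simp add: filterlim_at always_eventually)
  from filterlim_compose[OF lim this]
  have "(\<lambda>n. 1 / gamma_factor s * (1 / (\<Prod>k\<in>UNIV. 1 - hl_delta \<xi> k * of_real (c n)) * I (c n))) \<longlonglongrightarrow> D s"
    by (simp add: mult_ac)
  moreover have "(\<lambda>n. 1 / gamma_factor s * (1 / (\<Prod>k\<in>UNIV. 1 - hl_delta \<xi> k * of_real (c n)) * I (c n)))
     \<longlonglongrightarrow> 1 / gamma_factor s * integral\<^sup>L lborel (des_limit_integrand s)"
    by (intro tendsto_mult_left L)
  ultimately have "D s = 1 / gamma_factor s * integral\<^sup>L lborel (des_limit_integrand s)"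
    by (rule LIMSEQ_unique)
  also have "\<dots> = hl_term_combination C Z s"
    using g0 integral_des_limit_integrand[OF C Z s(1) sn L(2)] by simp
  finally show ?thesis .
qed

end

subsection \<open>The identity\<close>

text \<open>One sample suffices: the integral at a single point with nonintegral coordinates, a
  single c and a single small radius already provides a pole-free contour.\<close>

lemma is_hl_desingularization_imp_hl_data:
  fixes \<xi> :: "complex^'r" and \<gamma> :: "complex^'r^'d" and \<beta> :: "complex^'d"
  assumes \<xi>: "\<And>k. norm (\<xi> $ k) \<le> 1" and \<gamma>: "\<And>j k. Re (\<gamma> $ j $ k) \<ge> 0" and \<beta>: "\<And>j. Re (\<beta> $ j) > 0"
    and nz: "\<And>k. \<exists>j. \<gamma> $ j $ k \<noteq> 0" and D: "is_hl_desingularization \<xi> \<gamma> \<beta> D"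
  shows "hl_data \<xi> \<gamma> \<beta>"
proof
  fix j k assume x: "norm (\<xi> $ k) = 1" and g: "\<gamma> $ j $ k \<noteq> 0"
  define s :: "complex^'d" where "s = (\<chi> j. \<i>)"
  have "\<forall>j. s $ j \<notin> \<int>" by (auto simp: s_def Ints_def complex_eq_iff)
  then obtain I where "\<forall>\<^sub>F c in at 1. has_des_integral \<xi> \<gamma> \<beta> s c (I c)"
    using D unfolding is_hl_desingularization_def by meson
  then obtain c where "has_des_integral \<xi> \<gamma> \<beta> s c (I c)"
    using eventually_happens[of _ "at (1::real)"] by auto
  then have "\<forall>\<^sub>F \<epsilon> in at_right 0. hankel_avoids_poles \<xi> \<gamma> c \<epsilon>"
    unfolding has_des_integral_def by eventually_elim simp
  moreover have "\<forall>\<^sub>F \<epsilon> in at_right (0::real). \<epsilon> > 0" by (rule eventually_at_right_less)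
  ultimately have "\<forall>\<^sub>F \<epsilon> in at_right 0. hankel_avoids_poles \<xi> \<gamma> c \<epsilon> \<and> \<epsilon> > 0" by eventually_elim simp
  then obtain \<epsilon> where "hankel_avoids_poles \<xi> \<gamma> c \<epsilon>" "\<epsilon> > 0"
    using eventually_happens[of _ "at_right (0::real)"] by auto
  then show "Re (\<gamma> $ j $ k) > 0"
    using hankel_avoids_poles_imp_Re_pos[OF _ _ x \<gamma> g] by blast
qed (use assms in auto)

theorem theorem2p9:
  fixes \<xi> :: "complex^'r" and \<gamma> :: "complex^'r^'d" and \<beta> :: "complex^'d"
    and C :: "complex^'d^'r" and Z D :: "complex^'d \<Rightarrow> complex"
  assumes "\<And>k. norm (\<xi> $ k) \<le> 1"
    and "\<And>j k. Re (\<gamma> $ j $ k) \<ge> 0"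
    and "\<And>j. Re (\<beta> $ j) > 0"
    and "\<And>j. \<exists>k. Re (\<gamma> $ j $ k) > 0"
    and "\<And>m k. (\<Sum>j\<in>UNIV. C $ m $ j * \<gamma> $ j $ k) = (if m = k then 1 else 0)"
    and "is_hl_zeta \<xi> \<gamma> \<beta> Z"
    and "is_hl_desingularization \<xi> \<gamma> \<beta> D"
  shows "\<forall>s. (\<forall>(l, m)\<in>Poly_Mapping.keys (hl_G \<xi> \<gamma> \<beta> C).
                mv_regular_at Z (\<chi> j. s $ j + of_int (m $ j))) \<longrightarrow>
           D s = (\<Sum>(l, m)\<in>Poly_Mapping.keys (hl_G \<xi> \<gamma> \<beta> C).
                    Poly_Mapping.lookup (hl_G \<xi> \<gamma> \<beta> C) (l, m) *
                    (\<Prod>j\<in>UNIV. pochhammer (s $ j) (l $ j)) *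
                    Z (\<chi> j. s $ j + of_int (m $ j)))"
proof (intro allI impI)
  fix s assume reg: "\<forall>(l, m)\<in>Poly_Mapping.keys (hl_G \<xi> \<gamma> \<beta> C). mv_regular_at Z (\<chi> j. s $ j + of_int (m $ j))"
  \<comment> \<open>The diagonal entry of the relation between \<open>C\<close> and \<gamma> equals
    1, so no column of \<gamma> can vanish.\<close>
  have "\<exists>j. \<gamma> $ j $ k \<noteq> 0" for k
  proof (rule ccontr)
    assume "\<not> ?thesis"
    then have "(\<Sum>j\<in>UNIV. C $ k $ j * \<gamma> $ j $ k) = 0" by simp
    then show False using assms(5)[of k k] by simp
  qed
  then interpret hl_data \<xi> \<gamma> \<beta>
    using assms by (intro is_hl_desingularization_imp_hl_data) auto
  define G where "G = hl_G \<xi> \<gamma> \<beta> C"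
  define shift :: "int^'d \<Rightarrow> complex^'d" where "shift = (\<lambda>m. \<chi> j. of_int (m $ j))"
  have shift: "(\<chi> j. z $ j + of_int (m $ j)) = z + shift m" for z :: "complex^'d" and m
    by (simp add: shift_def vec_eq_iff)
  define co where "co = (\<lambda>p (z::complex^'d). Poly_Mapping.lookup G p * (\<Prod>j\<in>UNIV. pochhammer (z $ j) (fst p $ j)))"
  define f where "f = (\<lambda>z. D z - (\<Sum>p\<in>Poly_Mapping.keys G. co p z * Z (z + shift (snd p))))"
  have comb: "hl_term_combination C Z z = (\<Sum>p\<in>Poly_Mapping.keys G. co p z * Z (z + shift (snd p)))" for z
    by (simp add: hl_term_combination_def G_def co_def shift case_prod_unfold)
  have co: "mv_holomorphic_on (co p) UNIV" for p
    unfolding co_def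
    by (intro mv_holomorphic_on_mult mv_holomorphic_on_const mv_holomorphic_on_prod mv_holomorphic_on_pochhammer) auto
  have D: "mv_holomorphic_on D UNIV" and Z: "mv_meromorphic Z"
    using assms(6,7) by (auto simp: is_hl_desingularization_def is_hl_zeta_def)
  have mero: "mv_meromorphic f"
    unfolding f_def
    by (intro mv_meromorphic_diff mv_meromorphic_holomorphic D mv_meromorphic_sum
        mv_meromorphic_mult_holomorphic co mv_meromorphic_translate Z)
  \<comment> \<open>The double sum bounds every exponent of v in G, so beyond \<open>R\<close> every
    shifted argument stays in the region of absolute convergence.\<close>
  define R where "R = 2 * real CARD('r) + 1 + (\<Sum>p\<in>Poly_Mapping.keys G. \<Sum>j\<in>UNIV. \<bar>of_int (snd p $ j)\<bar>)"
  have R1: "R \<ge> 1 + real CARD('r)" unfolding R_def by (intro add_increasing2 sum_nonneg) auto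
  have R2: "R + of_int (snd p $ j) \<ge> 2 * real CARD('r)" if p: "p \<in> Poly_Mapping.keys G" for p j
  proof -
    have "\<bar>real_of_int (snd p $ j)\<bar> \<le> (\<Sum>j\<in>UNIV. \<bar>of_int (snd p $ j)\<bar>)"
      by (intro member_le_sum) auto
    also have "\<dots> \<le> (\<Sum>p\<in>Poly_Mapping.keys G. \<Sum>j\<in>UNIV. \<bar>of_int (snd p $ j)\<bar>)"
      using p by (intro member_le_sum[of p _ "\<lambda>p. \<Sum>j\<in>UNIV. \<bar>of_int (snd p $ j)\<bar>"]) (auto intro: sum_nonneg)
    finally show ?thesis by (simp add: R_def)
  qed
  \<comment> \<open>Positive imaginary parts exclude integers while keeping the set open and
    nonempty.\<close>
  define T where "T = (\<Inter>j\<in>UNIV. {z::complex^'d. Re (z $ j) > R \<and> Im (z $ j) > 0})"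
  have "open T"
    unfolding T_def by (intro open_INT ballI open_Collect_conj open_Collect_less continuous_intros) auto
  moreover have "(\<chi> j. Complex (R + 1) 1) \<in> T" by (simp add: T_def)
  moreover have "f z = 0" if z: "z \<in> T" for z
  proof -
    have zR: "Re (z $ j) > R" "Im (z $ j) > 0" for j using z by (auto simp: T_def)
    have "z $ j \<notin> \<int>" for j using zR(2)[of j] by (auto simp: Ints_def)
    moreover have "Re (z $ j) + of_int (n $ j) \<ge> 2 * real CARD('r)" if "(l, n) \<in> Poly_Mapping.keys G" for l n j
      using R2[OF that, of j] zR(1)[of j] by simp
    moreover have "Re (z $ j) \<ge> 1 + real CARD('r)" for j using R1 zR(1)[of j] by linarith
    ultimately have "D z = hl_term_combination C Z z"
      by (intro desingularization_eq_combination assms) (auto simp: G_def)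
    then show ?thesis by (simp add: f_def comb)
  qed
  \<comment> \<open>Regularity of \<open>Z\<close> at the shifted points enters only here: it makes
    the value of \<open>f\<close> at \<open>s\<close> the limit of its values nearby.\<close>
  moreover have "isCont f s"
  proof -
    have Dc: "isCont D s"
      using mv_regular_at_imp_isCont D unfolding mv_regular_at_def by blast
    have coc: "isCont (co p) s" for p
      using mv_regular_at_imp_isCont[of "co p" s] co unfolding mv_regular_at_def by blast
    have Zc: "isCont (\<lambda>z. Z (z + shift (snd p))) s" if "p \<in> Poly_Mapping.keys G" for p
    proof -
      have "isCont Z (s + shift (snd p))"
        using reg that mv_regular_at_imp_isCont by (auto simp: G_def shift case_prod_unfold)
      then show ?thesis
        by (intro isCont_o2[where f = "\<lambda>z. z + shift (snd p)" and g = Z] continuous_add continuous_ident continuous_const)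
    qed
    show ?thesis unfolding f_def by (intro continuous_diff continuous_sum continuous_mult Dc coc Zc)
  qed
  ultimately have "f s = 0" using mv_meromorphic_eq_zero[OF mero] by blast
  then show "D s = (\<Sum>(l, m)\<in>Poly_Mapping.keys (hl_G \<xi> \<gamma> \<beta> C).
                    Poly_Mapping.lookup (hl_G \<xi> \<gamma> \<beta> C) (l, m) *
                    (\<Prod>j\<in>UNIV. pochhammer (s $ j) (l $ j)) *
                    Z (\<chi> j. s $ j + of_int (m $ j)))"
    unfolding f_def comb[symmetric] hl_term_combination_def by simp
qed

end
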